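(* For any integer $n\ge2$, any $p\ge1$, any $\alpha\in[0,1]$ and any $\beta\ge0$ with $\beta>\frac{n}{p}-\frac{n-1}{\alpha}$, there is $v\in C^{0,\alpha}(B_1,\mathbb{R}^n)$ with $\deg(v,B_1,\cdot)\notin W^{\beta,p}(\mathbb{R}^n)$, where $B_1\subset\mathbb{R}^n$ is the unit ball. (For $\alpha=0$ the condition on $\beta$ is read with $\frac{n-1}{0}=+\infty$.)
   Context: For $\alpha\in(0,1]$, $C^{0,\alpha}(B_1,\mathbb{R}^n)$ is the space of $\alpha$-Hölder maps on the open unit ball $B_1$; such $v$ extends uniquely to a continuous map on $\overline{B_1}$, still denoted $v$. For $\alpha=0$, $C^{0,0}(B_1,\mathbb{R}^n)$ denotes the maps that extend continuously to $\overline{B_1}$. $\deg(v,B_1,y)$ is the Brouwer degree, defined for $y\in\mathbb{R}^n\setminus v(\partial B_1)$; to regard it as a function on $\mathbb{R}^n$, set it equal to $0$ on $v(\partial B_1)$. $W^{\beta,p}(\mathbb{R}^n)$ is the (fractional) Sobolev space: $W^{0,p}=L^p$; for $0<\beta<1$ it consists of $f\in L^p$ with $\int_{\mathbb{R}^n}\int_{\mathbb{R}^n}\frac{|f(x)-f(y)|^p}{|x-y|^{n+\beta p}}\,dx\,dy<\infty$; for integer $\beta$ it is the usual Sobolev space; for noninteger $\beta=m+s$ with $m\in\mathbb{N}$, $0<s<1$, it consists of $f\in W^{m,p}$ whose derivatives of order $m$ lie in $W^{s,p}$. *)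

theory Defs
  imports "HOL-Analysis.Analysis"
begin

section \<open>Iterated partial derivatives and smooth maps\<close>

definition partial_deriv ::
  "'n \<Rightarrow> (real^'n \<Rightarrow> 'b::real_normed_vector) \<Rightarrow> real^'n \<Rightarrow> 'b" where
  "partial_deriv i f x = frechet_derivative f (at x) (axis i 1)"

text \<open>A derivative of order \<open>k\<close> is indexed by a list of \<open>k\<close> coordinate directions.\<close>

definition partial_derivs ::
  "'n list \<Rightarrow> (real^'n \<Rightarrow> 'b::real_normed_vector) \<Rightarrow> real^'n \<Rightarrow> 'b" where
  "partial_derivs ds f = foldr partial_deriv ds f"

text \<open>\<open>C\<^sup>\<infinity>\<close> on an open set \<open>S\<close>. Differentiability of every iterated partial derivative
  makes all of them continuous.\<close>

definition smooth_on :: "(real^'n) set \<Rightarrow> (real^'n \<Rightarrow> 'b::real_normed_vector) \<Rightarrow> bool" where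
  "smooth_on S f \<longleftrightarrow> (\<forall>ds. \<forall>x\<in>S. partial_derivs ds f differentiable (at x))"

definition test_function :: "(real^'n \<Rightarrow> real) \<Rightarrow> bool" where
  "test_function \<phi> \<longleftrightarrow> smooth_on UNIV \<phi> \<and> compact (closure {x. \<phi> x \<noteq> 0})"


section \<open>Hoelder spaces and the extension to the closure\<close>

text \<open>For bounded open \<open>\<Omega>\<close>; boundedness of \<open>v\<close> is then automatic.
  Values outside \<open>\<Omega>\<close> are irrelevant.\<close>

definition holder_space :: "real \<Rightarrow> (real^'n) set \<Rightarrow> (real^'n \<Rightarrow> real^'m) set" where
  "holder_space \<alpha> \<Omega> =
    (if \<alpha> = 0 then {v. \<exists>u. continuous_on (closure \<Omega>) u \<and> (\<forall>x\<in>\<Omega>. u x = v x)}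
     else {v. \<exists>C. \<forall>x\<in>\<Omega>. \<forall>y\<in>\<Omega>. norm (v x - v y) \<le> C * norm (x - y) powr \<alpha>})"

definition extend_closure :: "(real^'n) set \<Rightarrow> (real^'n \<Rightarrow> real^'m) \<Rightarrow> real^'n \<Rightarrow> real^'m" where
  "extend_closure \<Omega> v x = (if x \<in> \<Omega> then v x else Lim (at x within \<Omega>) v)"


section \<open>The Brouwer degree\<close>

definition jacobian :: "(real^'n \<Rightarrow> real^'n) \<Rightarrow> real^'n \<Rightarrow> real" where
  "jacobian w x = det (matrix (frechet_derivative w (at x)))"

definition regular_value :: "(real^'n \<Rightarrow> real^'n) \<Rightarrow> (real^'n) set \<Rightarrow> real^'n \<Rightarrow> bool" where
  "regular_value w \<Omega> y \<longleftrightarrow> (\<forall>x\<in>\<Omega>. w x = y \<longrightarrow> jacobian w x \<noteq> 0)"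

text \<open>For bounded open \<open>\<Omega>\<close> and \<open>u\<close> continuous on \<open>closure \<Omega>\<close>: the degree at
  \<open>y \<notin> u ` frontier \<Omega>\<close> is the signed number of preimages of \<open>y\<close> under any smooth \<open>w\<close>
  whose uniform distance to \<open>u\<close> is less than the distance of \<open>y\<close> to \<open>u ` frontier \<Omega>\<close>
  and for which \<open>y\<close> is a regular value (then \<open>y\<close> has finitely many preimages).
  By convention it is \<open>0\<close> on \<open>u ` frontier \<Omega>\<close>.\<close>

definition degree_closure :: "(real^'n \<Rightarrow> real^'n) \<Rightarrow> (real^'n) set \<Rightarrow> real^'n \<Rightarrow> int" where
  "degree_closure u \<Omega> y =
    (if y \<in> u ` frontier \<Omega> then 0
     else THE d. \<forall>w. smooth_on \<Omega> w \<and> continuous_on (closure \<Omega>) w \<and>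
            (\<forall>x\<in>closure \<Omega>. norm (w x - u x) < infdist y (u ` frontier \<Omega>)) \<and>
            regular_value w \<Omega> y
          \<longrightarrow> real_of_int d = (\<Sum>x\<in>{x\<in>\<Omega>. w x = y}. sgn (jacobian w x)))"

definition brouwer_deg :: "(real^'n \<Rightarrow> real^'n) \<Rightarrow> (real^'n) set \<Rightarrow> real^'n \<Rightarrow> int" where
  "brouwer_deg v \<Omega> = degree_closure (extend_closure \<Omega> v) \<Omega>"


section \<open>Sobolev spaces on the whole space\<close>

definition Lp_space :: "real \<Rightarrow> (real^'n \<Rightarrow> real) set" where
  "Lp_space p = {f \<in> borel_measurable lebesgue. integrable lebesgue (\<lambda>x. \<bar>f x\<bar> powr p)}"

text \<open>Only used for \<open>f\<close> and \<open>g\<close> in \<open>L\<^sup>p\<close> with \<open>p \<ge> 1\<close>, so that both integrands are integrable.\<close>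

definition weak_deriv :: "'n list \<Rightarrow> (real^'n \<Rightarrow> real) \<Rightarrow> (real^'n \<Rightarrow> real) \<Rightarrow> bool" where
  "weak_deriv ds f g \<longleftrightarrow>
    (\<forall>\<phi>. test_function \<phi> \<longrightarrow>
       (LINT x|lebesgue. f x * partial_derivs ds \<phi> x) =
       (-1) ^ length ds * (LINT x|lebesgue. g x * \<phi> x))"

definition sobolev_int :: "nat \<Rightarrow> real \<Rightarrow> (real^'n \<Rightarrow> real) set" where
  "sobolev_int m p =
    {f \<in> Lp_space p. \<forall>ds. length ds \<le> m \<longrightarrow> (\<exists>g\<in>Lp_space p. weak_deriv ds f g)}"

definition sobolev_frac :: "real \<Rightarrow> real \<Rightarrow> (real^'n \<Rightarrow> real) set" where
  "sobolev_frac s p =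
    {f \<in> Lp_space p.
      (\<integral>\<^sup>+ x. (\<integral>\<^sup>+ y. ennreal (\<bar>f x - f y\<bar> powr p / norm (x - y) powr (real CARD('n) + s * p))
         \<partial>lebesgue) \<partial>lebesgue) < \<infinity>}"

definition sobolev :: "real \<Rightarrow> real \<Rightarrow> (real^'n \<Rightarrow> real) set" where
  "sobolev \<beta> p =
    (if \<beta> \<in> \<int> then sobolev_int (nat \<lfloor>\<beta>\<rfloor>) p
     else if \<beta> < 1 then sobolev_frac \<beta> p
     else {f \<in> sobolev_int (nat \<lfloor>\<beta>\<rfloor>) p.
             \<forall>ds. length ds = nat \<lfloor>\<beta>\<rfloor> \<longrightarrow>
               (\<exists>g\<in>sobolev_frac (frac \<beta>) p. weak_deriv ds f g)})"

end

theory Submission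
  imports Defs
begin

text \<open>For \<open>\<beta> \<ge> 1\<close> the identity works: its degree is the indicator of the unit ball, which has no
  weak derivative in \<open>L\<^sup>p\<close>. For \<open>\<beta> < 1\<close> only the boundary values matter. At level \<open>k\<close> about
  \<open>N k ^ (n - 1)\<close> disjoint boundary patches of size \<open>s k\<close> are each wrapped once around a set of
  size \<open>r k = s k powr \<alpha>\<close> near the origin. This is compatible with the Hoelder bound because the patches are
  disjoint. The degree is then at least \<open>N k ^ (n - 1)\<close> in absolute value on a ball of
  radius comparable to \<open>r k\<close>, and it vanishes on the reflected ball. Level \<open>k\<close> therefore contributes
  \<open>N k ^ ((n - 1) p) * r k powr (n - \<beta> p)\<close> to the seminorm, which is unbounded when \<open>s k\<close> decreases
  fast enough.

  The degree is computed from the integral of \<open>pbump \<epsilon> (w x - y) * det (Dw x)\<close>, a multiple of the signed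
  number of preimages. It depends only on the boundary values of \<open>w\<close>, because the weighted
  determinant is the Jacobian of a composition and Jacobian determinants are null Lagrangians.\<close>

text \<open>The sphere has room for only about s^(1-n) patches of size s, and a Hoelder map can
  stretch each to size s^\<alpha>. With s = \<theta>^k and nearly that many patches, level
  \<open>k\<close> contributes \<theta>^(k(\<alpha>(n - \<beta>p) - (n-1)p)) up to a bounded factor
  per level; the hypothesis on \<beta> says exactly that this exponent of \<theta>^k is negative.
  The seminorm sees only differences, so a large degree must be paired with a comparable set, at
  comparable distance, of degree 0. Hence all patches sit near one pole: no value of the map on the
  closed ball then lies in a narrow cone around that pole. The danger is cancellation. On the part
  of each patch inside the ball the Jacobian is negative wherever the value is nonzero, so coarser
  levels only enlarge the absolute degree, while finer levels have values too small to reach the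
  radius under consideration. Admissible approximants of the degree are smooth only in the open
  ball, so integrals run over closed balls of radius R < 1, beyond which the maps stay away from the
  target. The case \<alpha> = 0 is reduced to a small positive exponent.\<close>

hide_const (open) Polynomial.content

subsection \<open>Change of variables over an arbitrary finite index type\<close>

text \<open>The library theorem asks for a well-ordered index type. It is transferred to \<open>real^'n\<close> along a
  relabelling of the coordinates by a well-ordered copy of \<open>'n\<close>.\<close>

typedef ('a::finite) windex = "{..<CARD('a)}"
  using zero_less_card_finite by blast

instance windex :: (finite) finite
proof
  have "range (Rep_windex :: 'a windex \<Rightarrow> nat) \<subseteq> {..<CARD('a)}"
    using Rep_windex by auto
  then have "finite (range (Rep_windex :: 'a windex \<Rightarrow> nat))"
    by (rule finite_subset) auto
  then show "finite (UNIV :: 'a windex set)"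
    by (rule finite_imageD) (simp add: inj_on_def Rep_windex_inject)
qed

instantiation windex :: (finite) wellorder
begin
definition "x \<le> y \<longleftrightarrow> Rep_windex x \<le> Rep_windex y"
definition "x < y \<longleftrightarrow> Rep_windex x < Rep_windex y"
instance
proof
  fix P :: "'a windex \<Rightarrow> bool" and a
  assume *: "\<And>x. (\<And>y. y < x \<Longrightarrow> P y) \<Longrightarrow> P x"
  show "P a"
    by (induction "Rep_windex a" arbitrary: a rule: less_induct)
       (use * less_windex_def in blast)
qed (auto simp: less_eq_windex_def less_windex_def Rep_windex_inject)
end

lemma ex_bij_windex: "\<exists>\<pi> :: 'a windex \<Rightarrow> 'a::finite. bij \<pi>"
proof -
  have "bij_betw (Rep_windex :: 'a windex \<Rightarrow> nat) UNIV {..<CARD('a)}"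
    by (simp add: bij_betw_def inj_on_def Rep_windex_inject type_definition.Rep_range[OF type_definition_windex])
  then have "CARD('a windex) = CARD('a)"
    using bij_betw_same_card by fastforce
  then show ?thesis
    using finite_same_card_bij[of "UNIV::'a windex set" "UNIV::'a set"] by auto
qed

definition relabel :: "('b \<Rightarrow> 'a) \<Rightarrow> real^'a \<Rightarrow> real^'b" where
  "relabel \<pi> x = (\<chi> j. x $ \<pi> j)"

lemma relabel_nth [simp]: "relabel \<pi> x $ j = x $ \<pi> j"
  by (simp add: relabel_def)

lemma linear_relabel: "linear (relabel \<pi> :: real^'a \<Rightarrow> real^'b::finite)"
  by (rule linearI) (simp_all add: vec_eq_iff)

lemma relabel_inv:
  assumes "bij \<pi>"
  shows "relabel (inv \<pi>) (relabel \<pi> x) = x" "relabel \<pi> (relabel (inv \<pi>) y) = y"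
  using assms by (simp_all add: vec_eq_iff bij_is_surj surj_f_inv_f bij_is_inj)

lemma relabel_image:
  assumes "bij \<pi>"
  shows "relabel \<pi> ` S = {y. relabel (inv \<pi>) y \<in> S}"
proof (intro set_eqI iffI)
  fix y assume "y \<in> {y. relabel (inv \<pi>) y \<in> S}"
  then show "y \<in> relabel \<pi> ` S"
    using relabel_inv(2)[OF assms, of y] by (metis imageI mem_Collect_eq)
qed (auto simp: relabel_inv[OF assms])

lemma norm_relabel:
  fixes \<pi> :: "'b::finite \<Rightarrow> 'a::finite"
  assumes "bij \<pi>" shows "norm (relabel \<pi> x) = norm x"
  using sum.reindex_bij_betw[OF assms, of "\<lambda>i. (norm (x$i))\<^sup>2"]
  by (simp add: norm_vec_def L2_set_def)

section \<open>Boxes, balls and integrals under relabelling of coordinates\<close>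

lemma relabel_image_cbox:
  fixes \<pi> :: "'b::finite \<Rightarrow> 'a::finite"
  assumes "bij \<pi>"
  shows "relabel \<pi> ` cbox a b = cbox (relabel \<pi> a) (relabel \<pi> b)"
proof -
  have surj: "\<pi> (inv \<pi> i) = i" for i
    using assms by (simp add: bij_is_surj surj_f_inv_f)
  have inj: "inv \<pi> (\<pi> j) = j" for j
    using assms by (simp add: bij_is_inj)
  show ?thesis
  proof (intro set_eqI iffI)
    fix y assume "y \<in> relabel \<pi> ` cbox a b"
    then show "y \<in> cbox (relabel \<pi> a) (relabel \<pi> b)"
      by (auto simp: mem_box_cart)
  next
    fix y assume y: "y \<in> cbox (relabel \<pi> a) (relabel \<pi> b)"
    have "a $ i \<le> y $ inv \<pi> i \<and> y $ inv \<pi> i \<le> b $ i" for i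
      using y[unfolded mem_box_cart, rule_format, of "inv \<pi> i"] by (simp add: surj)
    then show "y \<in> relabel \<pi> ` cbox a b"
      unfolding relabel_image[OF assms] by (simp add: mem_box_cart)
  qed
qed

lemma relabel_image_ball:
  fixes \<pi> :: "'b::finite \<Rightarrow> 'a::finite"
  assumes "bij \<pi>"
  shows "relabel \<pi> ` ball 0 B = ball 0 B"
  unfolding relabel_image[OF assms]
  using norm_relabel[OF bij_imp_bij_inv[OF assms]] by auto

lemma content_relabel:
  fixes \<pi> :: "'b::finite \<Rightarrow> 'a::finite"
  assumes "bij \<pi>"
  shows "content (relabel \<pi> ` cbox a b) = content (cbox a b)"
proof -
  have "relabel \<pi> ` cbox a b = {} \<longleftrightarrow> cbox a b = {}" by auto
  then show ?thesis
    unfolding relabel_image_cbox[OF assms]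
    using prod.reindex_bij_betw[OF assms, of "\<lambda>i. b$i - a$i"]
    by (simp add: content_cbox_if_cart)
qed

text \<open>Relabelling carries boxes to boxes of the same content in both directions, so
  \<open>has_integral_twiddle\<close> applies with factor 1.\<close>

lemma has_integral_relabel_cbox:
  fixes \<pi> :: "'b::finite \<Rightarrow> 'a::finite" and f :: "real^'b \<Rightarrow> real"
  assumes "bij \<pi>" "(f has_integral I) (cbox (relabel \<pi> a) (relabel \<pi> b))"
  shows "((\<lambda>x. f (relabel \<pi> x)) has_integral I) (cbox a b)"
proof -
  have "((\<lambda>x. f (relabel \<pi> x)) has_integral (1/1) *\<^sub>R I)
      (relabel (inv \<pi>) ` cbox (relabel \<pi> a) (relabel \<pi> b))"
  proof (rule has_integral_twiddle[OF _ _ _ _ _ _ _ assms(2)])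
    show "continuous (at x) (relabel \<pi> :: real^'a \<Rightarrow> _)" for x
      by (simp add: linear_continuous_at linear_linear linear_relabel)
    show "\<exists>w z. relabel \<pi> ` cbox u v = cbox w z" for u v
      using relabel_image_cbox[OF assms(1)] by blast
    show "\<exists>w z. relabel (inv \<pi>) ` cbox u v = cbox w z" for u v
      using relabel_image_cbox[OF bij_imp_bij_inv[OF assms(1)]] by blast
  qed (use assms(1) in \<open>simp_all add: relabel_inv content_relabel\<close>)
  then show ?thesis
    using assms(1) by (simp add: relabel_image_cbox[OF bij_imp_bij_inv] relabel_inv)
qed

text \<open>Integrals over the whole space are limits over boxes containing a ball about 0.
  Relabelling is an isometry fixing 0, so it preserves these balls and the same \<open>B\<close>
  serves on both sides.\<close>

lemma has_integral_relabel_UNIV: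
  fixes \<pi> :: "'b::finite \<Rightarrow> 'a::finite" and f :: "real^'b \<Rightarrow> real"
  assumes \<pi>: "bij \<pi>" and f: "(f has_integral I) UNIV"
  shows "((\<lambda>x. f (relabel \<pi> x)) has_integral I) UNIV"
proof -
  have *: "(\<forall>a b. f integrable_on cbox a b)" "\<And>e. e > 0 \<Longrightarrow> \<exists>B>0. \<forall>a b. ball 0 B \<subseteq> cbox a b \<longrightarrow>
            norm (integral (cbox a b) f - I) < e"
    using f unfolding has_integral_alt'[of f I UNIV] by auto
  have int: "((\<lambda>x. f (relabel \<pi> x)) has_integral integral (cbox (relabel \<pi> a) (relabel \<pi> b)) f) (cbox a b)" for a b
    by (rule has_integral_relabel_cbox[OF \<pi>]) (use *(1) in \<open>auto intro: integrable_integral\<close>)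
  show ?thesis
    unfolding has_integral_alt'[of _ I UNIV]
  proof (intro conjI allI impI; simp)
    show "(\<lambda>x. f (relabel \<pi> x)) integrable_on cbox a b" for a b
      using int by blast
    fix e :: real assume "e > 0"
    then obtain B where B: "B > 0" "\<And>a b. ball 0 B \<subseteq> cbox a b \<Longrightarrow> norm (integral (cbox a b) f - I) < e"
      using *(2) by blast
    show "\<exists>B>0. \<forall>a b. ball 0 B \<subseteq> cbox a b \<longrightarrow> \<bar>integral (cbox a b) (\<lambda>x. f (relabel \<pi> x)) - I\<bar> < e"
    proof (intro exI conjI allI impI)
      fix a b :: "real^'a" assume "ball 0 B \<subseteq> cbox a b"
      then have "relabel \<pi> ` ball 0 B \<subseteq> relabel \<pi> ` cbox a b" by blast
      then have "ball 0 B \<subseteq> cbox (relabel \<pi> a) (relabel \<pi> b)"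
        using \<pi> by (simp add: relabel_image_cbox relabel_image_ball)
      from B(2)[OF this] show "\<bar>integral (cbox a b) (\<lambda>x. f (relabel \<pi> x)) - I\<bar> < e"
        using integral_unique[OF int[of a b]] by simp
    qed fact
  qed
qed

lemma has_integral_relabel:
  fixes \<pi> :: "'b::finite \<Rightarrow> 'a::finite" and f :: "real^'b \<Rightarrow> real"
  assumes \<pi>: "bij \<pi>"
  shows "(f has_integral I) (relabel \<pi> ` S) \<longleftrightarrow> ((\<lambda>x. f (relabel \<pi> x)) has_integral I) S"
proof -
  have 1: "((\<lambda>x. if x \<in> relabel \<pi> ` S then f x else 0) has_integral I) UNIV \<Longrightarrow>
      ((\<lambda>x. if x \<in> S then f (relabel \<pi> x) else 0) has_integral I) UNIV"
    using has_integral_relabel_UNIV[OF \<pi>, of "\<lambda>x. if x \<in> relabel \<pi> ` S then f x else 0" I]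
    by (simp add: relabel_image[OF \<pi>] relabel_inv[OF \<pi>])
  have 2: "((\<lambda>x. if x \<in> S then f (relabel \<pi> x) else 0) has_integral I) UNIV \<Longrightarrow>
     ((\<lambda>x. if x \<in> relabel \<pi> ` S then f x else 0) has_integral I) UNIV"
    using has_integral_relabel_UNIV[OF bij_imp_bij_inv[OF \<pi>], of "\<lambda>x. if x \<in> S then f (relabel \<pi> x) else 0" I]
    by (simp add: relabel_image[OF \<pi>] relabel_inv[OF \<pi>] cong: if_cong)
  show ?thesis
    using 1 2 unfolding has_integral_restrict_UNIV by blast
qed

lemma abs_integrable_relabel:
  fixes \<pi> :: "'b::finite \<Rightarrow> 'a::finite" and f :: "real^'b \<Rightarrow> real"
  assumes \<pi>: "bij \<pi>"
  shows "f absolutely_integrable_on (relabel \<pi> ` S) \<longleftrightarrow> (\<lambda>x. f (relabel \<pi> x)) absolutely_integrable_on S"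
  unfolding absolutely_integrable_on_def integrable_on_def
  using has_integral_relabel[OF \<pi>, of f _ S] has_integral_relabel[OF \<pi>, of "\<lambda>x. norm (f x)" _ S] by simp

lemma integral_relabel:
  fixes \<pi> :: "'b::finite \<Rightarrow> 'a::finite" and f :: "real^'b \<Rightarrow> real"
  assumes \<pi>: "bij \<pi>"
  shows "integral (relabel \<pi> ` S) f = integral S (\<lambda>x. f (relabel \<pi> x))"
  using has_integral_relabel[OF \<pi>, of f _ S] unfolding integral_def integrable_on_def by simp

section \<open>Sign and determinant under relabelling\<close>

lemma swapidseq_conj:
  assumes "swapidseq n p" "bij \<pi>"
  shows "swapidseq n (\<pi> \<circ> p \<circ> inv \<pi>)"
  using assms(1)
proof (induction rule: swapidseq.induct)
  case id
  have "\<pi> \<circ> id \<circ> inv \<pi> = id" unfolding comp_id using bij_is_surj[OF assms(2)] by (simp only: surj_iff)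
  then show ?case by (simp only: swapidseq.id)
next
  case (comp_Suc n p a b)
  have "\<pi> \<circ> (Transposition.transpose a b \<circ> p) \<circ> inv \<pi>
      = Transposition.transpose (\<pi> a) (\<pi> b) \<circ> (\<pi> \<circ> p \<circ> inv \<pi>)"
    using bij_is_inj[OF assms(2)] by (auto simp: fun_eq_iff Transposition.transpose_def inj_eq)
  moreover have "\<pi> a \<noteq> \<pi> b" using comp_Suc bij_is_inj[OF assms(2)] by (simp add: inj_eq)
  ultimately show ?case using comp_Suc swapidseq.comp_Suc by metis
qed

lemma sign_conj:
  assumes "permutation p" "bij \<pi>"
  shows "sign (\<pi> \<circ> p \<circ> inv \<pi>) = sign p"
proof -
  obtain n where n: "swapidseq n p" using assms(1) permutation_def by blast
  have "evenperm (\<pi> \<circ> p \<circ> inv \<pi>) = even n" "evenperm p = even n"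
    using evenperm_unique n swapidseq_conj[OF n assms(2)] by blast+
  then show ?thesis by (simp add: sign_def)
qed

text \<open>The two Leibniz sums are matched by conjugating permutations with \<open>\<pi>\<close>.
  Since the index types differ, signs are compared by counting transpositions: conjugation turns the
  swap of \<open>a\<close> and \<open>b\<close> into the swap of \<open>\<pi> a\<close> and
  \<open>\<pi> b\<close>.\<close>

lemma det_relabel:
  fixes \<pi> :: "'b::finite \<Rightarrow> 'a::finite" and A :: "real^'a^'a"
  assumes \<pi>: "bij \<pi>"
  shows "det (\<chi> j k. A $ \<pi> j $ \<pi> k) = det A"
proof -
  let ?c = "\<lambda>p. \<pi> \<circ> p \<circ> inv \<pi>"
  have surj: "\<pi> (inv \<pi> x) = x" for x by (simp add: \<pi> bij_is_surj surj_f_inv_f)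
  have inj: "inv \<pi> (\<pi> x) = x" for x by (simp add: \<pi> bij_is_inj)
  have "det A = (\<Sum>p\<in>{p. p permutes UNIV}. of_int (sign p) * (\<Prod>i\<in>UNIV. A $ i $ p i))"
    by (simp add: det_def)
  also have "\<dots> = (\<Sum>p\<in>{p. p permutes UNIV}. of_int (sign (?c p)) * (\<Prod>i\<in>UNIV. A $ i $ ?c p i))"
  proof (rule sum.reindex_bij_witness[where i = ?c and j = "\<lambda>p. inv \<pi> \<circ> p \<circ> \<pi>"])
    fix p assume "p \<in> {p. p permutes (UNIV::'a set)}"
    then have "bij p" by (simp add: permutes_bij)
    then show "inv \<pi> \<circ> p \<circ> \<pi> \<in> {p. p permutes UNIV}"
      using \<pi> by (auto intro!: bij_imp_permutes bij_comp bij_imp_bij_inv)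
    show "?c (inv \<pi> \<circ> p \<circ> \<pi>) = p" by (simp add: fun_eq_iff surj)
    then show "of_int (sign (?c (inv \<pi> \<circ> p \<circ> \<pi>))) * (\<Prod>i\<in>UNIV. A $ i $ ?c (inv \<pi> \<circ> p \<circ> \<pi>) i)
      = of_int (sign p) * (\<Prod>i\<in>UNIV. A $ i $ p i)" by simp
  next
    fix p assume "p \<in> {p. p permutes (UNIV::'b set)}"
    then have "bij p" by (simp add: permutes_bij)
    then show "?c p \<in> {p. p permutes UNIV}"
      using \<pi> by (auto intro!: bij_imp_permutes bij_comp bij_imp_bij_inv)
    show "inv \<pi> \<circ> ?c p \<circ> \<pi> = p" by (simp add: fun_eq_iff inj)
  qed
  also have "\<dots> = (\<Sum>p\<in>{p. p permutes UNIV}. of_int (sign p) * (\<Prod>j\<in>UNIV. A $ \<pi> j $ \<pi> (p j)))"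
  proof (intro sum.cong refl arg_cong2[where f = "(*)"])
    fix p assume "p \<in> {p. p permutes (UNIV::'b set)}"
    then have "permutation p" by (auto simp: permutation_permutes)
    then show "real_of_int (sign (?c p)) = real_of_int (sign p)" by (simp add: sign_conj \<pi>)
    show "(\<Prod>i\<in>UNIV. A $ i $ ?c p i) = (\<Prod>j\<in>UNIV. A $ \<pi> j $ \<pi> (p j))"
      using prod.reindex_bij_betw[OF \<pi>, of "\<lambda>i. A $ i $ ?c p i"] by (simp add: inj)
  qed
  finally show ?thesis by (simp add: det_def)
qed

text \<open>Conjugating \<open>g\<close> by the relabelling reindexes rows and columns of its
  Jacobian simultaneously, which preserves the determinant. For Borel \<open>S\<close> the
  relabelled image is measurable as a preimage under a continuous map. Real values pass through
  \<open>real^1\<close> to match the vector-valued form of the theorem.\<close>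

theorem change_of_variables:
  fixes g :: "real^'n \<Rightarrow> real^'n" and f :: "real^'n \<Rightarrow> real"
  assumes S: "S \<in> sets borel"
    and der: "\<And>x. x \<in> S \<Longrightarrow> (g has_derivative g' x) (at x within S)"
    and inj: "inj_on g S"
  shows "(\<lambda>x. \<bar>det (matrix (g' x))\<bar> * f (g x)) absolutely_integrable_on S \<and>
           integral S (\<lambda>x. \<bar>det (matrix (g' x))\<bar> * f (g x)) = b
     \<longleftrightarrow> f absolutely_integrable_on (g ` S) \<and> integral (g ` S) f = b"
proof -
  obtain \<pi> :: "'n windex \<Rightarrow> 'n" where \<pi>: "bij \<pi>" using ex_bij_windex by blast
  define T where "T = (relabel \<pi> :: real^'n \<Rightarrow> real^'n windex)"
  define T' where "T' = (relabel (inv \<pi>) :: real^'n windex \<Rightarrow> real^'n)"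
  have T: "T' (T x) = x" "T (T' y) = y" for x y
    by (simp_all add: T_def T'_def relabel_inv \<pi>)
  have lin: "linear T" "linear T'" by (simp_all add: T_def T'_def linear_relabel)
  have derT: "(T has_derivative T) (at x within X)" "(T' has_derivative T') (at y within Y)" for x y X Y
    using lin by (simp_all add: linear_imp_has_derivative)
  define G where "G = T \<circ> g \<circ> T'"
  define G' where "G' = (\<lambda>y. T \<circ> g' (T' y) \<circ> T')"
  have S': "T ` S \<in> sets lebesgue"
  proof -
    have "T ` S = T' -` S \<inter> space borel" by (auto simp: T) (metis T image_eqI)
    moreover have "T' \<in> borel_measurable borel"
      using lin by (simp add: borel_measurable_continuous_onI linear_continuous_on linear_linear)
    ultimately have "T ` S \<in> sets borel" using S by (metis measurable_sets)
    then show ?thesis by simp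
  qed
  have T'S: "T' ` T ` S = S" by (simp add: image_image T)
  have derG: "(G has_derivative G' y) (at y within T ` S)" if "y \<in> T ` S" for y
  proof -
    have "T' y \<in> S" using that by (auto simp: T)
    then have "(g has_derivative g' (T' y)) (at (T' y) within T' ` T ` S)" using der by (simp add: T'S)
    then show ?thesis unfolding G_def G'_def
      by (intro diff_chain_within derT)
  qed
  have injG: "inj_on G (T ` S)"
    using inj unfolding G_def inj_on_def by (auto simp: T) (metis T(1))
  have detG: "det (matrix (G' (T x))) = det (matrix (g' x))" if "x \<in> S" for x
  proof -
    have "matrix (G' (T x)) = (\<chi> j k. matrix (g' x) $ \<pi> j $ \<pi> k)"
    proof -
      have "T' (axis k 1) = axis (\<pi> k) 1" for k
        unfolding vec_eq_iff T'_def axis_def using \<pi>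
        by (simp add: bij_inv_eq_iff del: relabel_inv) (metis \<pi> bij_inv_eq_iff)
      then have "matrix (G' (T x)) $ j $ k = matrix (g' x) $ \<pi> j $ \<pi> k" for j k
        by (simp add: matrix_def G'_def T(1)) (simp add: T_def)
      then show ?thesis by (simp add: vec_eq_iff)
    qed
    then show ?thesis by (simp add: det_relabel[OF \<pi>])
  qed
  have GT: "G (T x) = T (g x)" for x by (simp add: G_def T)
  have imG: "G ` T ` S = T ` g ` S" by (simp add: image_image GT)
  let ?F = "\<lambda>y. f (T' y)"
  let ?v = "vec :: real \<Rightarrow> real^1"
  have "(\<lambda>y. \<bar>det (matrix (G' y))\<bar> *\<^sub>R ?v (?F (G y))) absolutely_integrable_on T ` S \<and>
      integral (T ` S) (\<lambda>y. \<bar>det (matrix (G' y))\<bar> *\<^sub>R ?v (?F (G y))) = ?v b \<longleftrightarrow>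
      (\<lambda>y. ?v (?F y)) absolutely_integrable_on (G ` T ` S) \<and> integral (G ` T ` S) (\<lambda>y. ?v (?F y)) = ?v b"
    by (rule has_absolute_integral_change_of_variables[OF S' derG injG])
  then have "(\<lambda>y. \<bar>det (matrix (G' y))\<bar> * ?F (G y)) absolutely_integrable_on T ` S \<and>
      integral (T ` S) (\<lambda>y. \<bar>det (matrix (G' y))\<bar> * ?F (G y)) = b \<longleftrightarrow>
      ?F absolutely_integrable_on (T ` g ` S) \<and> integral (T ` g ` S) ?F = b"
    by (simp add: absolutely_integrable_on_1_iff integral_on_1_eq imG)
  then have main: "(\<lambda>x. \<bar>det (matrix (G' (T x)))\<bar> * ?F (G (T x))) absolutely_integrable_on S \<and>
      integral S (\<lambda>x. \<bar>det (matrix (G' (T x)))\<bar> * ?F (G (T x))) = b \<longleftrightarrow>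
      (\<lambda>x. ?F (T x)) absolutely_integrable_on (g ` S) \<and> integral (g ` S) (\<lambda>x. ?F (T x)) = b"
    unfolding T_def abs_integrable_relabel[OF \<pi>] integral_relabel[OF \<pi>] .
  have eq: "\<bar>det (matrix (G' (T x)))\<bar> * ?F (G (T x)) = \<bar>det (matrix (g' x))\<bar> * f (g x)" if "x \<in> S" for x
    using that by (simp add: detG GT T)
  have "(\<lambda>x. \<bar>det (matrix (G' (T x)))\<bar> * ?F (G (T x))) absolutely_integrable_on S \<longleftrightarrow>
    (\<lambda>x. \<bar>det (matrix (g' x))\<bar> * f (g x)) absolutely_integrable_on S"
    by (rule set_integrable_cong) (simp_all add: eq)
  moreover have "integral S (\<lambda>x. \<bar>det (matrix (G' (T x)))\<bar> * ?F (G (T x))) =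
     integral S (\<lambda>x. \<bar>det (matrix (g' x))\<bar> * f (g x))"
    by (rule integral_cong) (simp add: eq)
  ultimately show ?thesis using main by (simp add: T)
qed

section \<open>Continuity, integrability and norm bounds for matrix fields\<close>

lemma continuous_on_det [continuous_intros]:
  fixes f :: "'a::topological_space \<Rightarrow> real^'n^'n"
  assumes "continuous_on S f"
  shows "continuous_on S (\<lambda>x. det (f x))"
  unfolding det_def by (intro continuous_intros assms)

lemma absolutely_integrable_continuous_compact:
  fixes f :: "'a::euclidean_space \<Rightarrow> real"
  assumes "compact S" "continuous_on S f"
  shows "f absolutely_integrable_on S"
proof -
  have "integrable lborel (\<lambda>x. indicator S x *\<^sub>R f x)"
    using borel_integrable_compact[OF assms] .
  then have "integrable lebesgue (\<lambda>x. indicator S x *\<^sub>R f x)"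
    by (subst integrable_completion) auto
  then show ?thesis by (simp add: set_integrable_def)
qed

text \<open>A crude entrywise bound; its point is to be linear in \<open>norm A\<close>, so that
  continuity of a matrix field controls operator norms.\<close>

lemma norm_matrix_vector_le:
  fixes A :: "real^'n^'m"
  shows "norm (A *v h) \<le> real CARD('m) * real CARD('n) * norm A * norm h"
proof -
  have "\<bar>A $ i $ j\<bar> \<le> norm A" for i j
    using component_le_norm_cart[of "A $ i" j] Finite_Cartesian_Product.norm_nth_le[of A i] by linarith
  then have "onorm ((*v) A) \<le> real CARD('m) * real CARD('n) * norm A"
    by (rule onorm_le_matrix_component)
  then show ?thesis
    using onorm[OF matrix_vector_mul_bounded_linear, of A h]
    by (meson mult_right_mono norm_ge_zero order_trans)
qed

lemma matrix_vector_fun_eqD: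
  fixes A B :: "real^'n^'m"
  assumes "(\<lambda>h. A *v h) = (\<lambda>h. B *v h)" shows "A = B"
  using assms matrix_eq by metis

subsection \<open>Continuously differentiable maps with a given Jacobian matrix\<close>

text \<open>Carrying the Jacobian matrix as the datum \<open>D\<close> keeps its determinant and its
  continuity directly accessible. Derivatives are taken in full neighbourhoods, so \<open>S\<close>
  is an open set in the applications.\<close>

definition c1_map :: "(real^'n) set \<Rightarrow> (real^'n \<Rightarrow> real^'n) \<Rightarrow> (real^'n \<Rightarrow> real^'n^'n) \<Rightarrow> bool" where
  "c1_map S w D \<longleftrightarrow> continuous_on S D \<and> (\<forall>x\<in>S. (w has_derivative (\<lambda>h. D x *v h)) (at x))"

lemma c1_mapD:
  assumes "c1_map S w D"
  shows "continuous_on S D" "x \<in> S \<Longrightarrow> (w has_derivative (\<lambda>h. D x *v h)) (at x)"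
  using assms by (auto simp: c1_map_def)

lemma c1_map_continuous: "c1_map S w D \<Longrightarrow> continuous_on S w"
  by (meson c1_mapD(2) continuous_at_imp_continuous_on has_derivative_continuous)

lemma c1_map_subset: "c1_map S w D \<Longrightarrow> T \<subseteq> S \<Longrightarrow> c1_map T w D"
  unfolding c1_map_def using continuous_on_subset by blast

lemma c1_map_eq_on_open:
  assumes "c1_map S w D" "c1_map S' w' D'" "open T" "x \<in> T" "x \<in> S" "x \<in> S'" "\<And>y. y \<in> T \<Longrightarrow> w y = w' y"
  shows "D x = D' x"
proof -
  have "(w has_derivative (\<lambda>h. D x *v h)) (at x)" "(w' has_derivative (\<lambda>h. D' x *v h)) (at x)"
    using assms by (auto simp: c1_map_def)
  then have "(w has_derivative (\<lambda>h. D' x *v h)) (at x)"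
    using has_derivative_transform_within_open[of w' "\<lambda>h. D' x *v h" x UNIV T w] assms by auto
  with \<open>(w has_derivative (\<lambda>h. D x *v h)) (at x)\<close> show ?thesis
    by (intro matrix_vector_fun_eqD has_derivative_unique)
qed

text \<open>Product rule in matrix form; the entries \<open>dk x $ j * F x $ i\<close> form the
  rank-one matrix of \<open>F\<close> and the gradient of \<open>k\<close>. With
  \<open>G = 0\<close> this cuts a map off, and with \<open>F = w0 - w1\<close>,
  \<open>G = w1\<close> it interpolates between two maps.\<close>

lemma c1_map_add_scaled:
  assumes "c1_map S F D" "c1_map S G E"
    and d: "\<And>x. x \<in> S \<Longrightarrow> (k has_derivative (\<lambda>h. dk x \<bullet> h)) (at x)" and c: "continuous_on S dk"
  shows "c1_map S (\<lambda>x. G x + k x *\<^sub>R F x)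
     (\<lambda>x. E x + (\<chi> i j. dk x $ j * F x $ i + k x * D x $ i $ j))"
  unfolding c1_map_def
proof (intro conjI ballI)
  have "continuous_on S k"
    by (meson d continuous_at_imp_continuous_on has_derivative_continuous)
  then show "continuous_on S (\<lambda>x. E x + (\<chi> i j. dk x $ j * F x $ i + k x * D x $ i $ j))"
    using c c1_mapD(1)[OF assms(1)] c1_mapD(1)[OF assms(2)] c1_map_continuous[OF assms(1)]
    by (intro continuous_intros) auto
next
  fix x assume x: "x \<in> S"
  have "((\<lambda>x. G x + k x *\<^sub>R F x) has_derivative
      (\<lambda>h. E x *v h + (k x *\<^sub>R (D x *v h) + (dk x \<bullet> h) *\<^sub>R F x))) (at x)"
    by (intro has_derivative_add has_derivative_scaleR d x c1_mapD(2)[OF assms(1)] c1_mapD(2)[OF assms(2)])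
  moreover have "(\<lambda>h. E x *v h + (k x *\<^sub>R (D x *v h) + (dk x \<bullet> h) *\<^sub>R F x)) =
     (\<lambda>h. (E x + (\<chi> i j. dk x $ j * F x $ i + k x * D x $ i $ j)) *v h)"
    by (simp add: fun_eq_iff vec_eq_iff matrix_vector_mult_def inner_vec_def sum.distrib
        sum_distrib_left sum_distrib_right algebra_simps)
  ultimately show "((\<lambda>x. G x + k x *\<^sub>R F x) has_derivative
     (\<lambda>h. (E x + (\<chi> i j. dk x $ j * F x $ i + k x * D x $ i $ j)) *v h)) (at x)" by simp
qed

lemma c1_map_zero: "c1_map S (\<lambda>x. 0) (\<lambda>x. 0)"
  by (simp add: c1_map_def)

lemma c1_map_diff:
  assumes "c1_map S F D" "c1_map S G E"
  shows "c1_map S (\<lambda>x. F x - G x) (\<lambda>x. D x - E x)"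
  using assms unfolding c1_map_def
  by (auto intro!: continuous_intros derivative_eq_intros simp: matrix_vector_mult_diff_rdistrib)

text \<open>\<open>S\<close> and \<open>- K\<close> form an open cover on which the extension is
  \<open>F\<close> and 0 respectively, so differentiability and continuity of the matrix are checked
  locally.\<close>

lemma c1_map_extend_zero:
  assumes c: "c1_map S F D" and "open S" and K: "closed K" "K \<subseteq> S"
    and z: "\<And>x. x \<in> S \<Longrightarrow> x \<notin> K \<Longrightarrow> F x = 0"
  shows "c1_map UNIV (\<lambda>x. if x \<in> S then F x else 0) (\<lambda>x. if x \<in> S then D x else 0)"
proof -
  let ?F = "\<lambda>x. if x \<in> S then F x else 0" and ?D = "\<lambda>x. if x \<in> S then D x else 0"
  have oK: "open (- K)" using K by (simp add: open_Compl)
  have D0: "D x = 0" if "x \<in> S" "x \<notin> K" for x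
    by (rule c1_map_eq_on_open[OF c c1_map_zero[of UNIV], of "S - K"])
       (use that z \<open>open S\<close> K in \<open>auto simp: open_Diff\<close>)
  have "continuous_on S ?D"
    using c1_mapD(1)[OF c] by (rule continuous_on_eq) auto
  moreover have "continuous_on (- K) ?D"
    by (rule continuous_on_eq[of _ "\<lambda>x. 0"]) (auto simp: D0)
  ultimately have "continuous_on (S \<union> - K) ?D"
    using \<open>open S\<close> oK by (rule continuous_on_open_Un[rotated 2])
  moreover have "S \<union> - K = UNIV" using K by blast
  moreover have "(?F has_derivative (\<lambda>h. ?D x *v h)) (at x)" for x
  proof (cases "x \<in> S")
    case True
    then show ?thesis
      using has_derivative_transform_within_open[OF c1_mapD(2)[OF c True] \<open>open S\<close>, of ?F] by auto
  next
    case False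
    then have "x \<in> - K" using K by auto
    then have "(?F has_derivative (\<lambda>h. 0)) (at x)"
      using has_derivative_transform_within_open[of "\<lambda>x. 0" "\<lambda>h. 0" x UNIV "-K" ?F] oK z by auto
    then show ?thesis using False by simp
  qed
  ultimately show ?thesis by (simp add: c1_map_def)
qed

subsection \<open>A continuously differentiable step\<close>

text \<open>Between 0 and 1 this is 1 - (1 - t^2)^2. The square of a positive part is continuously
  differentiable, so the polynomial is glued in a C1 way to the constants 0 and 1 at both
  ends.\<close>

definition step :: "real \<Rightarrow> real" where
  "step t = 1 - (max 0 (1 - (max 0 t)\<^sup>2))\<^sup>2"

definition step' :: "real \<Rightarrow> real" where
  "step' t = 4 * max 0 (1 - (max 0 t)\<^sup>2) * max 0 t"

lemma DERIV_max_square: "((\<lambda>t::real. (max 0 t)\<^sup>2) has_real_derivative 2 * max 0 t) (at t)"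
proof -
  consider "t < 0" | "t > 0" | "t = 0" by linarith
  then show ?thesis
  proof cases
    case 1
    have "((\<lambda>t. 0::real) has_real_derivative 2 * max 0 t) (at t)" using 1 by simp
    then show ?thesis
      by (rule has_field_derivative_transform_within_open[of _ _ _ "{..<0}"]) (use 1 in auto)
  next
    case 2
    have "((\<lambda>t. t\<^sup>2::real) has_real_derivative 2 * max 0 t) (at t)"
      using 2 by (auto intro!: derivative_eq_intros)
    then show ?thesis
      by (rule has_field_derivative_transform_within_open[of _ _ _ "{0<..}"]) (use 2 in auto)
  next
    case 3
    have "((\<lambda>h::real. (max 0 h)\<^sup>2 / h) \<longlongrightarrow> 0) (at 0)"
    proof (rule Lim_null_comparison)
      show "\<forall>\<^sub>F h::real in at 0. norm ((max 0 h)\<^sup>2 / h) \<le> \<bar>h\<bar>"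
        by (rule always_eventually) (auto simp: max_def power2_eq_square)
      show "((\<lambda>h::real. \<bar>h\<bar>) \<longlongrightarrow> 0) (at 0)"
        by (rule tendsto_eq_intros | simp)+
    qed
    then show ?thesis using 3 by (simp add: DERIV_def)
  qed
qed

lemma DERIV_step: "(step has_real_derivative step' t) (at t)"
proof -
  have "((\<lambda>t. 1 - (max 0 (1 - (max 0 t)\<^sup>2))\<^sup>2) has_real_derivative
      0 - (2 * max 0 (1 - (max 0 t)\<^sup>2)) * (0 - 2 * max 0 t)) (at t)"
    by (intro DERIV_diff DERIV_const DERIV_max_square DERIV_chain2[OF DERIV_max_square])
  then show ?thesis by (simp add: step_def[abs_def] step'_def mult.assoc)
qed

lemma step_eq_0: "t \<le> 0 \<Longrightarrow> step t = 0"
  by (simp add: step_def max_def)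

lemma step_eq_1: "t \<ge> 1 \<Longrightarrow> step t = 1"
  using one_le_power[of t 2] by (simp add: step_def)

lemma step'_eq_0: "t \<le> 0 \<or> t \<ge> 1 \<Longrightarrow> step' t = 0"
  using one_le_power[of t 2] by (auto simp: step'_def)

lemma step'_nonneg: "step' t \<ge> 0"
  by (simp add: step'_def)

lemma step'_pos: "0 < t \<Longrightarrow> t < 1 \<Longrightarrow> step' t > 0"
  using power_strict_mono[of t 1 2] by (simp add: step'_def)

lemma continuous_on_step' [continuous_intros]:
  "continuous_on S f \<Longrightarrow> continuous_on S (\<lambda>x. step' (f x))"
  unfolding step'_def by (intro continuous_intros)

lemma step_bounds: "0 \<le> step t" "step t \<le> 1"
proof -
  have "max 0 (1 - (max 0 t)\<^sup>2) \<le> 1" by simp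
  then have "(max 0 (1 - (max 0 t)\<^sup>2))\<^sup>2 \<le> 1\<^sup>2" by (intro power_mono) auto
  then show "0 \<le> step t" "step t \<le> 1" by (simp_all add: step_def)
qed

lemma radial_cutoff:
  assumes "0 \<le> a" "a < b"
  obtains k :: "real^'n \<Rightarrow> real" and dk :: "real^'n \<Rightarrow> real^'n" where
    "\<And>x. (k has_derivative (\<lambda>h. dk x \<bullet> h)) (at x)" "continuous_on UNIV dk"
    "\<And>x. norm x \<le> a \<Longrightarrow> k x = 1" "\<And>x. b \<le> norm x \<Longrightarrow> k x = 0" "\<And>x. 0 \<le> k x" "\<And>x. k x \<le> 1"
proof
  have pos: "b\<^sup>2 - a\<^sup>2 > 0" using assms by (simp add: power_strict_mono)
  \<comment> \<open>Squared norms avoid the kink of the norm at 0; \<open>q\<close> is affine in the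
    squared norm, with value 0 at radius \<open>a\<close> and 1 at radius \<open>b\<close>.\<close>
  define q where "q = (\<lambda>x::real^'n. (norm x ^ 2 - a\<^sup>2) / (b\<^sup>2 - a\<^sup>2))"
  define k where "k = (\<lambda>x. 1 - step (q x))"
  define dk where "dk = (\<lambda>x. (- step' (q x) * 2 / (b\<^sup>2 - a\<^sup>2)) *\<^sub>R x)"
  have qq: "q = (\<lambda>x. (1 / (b\<^sup>2 - a\<^sup>2)) * (x \<bullet> x - a\<^sup>2))"
    by (simp add: fun_eq_iff q_def power2_norm_eq_inner)
  have "((\<lambda>x. (1 / (b\<^sup>2 - a\<^sup>2)) * (x \<bullet> x - a\<^sup>2)) has_derivative
      (\<lambda>h. (1 / (b\<^sup>2 - a\<^sup>2)) * ((x \<bullet> h + h \<bullet> x) - 0))) (at x)" for x :: "real^'n"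
    by (intro has_derivative_mult_right has_derivative_diff has_derivative_inner
        has_derivative_ident has_derivative_const)
  then have "(q has_derivative (\<lambda>h. 2 * (x \<bullet> h) / (b\<^sup>2 - a\<^sup>2))) (at x)" for x
    unfolding qq by (rule has_derivative_eq_rhs) (simp add: fun_eq_iff inner_commute)
  from has_derivative_compose[OF this, of step] DERIV_step
  have "((\<lambda>x. step (q x)) has_derivative (\<lambda>h. step' (q x) * (2 * (x \<bullet> h) / (b\<^sup>2 - a\<^sup>2)))) (at x)" for x
    unfolding has_field_derivative_def by blast
  then have "(k has_derivative (\<lambda>h. 0 - step' (q x) * (2 * (x \<bullet> h) / (b\<^sup>2 - a\<^sup>2)))) (at x)" for x
    unfolding k_def by (intro has_derivative_diff has_derivative_const)
  then show "(k has_derivative (\<lambda>h. dk x \<bullet> h)) (at x)" for x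
    by (simp add: dk_def mult.assoc)
  have "continuous_on UNIV q" unfolding q_def by (intro continuous_intros) (use pos in auto)
  then show "continuous_on UNIV dk" unfolding dk_def using pos by (intro continuous_intros) auto
  show "k x = 1" if "norm x \<le> a" for x
  proof -
    have "norm x ^ 2 \<le> a\<^sup>2" using that by (simp add: power_mono)
    then show ?thesis using pos by (simp add: k_def q_def step_eq_0 divide_nonpos_pos)
  qed
  show "k x = 0" if "b \<le> norm x" for x
  proof -
    have "norm x ^ 2 \<ge> b\<^sup>2" using that assms by (simp add: power_mono)
    then show ?thesis using pos by (simp add: k_def q_def step_eq_1)
  qed
  show "0 \<le> k x" "k x \<le> 1" for x using step_bounds by (auto simp: k_def)
qed

subsection \<open>The integral of a Jacobian determinant is a null Lagrangian\<close>

lemma degree_prod_linear_le: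
  "finite S \<Longrightarrow> degree (\<Prod>i\<in>S. [:a i, b i:] :: real poly) \<le> card S"
proof (induction S rule: finite_induct)
  case (insert x F)
  have "degree ([:a x, b x:] * (\<Prod>i\<in>F. [:a i, b i:])) \<le> degree [:a x, b x:] + degree (\<Prod>i\<in>F. [:a i, b i:])"
    by (rule degree_mult_le)
  also have "\<dots> \<le> 1 + card F" using insert by (intro add_mono) auto
  finally show ?case using insert by simp
qed auto

lemma coeff_prod_linear_card:
  "finite S \<Longrightarrow> coeff (\<Prod>i\<in>S. [:a i, b i:] :: real poly) (card S) = (\<Prod>i\<in>S. b i)"
proof (induction S rule: finite_induct)
  case (insert x F)
  have "coeff (\<Prod>i\<in>F. [:a i, b i:]) (Suc (card F)) = 0"
    using degree_prod_linear_le[OF insert(1), of a b] by (intro coeff_eq_0) simp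
  then show ?case using insert by (simp add: coeff_pCons)
qed auto

lemma continuous_on_coeff_prod_linear:
  fixes a b :: "'i \<Rightarrow> 'x::topological_space \<Rightarrow> real"
  assumes "finite S" "\<And>i. continuous_on X (a i)" "\<And>i. continuous_on X (b i)"
  shows "continuous_on X (\<lambda>x. coeff (\<Prod>i\<in>S. [:a i x, b i x:]) k)"
  using assms(1)
proof (induction S arbitrary: k rule: finite_induct)
  case (insert y F)
  have "continuous_on X (\<lambda>x. a y x * coeff (\<Prod>i\<in>F. [:a i x, b i x:]) k + 
     (if k = 0 then 0 else b y x * coeff (\<Prod>i\<in>F. [:a i x, b i x:]) (k - 1)))"
    using insert(3) assms by (cases k) (auto intro!: continuous_intros)
  then show ?case using insert(1,2) by (cases k) (simp_all add: coeff_pCons)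
qed auto

text \<open>The Leibniz expansion of det(1 + tA) as a polynomial in t. Written this way, every
  coefficient is visibly a polynomial in the entries of \<open>A\<close>, hence continuous.\<close>

definition det_poly :: "real^'n^'n \<Rightarrow> real poly" where
  "det_poly A = (\<Sum>p | p permutes UNIV. smult (of_int (sign p))
     (\<Prod>i\<in>UNIV. [:if i = p i then 1 else 0, A $ i $ p i:]))"

lemma poly_det_poly: "poly (det_poly A) t = det (mat 1 + t *\<^sub>R A)"
  unfolding det_poly_def det_def
  by (simp add: poly_sum poly_prod mat_def mult.commute)

lemma degree_det_poly: "degree (det_poly (A::real^'n^'n)) \<le> CARD('n)"
  unfolding det_poly_def
  by (rule degree_sum_le) (auto intro!: order_trans[OF degree_smult_le] degree_prod_linear_le)

lemma coeff_det_poly: "coeff (det_poly (A::real^'n^'n)) CARD('n) = det A"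
  unfolding det_poly_def det_def
  using coeff_prod_linear_card[of "UNIV::'n set"] by (simp add: coeff_sum)

lemma continuous_on_coeff_det_poly:
  fixes D :: "'x::topological_space \<Rightarrow> real^'n^'n"
  assumes "continuous_on X D"
  shows "continuous_on X (\<lambda>x. coeff (det_poly (D x)) k)"
  unfolding det_poly_def coeff_sum coeff_smult
  by (intro continuous_intros continuous_on_coeff_prod_linear assms) auto

lemma poly_eq_sum_le:
  fixes p :: "real poly"
  assumes "degree p \<le> n" shows "poly p t = (\<Sum>k\<le>n. coeff p k * t ^ k)"
  unfolding poly_altdef
  by (rule sum.mono_neutral_left) (use assms in \<open>auto simp: coeff_eq_0\<close>)

text \<open>Rogers' volume trick: \<open>x \<mapsto> x + t g x\<close> permutes a large ball for small \<open>t\<close>, so the polynomial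
  \<open>t \<mapsto> \<integral> det (1 + t Dg)\<close> is constant; the integral in question is its top coefficient.\<close>

lemma integral_det_compact_support:
  fixes g :: "real^'n \<Rightarrow> real^'n"
  assumes c: "c1_map UNIV g D" and R: "R > 0" and z: "\<And>x. norm x \<ge> R \<Longrightarrow> g x = 0"
  shows "integral (cball 0 R) (\<lambda>x. det (D x)) = 0"
proof -
  let ?B = "cball 0 R :: (real^'n) set" and ?n = "CARD('n)"
  have D0: "D x = 0" if "norm x > R" for x
    by (rule c1_map_eq_on_open[OF c c1_map_zero[of UNIV], of "- ?B"])
       (use that z in \<open>simp_all add: open_Compl\<close>)
  have contD: "continuous_on UNIV D" using c1_mapD(1)[OF c] .
  have "compact (D ` ?B)" by (intro compact_continuous_image continuous_on_subset[OF contD]) auto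
  then have "bounded (D ` ?B)" by (rule compact_imp_bounded)
  then obtain K where K: "K > 0" and KB: "\<forall>A\<in>D ` ?B. norm A \<le> K" unfolding bounded_pos by blast
  have K': "norm (D x) \<le> K" for x
  proof (cases "norm x > R")
    case True
    then show ?thesis using K by (simp add: D0)
  next
    case False
    then have "D x \<in> D ` ?B" by (intro imageI) simp
    then show ?thesis using KB by blast
  qed
  define L where "L = real ?n * real ?n * K"
  have "L > 0" using K by (simp add: L_def)
  have lip: "norm (g x - g y) \<le> L * norm (x - y)" for x y
  proof (rule differentiable_bound[of UNIV])
    show "(g has_derivative (\<lambda>h. D x *v h)) (at x within UNIV)" for x
      using c1_mapD(2)[OF c] by auto
    show "onorm (\<lambda>h. D x *v h) \<le> L" for x
    proof (rule onorm_le)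
      fix h have "norm (D x *v h) \<le> real ?n * real ?n * norm (D x) * norm h"
        by (rule norm_matrix_vector_le)
      also have "\<dots> \<le> L * norm h"
        unfolding L_def by (intro mult_right_mono mult_left_mono K') simp_all
      finally show "norm (D x *v h) \<le> L * norm h" .
    qed
  qed auto
  have "continuous_on UNIV (\<lambda>A::real^'n^'n. det A)" by (intro continuous_intros)
  then have "isCont det (mat 1 :: real^'n^'n)"
    using continuous_on_eq_continuous_at[OF open_UNIV] by blast
  then have "\<exists>e>0. \<forall>A::real^'n^'n. dist A (mat 1) < e \<longrightarrow> dist (det A) (det (mat 1 :: real^'n^'n)) < 1"
    unfolding continuous_at_eps_delta using zero_less_one by blast
  then obtain e where e: "e > 0" "\<And>A::real^'n^'n. dist A (mat 1) < e \<Longrightarrow> dist (det A) 1 < 1"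
    unfolding det_I by blast
  define \<delta> where "\<delta> = min (1 / (2 * L)) (e / (2 * K))"
  have \<delta>: "\<delta> > 0" using \<open>L > 0\<close> K e by (simp add: \<delta>_def)
  have vol: "integral ?B (\<lambda>x. det (mat 1 + t *\<^sub>R D x)) = integral ?B (\<lambda>x. 1)"
    if t: "0 < t" "t < \<delta>" for t
  proof -
    define \<phi> where "\<phi> = (\<lambda>x. x + t *\<^sub>R g x)"
    have tL: "t * L \<le> 1/2" using t \<open>L > 0\<close> by (simp add: \<delta>_def field_simps)
    have tg: "norm (t *\<^sub>R g x - t *\<^sub>R g y) \<le> 1/2 * norm (x - y)" for x y
    proof -
      have "norm (t *\<^sub>R g x - t *\<^sub>R g y) = t * norm (g x - g y)"
        using t by (simp flip: scaleR_diff_right)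
      also have "\<dots> \<le> t * (L * norm (x - y))" using lip t by (intro mult_left_mono) auto
      also have "\<dots> \<le> 1/2 * norm (x - y)" 
        using mult_right_mono[OF tL norm_ge_zero[of "x - y"]] by (simp add: mult.assoc)
      finally show ?thesis .
    qed
    have inj: "inj \<phi>"
    proof (rule injI)
      fix x y assume "\<phi> x = \<phi> y"
      then have "x - y = - (t *\<^sub>R g x - t *\<^sub>R g y)" by (simp add: \<phi>_def algebra_simps)
      then have "norm (x - y) = norm (t *\<^sub>R g x - t *\<^sub>R g y)" by (metis norm_minus_cancel)
      then have "norm (x - y) \<le> 1/2 * norm (x - y)" using tg[of x y] by simp
      then show "x = y" by simp
    qed
    have out: "\<phi> x = x" if "norm x \<ge> R" for x using z that by (simp add: \<phi>_def)
    have img: "\<phi> ` ?B = ?B"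
    proof (intro set_eqI iffI)
      fix y assume "y \<in> \<phi> ` ?B"
      then obtain x where x: "norm x \<le> R" "y = \<phi> x" by auto
      show "y \<in> ?B"
      proof (rule ccontr)
        assume "y \<notin> ?B"
        then have "\<phi> y = \<phi> x" using out[of y] x by simp
        then have "y = x" using inj by (simp add: inj_eq)
        then show False using x \<open>y \<notin> ?B\<close> by simp
      qed
    next
      fix y assume y: "y \<in> ?B"
      \<comment> \<open>Surjectivity is a fixed point problem. Points of norm at least
        \<open>R\<close> are not moved, so a preimage of a point of the ball lies in the
        ball.\<close>
      have "\<exists>!x. y - t *\<^sub>R g x = x"
      proof (rule banach_fix_type)
        show "\<forall>x z. dist (y - t *\<^sub>R g x) (y - t *\<^sub>R g z) \<le> 1/2 * dist x z"
          using tg by (simp add: dist_norm norm_minus_commute)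
      qed auto
      then obtain x where "y - t *\<^sub>R g x = x" by blast
      then have x: "\<phi> x = y" unfolding \<phi>_def by (metis diff_add_cancel)
      moreover have "x \<in> ?B" using out[of x] x y by (cases "norm x \<ge> R") auto
      ultimately show "y \<in> \<phi> ` ?B" by blast
    qed
    have der: "(\<phi> has_derivative (\<lambda>h. (mat 1 + t *\<^sub>R D x) *v h)) (at x within ?B)" for x
    proof -
      have "(g has_derivative (\<lambda>h. D x *v h)) (at x within ?B)"
        by (rule has_derivative_at_withinI[OF c1_mapD(2)[OF c UNIV_I]])
      then have "(\<phi> has_derivative (\<lambda>h. h + t *\<^sub>R (D x *v h))) (at x within ?B)"
        unfolding \<phi>_def by (intro has_derivative_add has_derivative_ident has_derivative_scaleR_right)
      moreover have "(\<lambda>h. h + t *\<^sub>R (D x *v h)) = (\<lambda>h. (mat 1 + t *\<^sub>R D x) *v h)"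
        by (simp only: matrix_vector_mult_add_rdistrib matrix_vector_mul_lid scaleR_matrix_vector_assoc)
      ultimately show ?thesis by simp
    qed
    have pos: "det (mat 1 + t *\<^sub>R D x) > 0" for x
    proof -
      have "norm (t *\<^sub>R D x) = t * norm (D x)" using t by simp
      also have "\<dots> \<le> t * K" using K' t by (intro mult_left_mono) simp_all
      also have "\<dots> < e"
      proof -
        have "t < e / (2 * K)" using t by (simp add: \<delta>_def)
        then have "t * (2 * K) < e" using K by (simp add: pos_less_divide_eq)
        moreover have "t * K > 0" using t K by simp
        ultimately show ?thesis by linarith
      qed
      finally have "dist (mat 1 + t *\<^sub>R D x) (mat 1) < e" by (simp add: dist_norm)
      then have "dist (det (mat 1 + t *\<^sub>R D x)) 1 < 1" by (rule e)
      then show ?thesis by (simp add: dist_real_def)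
    qed
    have one: "(\<lambda>x. 1::real) absolutely_integrable_on ?B"
      by (intro absolutely_integrable_continuous_compact continuous_intros) auto
    have "integral ?B (\<lambda>x. \<bar>det (matrix (\<lambda>h. (mat 1 + t *\<^sub>R D x) *v h))\<bar> * 1) = integral ?B (\<lambda>x. 1)"
      using change_of_variables[of ?B \<phi> "\<lambda>x h. (mat 1 + t *\<^sub>R D x) *v h" "\<lambda>_. 1" "integral ?B (\<lambda>x. 1)"]
        der inj_on_subset[OF inj] one by (simp add: img)
    then show ?thesis using pos by (simp add: abs_of_pos)
  qed
  define c' where "c' = (\<lambda>k. integral ?B (\<lambda>x. coeff (det_poly (D x)) k))"
  define P where "P = (\<Sum>k\<le>?n. monom (c' k) k)"
  have P: "poly P t = integral ?B (\<lambda>x. det (mat 1 + t *\<^sub>R D x))" for t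
  proof -
    have "integral ?B (\<lambda>x. det (mat 1 + t *\<^sub>R D x)) = integral ?B (\<lambda>x. \<Sum>k\<le>?n. coeff (det_poly (D x)) k * t ^ k)"
      by (simp flip: poly_det_poly add: poly_eq_sum_le[OF degree_det_poly])
    also have "\<dots> = (\<Sum>k\<le>?n. integral ?B (\<lambda>x. coeff (det_poly (D x)) k * t ^ k))"
    proof (rule integral_sum)
      show "(\<lambda>x. coeff (det_poly (D x)) k * t ^ k) integrable_on ?B" for k
        by (intro set_lebesgue_integral_eq_integral(1) absolutely_integrable_continuous_compact
             continuous_intros continuous_on_coeff_det_poly continuous_on_subset[OF contD]) auto
    qed auto
    finally show ?thesis by (simp add: P_def poly_sum poly_monom c'_def)
  qed
  have "P - [:integral ?B (\<lambda>x. 1):] = 0"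
  proof (rule ccontr)
    assume "P - [:integral ?B (\<lambda>x. 1):] \<noteq> 0"
    then have "finite {t. poly (P - [:integral ?B (\<lambda>x. 1):]) t = 0}" by (rule poly_roots_finite)
    moreover have "{0<..<\<delta>} \<subseteq> {t. poly (P - [:integral ?B (\<lambda>x. 1):]) t = 0}"
      using P vol by auto
    ultimately show False using \<delta> infinite_Ioo finite_subset by blast
  qed
  then have "coeff P ?n = coeff [:integral ?B (\<lambda>x. 1):] ?n" by simp
  moreover have "coeff P ?n = c' ?n"
    by (simp add: P_def coeff_sum coeff_monom)
  \<comment> \<open>\<open>CARD('n)\<close> is positive, so the constant polynomial has no
    coefficient at this degree.\<close>
  moreover have "coeff [:integral ?B (\<lambda>x. 1):] ?n = 0" by (simp add: coeff_pCons split: nat.split)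
  ultimately show ?thesis by (simp add: c'_def coeff_det_poly)
qed

lemma integrable_continuous_compact:
  fixes f :: "'a::euclidean_space \<Rightarrow> real"
  assumes "compact S" "continuous_on S f"
  shows "f integrable_on S"
  using absolutely_integrable_continuous_compact[OF assms] set_lebesgue_integral_eq_integral(1) by blast

lemma integral_eq_on_subset:
  fixes f :: "'a::euclidean_space \<Rightarrow> real"
  assumes "S \<subseteq> T" "\<And>x. x \<in> T \<Longrightarrow> x \<notin> S \<Longrightarrow> f x = 0"
  shows "integral T f = integral S f"
proof -
  have "(\<lambda>x. if x \<in> T then f x else 0) = (\<lambda>x. if x \<in> S then f x else 0)"
    using assms by (auto simp: fun_eq_iff)
  then show ?thesis by (metis integral_restrict_UNIV)
qed

text \<open>Both maps are cut off inside the unit ball without being changed on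
  \<open>cball 0 R\<close>. The cut-off maps have compact support, so each determinant integrates to
  0 over a larger ball; they agree outside \<open>cball 0 R\<close>, so the outer parts cancel and
  the inner parts must be equal.\<close>

lemma null_lagrangian:
  fixes F0 F1 :: "real^'n \<Rightarrow> real^'n"
  assumes c0: "c1_map (ball 0 1) F0 D0" and c1: "c1_map (ball 0 1) F1 D1"
    and R: "0 < R" "R < 1" and agree: "\<And>x. R \<le> norm x \<Longrightarrow> norm x < 1 \<Longrightarrow> F0 x = F1 x"
  shows "integral (cball 0 R) (\<lambda>x. det (D0 x)) = integral (cball 0 R) (\<lambda>x. det (D1 x))"
proof -
  \<comment> \<open>The points dividing the interval from \<open>R\<close> to 1 into thirds: the
    cutoff is 1 on a neighbourhood of \<open>cball 0 R\<close> and 0 before the unit sphere.\<close>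
  define a b where "a = (2 * R + 1) / 3" and "b = (R + 2) / 3"
  have ab: "R < a" "a < b" "b < 1" "0 \<le> a" using R by (auto simp: a_def b_def)
  obtain k :: "real^'n \<Rightarrow> real" and dk where k: "\<And>x. (k has_derivative (\<lambda>h. dk x \<bullet> h)) (at x)"
    "continuous_on UNIV dk" "\<And>x. norm x \<le> a \<Longrightarrow> k x = 1" "\<And>x. b \<le> norm x \<Longrightarrow> k x = 0"
    using radial_cutoff[OF ab(4,2)] by metis
  define A where "A = (\<lambda>F x. if x \<in> ball 0 1 then 0 + k x *\<^sub>R F x else (0::real^'n))"
  define E where "E = (\<lambda>F D x. if x \<in> ball 0 1 then 
      0 + (\<chi> i j. dk x $ j * F x $ i + k x * D x $ i $ j) else (0::real^'n^'n))"
  have A: "c1_map UNIV (A F) (E F D)" if "c1_map (ball 0 1) F D" for F D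
    unfolding A_def E_def
  proof (rule c1_map_extend_zero)
    show "c1_map (ball 0 1) (\<lambda>x. 0 + k x *\<^sub>R F x)
     (\<lambda>x. 0 + (\<chi> i j. dk x $ j * F x $ i + k x * D x $ i $ j))"
      by (rule c1_map_add_scaled[OF that c1_map_zero k(1) continuous_on_subset[OF k(2)]]) auto
    show "0 + k x *\<^sub>R F x = 0" if "x \<notin> cball 0 b" for x
      using k(4)[of x] that by simp
  qed (use ab in auto)
  have I0: "integral (cball 0 b) (\<lambda>x. det (E F D x)) = 0" if "c1_map (ball 0 1) F D" for F D
  proof (rule integral_det_compact_support[OF A[OF that]])
    show "A F x = 0" if "b \<le> norm x" for x
      using k(4)[OF that] by (simp add: A_def)
  qed (use ab in auto)
  have E_out: "E F0 D0 x = E F1 D1 x" if "norm x > R" for x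
  proof (rule c1_map_eq_on_open[OF A[OF c0] A[OF c1], of "- cball 0 R"])
    show "A F0 y = A F1 y" if "y \<in> - cball 0 R" for y
      using agree[of y] that by (auto simp: A_def)
  qed (use that in \<open>auto simp: open_Compl\<close>)
  have E_in: "E F D x = D x" if c: "c1_map (ball 0 1) F D" and "x \<in> cball 0 R" for F D x
  proof (rule c1_map_eq_on_open[OF A[OF c] c, of "ball 0 a"])
    show "A F y = F y" if "y \<in> ball 0 a" for y
      using k(3)[of y] that ab by (auto simp: A_def)
  qed (use that ab in auto)
  have int: "(\<lambda>x. det (E F D x)) integrable_on cball 0 r" if "c1_map (ball 0 1) F D" for F D r
    by (intro integrable_continuous_compact continuous_on_det
        continuous_on_subset[OF c1_mapD(1)[OF A[OF that]]]) auto
  have "integral (cball 0 R) (\<lambda>x. det (E F0 D0 x) - det (E F1 D1 x))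
      = integral (cball 0 b) (\<lambda>x. det (E F0 D0 x) - det (E F1 D1 x))"
    by (rule sym, rule integral_eq_on_subset) (use E_out ab in auto)
  also have "\<dots> = 0" by (simp add: integral_diff int c0 c1 I0)
  finally have "integral (cball 0 R) (\<lambda>x. det (E F0 D0 x)) = integral (cball 0 R) (\<lambda>x. det (E F1 D1 x))"
    by (simp add: integral_diff int c0 c1)
  moreover have "integral (cball 0 R) (\<lambda>x. det (E F D x)) = integral (cball 0 R) (\<lambda>x. det (D x))"
    if "c1_map (ball 0 1) F D" for F D
    using E_in[OF that] by (intro integral_cong) simp
  ultimately show ?thesis using c0 c1 by simp
qed

subsection \<open>Weighted Jacobian integrals\<close>

text \<open>The product form is chosen because this is the Jacobian determinant of the diagonal map
  with components \<open>step ((z $ i + \<epsilon>) / (2 * \<epsilon>))\<close>. Multiplying a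
  determinant by it therefore amounts to composing with that map.\<close>

definition pbump :: "real \<Rightarrow> real^'n \<Rightarrow> real" where
  "pbump \<epsilon> z = (\<Prod>i\<in>UNIV. step' ((z $ i + \<epsilon>) / (2 * \<epsilon>)) / (2 * \<epsilon>))"

lemma pbump_nonneg: "\<epsilon> > 0 \<Longrightarrow> pbump \<epsilon> z \<ge> 0"
  unfolding pbump_def by (intro prod_nonneg) (simp add: step'_nonneg)

lemma pbump_0_pos: "\<epsilon> > 0 \<Longrightarrow> pbump \<epsilon> 0 > 0"
  unfolding pbump_def by (intro prod_pos) (simp add: step'_pos)

text \<open>The bump lives on a cube of half-width \<epsilon>. The l1 bound on the norm turns this
  into a ball condition, which is the source of the factor \<open>CARD('n)\<close> in the radii
  below.\<close>

lemma pbump_eq_0: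
  fixes z :: "real^'n"
  assumes "\<epsilon> > 0" "norm z \<ge> \<epsilon> * real CARD('n)"
  shows "pbump \<epsilon> z = 0"
proof -
  have "\<exists>i. \<bar>z $ i\<bar> \<ge> \<epsilon>"
  proof (rule ccontr)
    assume "\<nexists>i. \<bar>z $ i\<bar> \<ge> \<epsilon>"
    then have "(\<Sum>i\<in>UNIV. \<bar>z $ i\<bar>) < (\<Sum>i\<in>(UNIV::'n set). \<epsilon>)"
      by (intro sum_strict_mono) (auto simp: not_le)
    then show False using norm_le_l1_cart[of z] assms by (simp add: mult.commute)
  qed
  then obtain i where "\<bar>z $ i\<bar> \<ge> \<epsilon>" by blast
  then have "z $ i \<ge> \<epsilon> \<or> z $ i \<le> - \<epsilon>" by linarith
  then have "(z $ i + \<epsilon>) / (2 * \<epsilon>) \<ge> 1 \<or> (z $ i + \<epsilon>) / (2 * \<epsilon>) \<le> 0"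
    using assms by (auto simp: divide_nonpos_pos)
  then have "step' ((z $ i + \<epsilon>) / (2 * \<epsilon>)) = 0" using step'_eq_0 by blast
  then show ?thesis unfolding pbump_def by (intro prod_zero) auto
qed

lemma continuous_on_pbump [continuous_intros]:
  assumes "\<epsilon> > 0" "continuous_on S f"
  shows "continuous_on S (\<lambda>x. pbump \<epsilon> (f x :: real^'n))"
  unfolding pbump_def using assms by (intro continuous_intros) auto

lemma has_derivative_cart:
  fixes f :: "'a::real_normed_vector \<Rightarrow> real^'n"
  assumes "\<And>i. ((\<lambda>x. f x $ i) has_derivative (\<lambda>h. f' h $ i)) (at a)"
  shows "(f has_derivative f') (at a)"
  using assms unfolding has_derivative_componentwise_within[of f f' a UNIV]
  by (auto simp: Basis_vec_def inner_axis)

text \<open>Composing \<open>w\<close> with the diagonal step map multiplies row \<open>i\<close> of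
  its Jacobian by the \<open>i\<close>-th factor of the bump, so the weighted determinant is an
  honest determinant to which \<open>null_lagrangian\<close> applies.\<close>

lemma integral_pbump_agree:
  fixes w0 w1 :: "real^'n \<Rightarrow> real^'n"
  assumes c0: "c1_map (ball 0 1) w0 D0" and c1: "c1_map (ball 0 1) w1 D1"
    and R: "0 < R" "R < 1" and agree: "\<And>x. R \<le> norm x \<Longrightarrow> norm x < 1 \<Longrightarrow> w0 x = w1 x"
    and \<epsilon>: "\<epsilon> > 0"
  shows "integral (cball 0 R) (\<lambda>x. pbump \<epsilon> (w0 x - y) * det (D0 x)) =
         integral (cball 0 R) (\<lambda>x. pbump \<epsilon> (w1 x - y) * det (D1 x))"
proof -
  let ?u = "\<lambda>(w::real^'n \<Rightarrow> real^'n) x i. ((w x - y) $ i + \<epsilon>) / (2 * \<epsilon>)"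
  define \<Phi> where "\<Phi> = (\<lambda>w x. (\<chi> i. step (?u w x i)) :: real^'n)"
  define E where "E = (\<lambda>w D x. (\<chi> i. (step' (?u w x i) / (2 * \<epsilon>)) *s D x $ i) :: real^'n^'n)"
  have "c1_map (ball 0 1) (\<Phi> w) (E w D)" if c: "c1_map (ball 0 1) w D" for w D
    unfolding c1_map_def
  proof (intro conjI ballI)
    show "continuous_on (ball 0 1) (E w D)"
      unfolding E_def vector_scalar_mult_def
      using c1_mapD(1)[OF c] c1_map_continuous[OF c] \<epsilon>
      by (intro continuous_intros) auto
    fix x :: "real^'n" assume x: "x \<in> ball 0 1"
    show "(\<Phi> w has_derivative (\<lambda>h. E w D x *v h)) (at x)"
    proof (rule has_derivative_cart)
      fix i
      have "((\<lambda>x. w x $ i) has_derivative (\<lambda>h. (D x *v h) $ i)) (at x)"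
        using bounded_linear.has_derivative[OF bounded_linear_vec_nth c1_mapD(2)[OF c x]] .
      then have "((\<lambda>x. (w x $ i - y $ i + \<epsilon>) * (1 / (2 * \<epsilon>))) has_derivative 
          (\<lambda>h. ((D x *v h) $ i - 0 + 0) * (1 / (2 * \<epsilon>)))) (at x)"
        by (intro has_derivative_mult_left has_derivative_add has_derivative_diff has_derivative_const)
      then have "((\<lambda>x. ?u w x i) has_derivative (\<lambda>h. (D x *v h) $ i / (2 * \<epsilon>))) (at x)" by simp
      from has_derivative_compose[OF this DERIV_step[unfolded has_field_derivative_def]]
      show "((\<lambda>x. \<Phi> w x $ i) has_derivative (\<lambda>h. (E w D x *v h) $ i)) (at x)"
        by (simp add: \<Phi>_def E_def matrix_vector_mult_def sum_distrib_left sum_divide_distrib mult.assoc)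
    qed
  qed
  then have "integral (cball 0 R) (\<lambda>x. det (E w0 D0 x)) = integral (cball 0 R) (\<lambda>x. det (E w1 D1 x))"
    using c0 c1 R agree by (intro null_lagrangian[of "\<Phi> w0" _ "\<Phi> w1"]) (auto simp: \<Phi>_def)
  moreover have "det (E w D x) = pbump \<epsilon> (w x - y) * det (D x)" for w D x
    unfolding E_def det_rows_mul pbump_def by (simp add: vec_lambda_eta)
  ultimately show ?thesis by simp
qed

text \<open>A cutoff glues \<open>w0\<close> on the inner ball to \<open>w1\<close> near the sphere.
  In the transition shell the glued map takes values on segments that avoid the support of the bump,
  so the shell contributes nothing and agreement near the sphere suffices.\<close>

lemma integral_pbump_homotopy:
  fixes w0 w1 :: "real^'n \<Rightarrow> real^'n"
  assumes c0: "c1_map (ball 0 1) w0 D0" and c1: "c1_map (ball 0 1) w1 D1"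
    and R: "0 < R" "R < 1" and \<epsilon>: "\<epsilon> > 0"
    and avoid: "\<And>x t. R \<le> norm x \<Longrightarrow> norm x < 1 \<Longrightarrow> 0 \<le> t \<Longrightarrow> t \<le> 1 \<Longrightarrow>
       norm (w1 x + t *\<^sub>R (w0 x - w1 x) - y) \<ge> \<epsilon> * real CARD('n)"
  shows "integral (cball 0 R) (\<lambda>x. pbump \<epsilon> (w0 x - y) * det (D0 x)) =
         integral (cball 0 R) (\<lambda>x. pbump \<epsilon> (w1 x - y) * det (D1 x))"
proof -
  define a where "a = (R + 1) / 2"
  have a: "R < a" "a < 1" using R by (auto simp: a_def)
  obtain k :: "real^'n \<Rightarrow> real" and dk where k: "\<And>x. (k has_derivative (\<lambda>h. dk x \<bullet> h)) (at x)"
    "continuous_on UNIV dk" "\<And>x. norm x \<le> R \<Longrightarrow> k x = 1" "\<And>x. a \<le> norm x \<Longrightarrow> k x = 0"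
    "\<And>x. 0 \<le> k x" "\<And>x. k x \<le> 1"
    using radial_cutoff[of R a] R a by (metis less_eq_real_def)
  define w where "w = (\<lambda>x. w1 x + k x *\<^sub>R (w0 x - w1 x))"
  obtain D where c: "c1_map (ball 0 1) w D"
    using c1_map_add_scaled[OF c1_map_diff[OF c0 c1] c1 k(1) continuous_on_subset[OF k(2)]]
    unfolding w_def by blast
  have shrink: "integral (cball 0 a) (\<lambda>x. pbump \<epsilon> (v x - y) * det (E x)) =
     integral (cball 0 R) (\<lambda>x. pbump \<epsilon> (v x - y) * det (E x))"
    if v: "c1_map (ball 0 1) v E" and av: "\<And>x. R \<le> norm x \<Longrightarrow> norm x < 1 \<Longrightarrow> norm (v x - y) \<ge> \<epsilon> * real CARD('n)" for v E
  proof (rule integral_eq_on_subset)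
    show "cball 0 R \<subseteq> (cball 0 a :: (real^'n) set)" using a by auto
  next
    fix x :: "real^'n" assume "x \<notin> cball 0 R" "x \<in> cball 0 a"
    then show "pbump \<epsilon> (v x - y) * det (E x) = 0"
      using pbump_eq_0[OF \<epsilon> av[of x]] a by auto
  qed
  have "integral (cball 0 R) (\<lambda>x. pbump \<epsilon> (w0 x - y) * det (D0 x)) =
     integral (cball 0 R) (\<lambda>x. pbump \<epsilon> (w x - y) * det (D x))"
  proof (rule integral_cong)
    fix x :: "real^'n" assume x: "x \<in> cball 0 R"
    show "pbump \<epsilon> (w0 x - y) * det (D0 x) = pbump \<epsilon> (w x - y) * det (D x)"
    proof (cases "norm x < R")
      case True
      have "D0 x = D x"
        by (rule c1_map_eq_on_open[OF c0 c, of "ball 0 R"]) (use True R k(3) in \<open>auto simp: w_def\<close>)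
      then show ?thesis using k(3)[of x] True by (simp add: w_def)
    next
      \<comment> \<open>On the sphere of radius \<open>R\<close> the Jacobians cannot be compared by
        locality, but the values there already lie outside the support and both integrands
        vanish.\<close>
      case False
      then show ?thesis using x k(3)[of x] R pbump_eq_0[OF \<epsilon>, of "w0 x - y"] avoid[of x 1]
        by (simp add: w_def)
    qed
  qed
  also have "\<dots> = integral (cball 0 a) (\<lambda>x. pbump \<epsilon> (w x - y) * det (D x))"
    by (rule shrink[symmetric, OF c]) (use avoid k in \<open>auto simp: w_def\<close>)
  also have "\<dots> = integral (cball 0 a) (\<lambda>x. pbump \<epsilon> (w1 x - y) * det (D1 x))"
    by (rule integral_pbump_agree[OF c c1 _ _ _ \<epsilon>]) (use R a k(4) in \<open>auto simp: w_def\<close>)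
  also have "\<dots> = integral (cball 0 R) (\<lambda>x. pbump \<epsilon> (w1 x - y) * det (D1 x))"
    by (rule shrink[OF c1]) (use avoid[of _ 0] in auto)
  finally show ?thesis .
qed

subsection \<open>The Brouwer degree on the unit ball\<close>

text \<open>The derivative at \<open>a\<close> has a left inverse and varies continuously in
  operator norm, which yields local injectivity. A determinant closer to \<open>det (D a)\<close>
  than \<open>\<bar>det (D a)\<bar>\<close> keeps its sign.\<close>

lemma regular_point_nbhd:
  fixes w :: "real^'n \<Rightarrow> real^'n"
  assumes c: "c1_map S w D" and S: "open S" "a \<in> S" and reg: "det (D a) \<noteq> 0"
  obtains r where "r > 0" "ball a r \<subseteq> S" "inj_on w (ball a r)"
    "\<And>x. x \<in> ball a r \<Longrightarrow> sgn (det (D x)) = sgn (det (D a))"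
proof -
  let ?n = "real CARD('n) * real CARD('n)"
  have n: "?n > 0" by simp
  have contD: "isCont D a"
    using c1_mapD(1)[OF c] S by (simp add: continuous_on_eq_continuous_at)
  have "invertible (D a)" using reg by (simp add: invertible_det_nz)
  then obtain B where B: "B ** D a = mat 1" unfolding invertible_def by blast
  obtain r1 where r1: "r1 > 0" "ball a r1 \<subseteq> S" "inj_on w (ball a r1)"
  proof (rule has_derivative_locally_injective[OF S(2,1), of "\<lambda>h. B *v h" "\<lambda>x h. D x *v h" w])
    show "(\<lambda>h. B *v h) \<circ> (\<lambda>h. D a *v h) = id"
      using B by (simp add: fun_eq_iff matrix_vector_mul_assoc)
    fix e :: real assume "e > 0"
    then have "e / (2 * ?n) > 0" by simp
    then obtain d where d: "d > 0" "\<And>x. dist x a < d \<Longrightarrow> dist (D x) (D a) < e / (2 * ?n)"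
      using contD unfolding continuous_at_eps_delta by blast
    have "onorm (\<lambda>v. D x *v v - D a *v v) < e" if "dist a x < d" for x
    proof -
      have "onorm (\<lambda>v. D x *v v - D a *v v) \<le> ?n * norm (D x - D a)"
      proof (rule onorm_le)
        show "norm (D x *v h - D a *v h) \<le> ?n * norm (D x - D a) * norm h" for h
          using norm_matrix_vector_le[of "D x - D a" h] by (simp add: matrix_vector_mult_diff_rdistrib)
      qed
      also have "\<dots> \<le> ?n * (e / (2 * ?n))"
        using d(2)[of x] that by (intro mult_left_mono) (simp_all add: dist_norm norm_minus_commute)
      also have "\<dots> < e" using \<open>e > 0\<close> by simp
      finally show ?thesis .
    qed
    then show "\<exists>d>0. \<forall>x. dist a x < d \<longrightarrow> onorm (\<lambda>v. D x *v v - D a *v v) < e" using d(1) by blast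
  qed (use c in \<open>auto simp: c1_map_def matrix_vector_mul_bounded_linear\<close>)
  have "continuous_on S (\<lambda>x. det (D x))" using c1_mapD(1)[OF c] by (intro continuous_intros)
  then have "isCont (\<lambda>x. det (D x)) a" using S by (simp add: continuous_on_eq_continuous_at)
  moreover have "\<bar>det (D a)\<bar> > 0" using reg by simp
  ultimately obtain r2 where r2: "r2 > 0" "\<And>x. dist x a < r2 \<Longrightarrow> dist (det (D x)) (det (D a)) < \<bar>det (D a)\<bar>"
    unfolding continuous_at_eps_delta by blast
  show thesis
  proof (rule that[of "min r1 r2"])
    show "inj_on w (ball a (min r1 r2))" using r1(3) by (rule inj_on_subset) auto
    fix x assume "x \<in> ball a (min r1 r2)"
    then have "\<bar>det (D x) - det (D a)\<bar> < \<bar>det (D a)\<bar>"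
      using r2(2)[of x] by (simp add: dist_commute dist_real_def)
    then show "sgn (det (D x)) = sgn (det (D a))" by (auto simp: sgn_if abs_if split: if_splits)
  qed (use r1 r2 in auto)
qed

lemma pbump_shift_eq_0:
  fixes y z :: "real^'n"
  assumes "\<epsilon> > 0" "\<epsilon> * real CARD('n) \<le> e" "z \<notin> ball y e"
  shows "pbump \<epsilon> (z - y) = 0"
  using assms by (intro pbump_eq_0) (auto simp: dist_norm norm_minus_commute)

lemma absolutely_integrable_pbump:
  fixes y :: "real^'n"
  assumes "\<epsilon> > 0"
  shows "(\<lambda>z. pbump \<epsilon> (z - y)) absolutely_integrable_on UNIV"
proof -
  let ?K = "cball y (\<epsilon> * real CARD('n))"
  have "(\<lambda>z. pbump \<epsilon> (z - y)) absolutely_integrable_on ?K"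
    using assms by (intro absolutely_integrable_continuous_compact continuous_intros) auto
  moreover have "indicator ?K z *\<^sub>R pbump \<epsilon> (z - y) = indicator UNIV z *\<^sub>R pbump \<epsilon> (z - y)" for z
    using pbump_shift_eq_0[OF assms order_refl, of z y] by (auto simp: indicator_def)
  ultimately show ?thesis unfolding set_integrable_def by (simp only:)
qed

lemma integral_pos_of_nonneg_continuous:
  fixes f :: "'a::euclidean_space \<Rightarrow> real"
  assumes C: "cbox a b \<subseteq> S" "x \<in> box a b" and cont: "continuous_on (cbox a b) f"
    and f: "f integrable_on S" "\<And>x. x \<in> S \<Longrightarrow> f x \<ge> 0" "f x > 0"
  shows "integral S f > 0"
proof -
  have intC: "f integrable_on cbox a b" using cont by (rule integrable_continuous)
  have x: "x \<in> cbox a b" "box a b \<noteq> {}" using C(2) box_subset_cbox by auto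
  have nonneg: "0 \<le> f z" if "z \<in> box a b" for z using f(2) C(1) box_subset_cbox that by blast
  have "integral (cbox a b) f \<noteq> 0"
  proof
    assume "integral (cbox a b) f = 0"
    then have "(f has_integral 0) (cbox a b)" using intC by (metis integrable_integral)
    from has_integral_0_cbox_imp_0[OF cont nonneg this x(2,1)] show False using f(3) by simp
  qed
  moreover have "integral (cbox a b) f \<ge> 0" using intC f(2) C(1) by (intro integral_nonneg) auto
  moreover have "integral (cbox a b) f \<le> integral S f"
    using intC f C(1) by (intro integral_subset_le) auto
  ultimately show ?thesis by linarith
qed

lemma integral_pbump_pos:
  fixes y :: "real^'n"
  assumes "\<epsilon> > 0"
  shows "integral UNIV (\<lambda>z. pbump \<epsilon> (z - y)) > 0"
proof (rule integral_pos_of_nonneg_continuous[where x = y and a = "y - vec 1" and b = "y + vec 1"])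
  show "(\<lambda>z. pbump \<epsilon> (z - y)) integrable_on UNIV"
    using absolutely_integrable_pbump[OF assms] set_lebesgue_integral_eq_integral(1) by blast
  show "continuous_on (cbox (y - vec 1) (y + vec 1)) (\<lambda>z. pbump \<epsilon> (z - y))"
    using assms by (intro continuous_intros)
qed (use pbump_nonneg[OF assms] pbump_0_pos[OF assms] in \<open>simp_all add: mem_box_cart\<close>)

text \<open>Regular preimages are isolated and confined to a compact ball, hence finite in number.
  For a narrow bump the integrand lives on disjoint neighbourhoods of them; on each one, change of
  variables yields the full mass of the bump times the constant sign of the determinant.\<close>

lemma integral_pbump_count:
  fixes w :: "real^'n \<Rightarrow> real^'n"
  assumes c: "c1_map (ball 0 1) w D" and R: "0 < R" "R < 1"
    and reg: "\<And>x. x \<in> ball 0 1 \<Longrightarrow> w x = y \<Longrightarrow> norm x < R \<and> det (D x) \<noteq> 0"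
  shows "finite {x \<in> ball 0 1. w x = y}" (is "finite ?P")
    and "\<exists>\<epsilon>0>0. \<forall>\<epsilon>. 0 < \<epsilon> \<and> \<epsilon> < \<epsilon>0 \<longrightarrow>
      integral (cball 0 R) (\<lambda>x. pbump \<epsilon> (w x - y) * det (D x)) =
      integral UNIV (\<lambda>z. pbump \<epsilon> (z - y)) * (\<Sum>x | x \<in> ball 0 1 \<and> w x = y. sgn (det (D x)))"
proof -
  have contw: "continuous_on (cball 0 R) w" 
    by (rule continuous_on_subset[OF c1_map_continuous[OF c]]) (use R in auto)
  have cR: "c1_map (ball 0 R) w D" by (rule c1_map_subset[OF c]) (use R in auto)
  have "\<exists>r>0. ball x r \<subseteq> ball 0 R \<and> inj_on w (ball x r) \<and> (\<forall>z\<in>ball x r. sgn (det (D z)) = sgn (det (D x)))"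
    if "x \<in> ?P" for x
    using regular_point_nbhd[OF cR, of x] reg[of x] that by (metis (mono_tags, lifting) mem_Collect_eq mem_ball_0 open_ball)
  then have "\<forall>x\<in>?P. \<exists>r>0. ball x r \<subseteq> ball 0 R \<and> inj_on w (ball x r) \<and> 
      (\<forall>z\<in>ball x r. sgn (det (D z)) = sgn (det (D x)))" by (rule ballI)
  from bchoice[OF this] obtain r where r0: "\<forall>x\<in>?P. r x > 0 \<and> ball x (r x) \<subseteq> ball 0 R \<and>
      inj_on w (ball x (r x)) \<and> (\<forall>z\<in>ball x (r x). sgn (det (D z)) = sgn (det (D x)))" ..
  have r: "r x > 0" "ball x (r x) \<subseteq> ball 0 R" "inj_on w (ball x (r x))"
      "\<And>z. z \<in> ball x (r x) \<Longrightarrow> sgn (det (D z)) = sgn (det (D x))" if "x \<in> ?P" for x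
    using bspec[OF r0 that] by blast+
  have P_eq: "?P = {x \<in> cball 0 R. w x = y}" using reg R by fastforce
  have "compact ?P" unfolding P_eq
    using continuous_closed_preimage_constant[OF contw closed_cball, of y]
    unfolding compact_eq_bounded_closed by (auto intro: boundedI)
  show fin: "finite ?P"
  proof -
    obtain C where C: "C \<subseteq> ?P" "finite C" "?P \<subseteq> (\<Union>x\<in>C. ball x (r x))"
    proof (rule compactE_image[OF \<open>compact ?P\<close>, of ?P "\<lambda>x. ball x (r x)"])
      show "?P \<subseteq> (\<Union>x\<in>?P. ball x (r x))"
        using r(1) by (intro subsetI UN_I) (assumption, simp)
    qed auto
    have "?P \<subseteq> C"
    proof
      fix z assume z: "z \<in> ?P"
      then obtain x where x: "x \<in> C" "z \<in> ball x (r x)" using C by blast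
      then have "x \<in> ?P" using C by blast
      moreover have "x \<in> ball x (r x)" using r(1)[OF \<open>x \<in> ?P\<close>] by simp
      moreover have "w z = w x" using z \<open>x \<in> ?P\<close> by simp
      ultimately have "z = x" using inj_onD[OF r(3)] x(2) by blast
      then show "z \<in> C" using x by simp
    qed
    then show ?thesis using C(2) finite_subset by blast
  qed
  have "\<exists>d>0. \<forall>z\<in>?P. z \<noteq> x \<longrightarrow> d \<le> dist x z" for x using finite_set_avoid[OF fin] .
  then have "\<forall>x. \<exists>d>0. \<forall>z\<in>?P. z \<noteq> x \<longrightarrow> d \<le> dist x z" by (rule allI)
  from choice[OF this] obtain d where "\<forall>x. d x > 0 \<and> (\<forall>z\<in>?P. z \<noteq> x \<longrightarrow> d x \<le> dist x z)" ..
  then have d: "\<And>x. d x > 0" "\<And>x z. z \<in> ?P \<Longrightarrow> z \<noteq> x \<Longrightarrow> d x \<le> dist x z" by blast+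
  \<comment> \<open>Half the distance to the nearest other preimage makes the neighbourhoods
    disjoint; \<open>r x\<close> gives injectivity and a constant sign.\<close>
  define B where "B = (\<lambda>x. ball x (min (r x) (d x / 2)))"
  have B: "open (B x)" "x \<in> B x" "B x \<subseteq> ball 0 R" "inj_on w (B x)" "\<And>z. z \<in> B x \<Longrightarrow> sgn (det (D z)) = sgn (det (D x))"
    if "x \<in> ?P" for x
  proof -
    have sub: "B x \<subseteq> ball x (r x)" by (auto simp: B_def)
    show "open (B x)" "x \<in> B x" using r(1)[OF that] d(1)[of x] by (simp_all add: B_def)
    show "B x \<subseteq> ball 0 R" using sub r(2)[OF that] by blast
    show "inj_on w (B x)" using sub r(3)[OF that] by (rule inj_on_subset[rotated])
    show "sgn (det (D z)) = sgn (det (D x))" if "z \<in> B x" for z using sub r(4)[OF \<open>x \<in> ?P\<close>] that by blast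
  qed
  have disj: "B x \<inter> B z = {}" if "x \<in> ?P" "z \<in> ?P" "x \<noteq> z" for x z
  proof (rule ccontr)
    assume "B x \<inter> B z \<noteq> {}"
    then obtain v where "dist x v < d x / 2" "dist z v < d z / 2" by (auto simp: B_def)
    moreover have "d x \<le> dist x z" "d z \<le> dist z x"
      using d(2)[of z x] d(2)[of x z] that by blast+
    moreover have "dist z x = dist x z" by (rule dist_commute)
    moreover have "dist x z \<le> dist x v + dist z v" by (metis dist_commute dist_triangle)
    ultimately show False by linarith
  qed
  let ?K = "cball 0 R - (\<Union>x\<in>?P. B x)"
  have "compact (w ` ?K)"
    using B(1) by (intro compact_continuous_image continuous_on_subset[OF contw] compact_diff open_UN) auto
  moreover have "y \<notin> w ` ?K" using B(2) P_eq by blast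
  ultimately obtain \<eta>1 where \<eta>1: "\<eta>1 > 0" "\<And>x. x \<in> ?K \<Longrightarrow> \<eta>1 \<le> dist y (w x)"
    using separate_point_closed[of "w ` ?K" y] compact_imp_closed by blast
  \<comment> \<open>Invariance of domain makes the image of each neighbourhood cover a ball about
    \<open>y\<close>, so no mass of a narrow bump is lost.\<close>
  have "\<exists>e>0. ball y e \<subseteq> w ` B x" if x: "x \<in> ?P" for x
  proof -
    have "open (w ` B x)"
      using B[OF x] by (intro invariance_of_domain continuous_on_subset[OF contw]) auto
    moreover have "y \<in> w ` B x" using B(2)[OF x] x by blast
    ultimately show ?thesis using open_contains_ball by blast
  qed
  then have "\<forall>x\<in>?P. \<exists>e>0. ball y e \<subseteq> w ` B x" by (rule ballI)
  from bchoice[OF this] obtain \<eta> where "\<forall>x\<in>?P. \<eta> x > 0 \<and> ball y (\<eta> x) \<subseteq> w ` B x" ..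
  then have \<eta>: "\<And>x. x \<in> ?P \<Longrightarrow> \<eta> x > 0" "\<And>x. x \<in> ?P \<Longrightarrow> ball y (\<eta> x) \<subseteq> w ` B x" by blast+
  \<comment> \<open>Dividing by \<open>CARD('n)\<close> converts the admissible ball radius into the
    half-width of the bump's cube.\<close>
  define \<epsilon>0 where "\<epsilon>0 = Min (insert \<eta>1 (\<eta> ` ?P)) / real CARD('n)"
  have "\<epsilon>0 > 0" using fin \<eta>(1) \<eta>1 by (simp add: \<epsilon>0_def)
  moreover have "integral (cball 0 R) (\<lambda>x. pbump \<epsilon> (w x - y) * det (D x)) =
      integral UNIV (\<lambda>z. pbump \<epsilon> (z - y)) * (\<Sum>x\<in>?P. sgn (det (D x)))" if \<epsilon>: "0 < \<epsilon>" "\<epsilon> < \<epsilon>0" for \<epsilon>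
  proof -
    let ?c = "integral UNIV (\<lambda>z. pbump \<epsilon> (z - y))"
    let ?f = "\<lambda>x. pbump \<epsilon> (w x - y) * det (D x)"
    have "\<epsilon> * real CARD('n) < Min (insert \<eta>1 (\<eta> ` ?P))" using \<epsilon>(2) by (simp add: \<epsilon>0_def field_simps)
    then have en: "\<epsilon> * real CARD('n) \<le> \<eta>1" "\<And>x. x \<in> ?P \<Longrightarrow> \<epsilon> * real CARD('n) \<le> \<eta> x"
      using fin by auto
    have "integral (cball 0 R) ?f = integral (\<Union>x\<in>?P. B x) ?f"
    proof (rule integral_eq_on_subset)
      show "(\<Union>x\<in>?P. B x) \<subseteq> cball 0 R" using B(3) by (meson UN_least ball_subset_cball order_trans)
      show "?f x = 0" if "x \<in> cball 0 R" "x \<notin> (\<Union>x\<in>?P. B x)" for x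
        using pbump_shift_eq_0[OF \<epsilon>(1) en(1), of "w x" y] \<eta>1(2)[of x] that by auto
    qed
    also have "\<dots> = (\<Sum>x\<in>?P. ?c * sgn (det (D x)))"
    proof (rule integral_unique, rule has_integral_UN[OF fin])
      fix x assume x: "x \<in> ?P"
      let ?g = "\<lambda>z. pbump \<epsilon> (z - y)"
      have "?g absolutely_integrable_on (w ` B x)"
      proof (rule set_integrable_subset[OF absolutely_integrable_pbump[OF \<epsilon>(1)]])
        have "open (w ` B x)"
          using B[OF x] by (intro invariance_of_domain continuous_on_subset[OF contw]) auto
        then show "w ` B x \<in> sets lebesgue" by (simp add: lebesgue_openin)
      qed auto
      moreover have "integral (w ` B x) ?g = ?c"
      proof (rule integral_eq_on_subset[symmetric])
        show "?g z = 0" if "z \<notin> w ` B x" for z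
          using that \<eta>(2)[OF x] by (intro pbump_shift_eq_0[OF \<epsilon>(1) en(2)[OF x]]) blast
      qed simp
      ultimately have "?g absolutely_integrable_on (w ` B x) \<and> integral (w ` B x) ?g = ?c" by (rule conjI)
      moreover have "(w has_derivative (\<lambda>h. D z *v h)) (at z within B x)" if "z \<in> B x" for z
        by (rule has_derivative_at_withinI[OF c1_mapD(2)[OF cR subsetD[OF B(3)[OF x] that]]])
      ultimately have "(\<lambda>z. \<bar>det (matrix (\<lambda>h. D z *v h))\<bar> * ?g (w z)) absolutely_integrable_on B x \<and>
        integral (B x) (\<lambda>z. \<bar>det (matrix (\<lambda>h. D z *v h))\<bar> * ?g (w z)) = ?c"
        using change_of_variables[OF borel_open[OF B(1)[OF x]] _ B(4)[OF x], of "\<lambda>z h. D z *v h" ?g ?c]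
        by simp
      then have cov: "(\<lambda>z. \<bar>det (D z)\<bar> * ?g (w z)) absolutely_integrable_on B x"
          "integral (B x) (\<lambda>z. \<bar>det (D z)\<bar> * ?g (w z)) = ?c"
        by (simp_all add: matrix_of_matrix_vector_mul)
      have "((\<lambda>z. \<bar>det (D z)\<bar> * ?g (w z)) has_integral ?c) (B x)"
        using integrable_integral[OF set_lebesgue_integral_eq_integral(1)[OF cov(1)]] unfolding cov(2) .
      then have scaled: "((\<lambda>z. sgn (det (D x)) * (\<bar>det (D z)\<bar> * ?g (w z))) has_integral sgn (det (D x)) * ?c) (B x)"
        by (rule has_integral_mult_right)
      have "(?f has_integral sgn (det (D x)) * ?c) (B x)"
      proof (rule has_integral_eq[OF _ scaled])
        fix z assume "z \<in> B x"
        then have "sgn (det (D x)) * \<bar>det (D z)\<bar> = det (D z)"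
          using B(5)[OF x] by (simp add: sgn_mult_abs flip: B(5)[OF x])
        then show "sgn (det (D x)) * (\<bar>det (D z)\<bar> * ?g (w z)) = ?f z"
          by (simp flip: mult.assoc)
      qed
      then show "(?f has_integral ?c * sgn (det (D x))) (B x)" by (simp only: mult.commute)
    next
      show "pairwise (\<lambda>x x'. negligible (B x \<inter> B x')) ?P"
        unfolding pairwise_def using disj by simp
    qed
    finally show ?thesis by (simp add: sum_distrib_left)
  qed
  ultimately show "\<exists>\<epsilon>0>0. \<forall>\<epsilon>. 0 < \<epsilon> \<and> \<epsilon> < \<epsilon>0 \<longrightarrow>
      integral (cball 0 R) (\<lambda>x. pbump \<epsilon> (w x - y) * det (D x)) =
      integral UNIV (\<lambda>z. pbump \<epsilon> (z - y)) * (\<Sum>x\<in>?P. sgn (det (D x)))" by blast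
qed

text \<open>Compactness is used twice. The pairs (x, t) whose segment point equals \<open>y\<close>
  form a compact set missing the sphere, so their norms keep a distance from 1; on the compact shell
  beyond them the segment keeps a positive distance from \<open>y\<close>.\<close>

lemma segment_margin:
  fixes w0 w1 :: "real^'n \<Rightarrow> real^'n"
  assumes cont: "continuous_on (cball 0 1) w0" "continuous_on (cball 0 1) w1"
    and avoid: "\<And>x t. norm x = 1 \<Longrightarrow> 0 \<le> t \<Longrightarrow> t \<le> 1 \<Longrightarrow> w1 x + t *\<^sub>R (w0 x - w1 x) \<noteq> y"
  obtains R \<eta> where "0 < R" "R < 1" "\<eta> > 0"
    "\<And>x t. R \<le> norm x \<Longrightarrow> norm x \<le> 1 \<Longrightarrow> 0 \<le> t \<Longrightarrow> t \<le> 1 \<Longrightarrow> norm (w1 x + t *\<^sub>R (w0 x - w1 x) - y) \<ge> \<eta>"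
proof -
  define h where "h = (\<lambda>(x, t). w1 x + t *\<^sub>R (w0 x - w1 x))"
  have conth: "continuous_on (cball 0 1 \<times> {0..1}) h"
    unfolding h_def case_prod_beta
    by (intro continuous_intros continuous_on_compose2[OF cont(1)] continuous_on_compose2[OF cont(2)]) auto
  let ?Z = "{p \<in> cball 0 1 \<times> {0..1}. h p = y}"
  have "closed ?Z"
    by (rule continuous_closed_preimage_constant[OF conth]) (auto intro: closed_Times)
  moreover have "bounded ?Z"
    by (rule bounded_subset[of "cball 0 1 \<times> {0..1}"]) (auto intro: bounded_Times)
  ultimately have "compact ?Z" by (simp add: compact_eq_bounded_closed)
  then have cN: "compact ((\<lambda>p. norm (fst p)) ` ?Z)"
    by (intro compact_continuous_image continuous_intros)
  have "1 \<notin> (\<lambda>p. norm (fst p)) ` ?Z"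
  proof
    assume "1 \<in> (\<lambda>p. norm (fst p)) ` ?Z"
    then obtain x t where "norm x = 1" "t \<in> {0..1}" "h (x, t) = y" by auto
    then show False using avoid[of x t] by (simp add: h_def)
  qed
  from separate_point_closed[OF compact_imp_closed[OF cN] this]
  obtain d where d: "d > 0" "\<forall>s\<in>(\<lambda>p. norm (fst p)) ` ?Z. d \<le> dist 1 s" by blast
  \<comment> \<open>\<open>1 - d / 2\<close> lies beyond all points that hit \<open>y\<close>; the
    maximum with 1/2 keeps the radius positive when \<open>d\<close> is large.\<close>
  define R where "R = max (1/2) (1 - d / 2)"
  have R: "0 < R" "R < 1" "1 - d < R" using d(1) by (auto simp: R_def)
  let ?K = "(cball 0 1 - ball 0 R) \<times> {0..1}"
  have cK: "compact (h ` ?K)"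
    by (intro compact_continuous_image continuous_on_subset[OF conth] compact_Times compact_diff) auto
  have "y \<notin> h ` ?K"
  proof
    assume "y \<in> h ` ?K"
    then obtain p where p: "p \<in> ?K" "h p = y" by blast
    then have "p \<in> ?Z" by auto
    then have "d \<le> dist 1 (norm (fst p))" using d(2) by blast
    moreover have "R \<le> norm (fst p)" "norm (fst p) \<le> 1" using p(1) by auto
    ultimately show False using R by (simp add: dist_real_def)
  qed
  from separate_point_closed[OF compact_imp_closed[OF cK] this]
  obtain \<eta> where \<eta>: "\<eta> > 0" "\<forall>z\<in>h ` ?K. \<eta> \<le> dist y z" by blast
  show thesis
  proof (rule that[OF R(1,2) \<eta>(1)])
    fix x t assume "R \<le> norm (x :: real^'n)" "norm x \<le> 1" "0 \<le> t" "t \<le> (1 :: real)"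
    then have "(x, t) \<in> ?K" by simp
    then have "\<eta> \<le> dist y (h (x, t))" using \<eta>(2) by blast
    then show "norm (w1 x + t *\<^sub>R (w0 x - w1 x) - y) \<ge> \<eta>"
      by (simp add: h_def dist_norm norm_minus_commute)
  qed
qed

text \<open>Both counts equal the same weighted Jacobian integral divided by the positive mass of
  the bump, once \<epsilon> is below the two counting thresholds and the bump fits into the margin
  left by the segments.\<close>

lemma signed_count_homotopy:
  fixes w0 w1 :: "real^'n \<Rightarrow> real^'n"
  assumes cont: "continuous_on (cball 0 1) w0" "continuous_on (cball 0 1) w1"
    and c0: "c1_map (ball 0 1) w0 D0" and c1: "c1_map (ball 0 1) w1 D1"
    and avoid: "\<And>x t. norm x = 1 \<Longrightarrow> 0 \<le> t \<Longrightarrow> t \<le> 1 \<Longrightarrow> w1 x + t *\<^sub>R (w0 x - w1 x) \<noteq> y"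
    and reg: "\<And>x. x \<in> ball 0 1 \<Longrightarrow> w0 x = y \<Longrightarrow> det (D0 x) \<noteq> 0"
      "\<And>x. x \<in> ball 0 1 \<Longrightarrow> w1 x = y \<Longrightarrow> det (D1 x) \<noteq> 0"
  shows "(\<Sum>x | x \<in> ball 0 1 \<and> w0 x = y. sgn (det (D0 x))) = (\<Sum>x | x \<in> ball 0 1 \<and> w1 x = y. sgn (det (D1 x)))"
proof -
  obtain R \<eta> where R: "0 < R" "R < 1" and \<eta>: "\<eta> > 0"
    "\<And>x t. R \<le> norm x \<Longrightarrow> norm x \<le> 1 \<Longrightarrow> 0 \<le> t \<Longrightarrow> t \<le> 1 \<Longrightarrow> norm (w1 x + t *\<^sub>R (w0 x - w1 x) - y) \<ge> \<eta>"
  proof (rule segment_margin[OF cont avoid])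
    fix R \<eta> assume "0 < R" "R < 1" "\<eta> > 0" "\<And>x t. R \<le> norm x \<Longrightarrow> norm x \<le> 1 \<Longrightarrow> 0 \<le> t \<Longrightarrow> t \<le> 1 \<Longrightarrow>
        norm (w1 x + t *\<^sub>R (w0 x - w1 x) - y) \<ge> \<eta>"
    then show thesis by (rule that)
  qed
  have in0: "norm x < R \<and> det (D0 x) \<noteq> 0" if "x \<in> ball 0 1" "w0 x = y" for x
    using \<eta>(2)[of x 1] that reg(1)[OF that] \<eta>(1) by (cases "norm x < R") auto
  have in1: "norm x < R \<and> det (D1 x) \<noteq> 0" if "x \<in> ball 0 1" "w1 x = y" for x
    using \<eta>(2)[of x 0] that reg(2)[OF that] \<eta>(1) by (cases "norm x < R") auto
  obtain e0 where e0: "e0 > 0" "\<forall>\<epsilon>. 0 < \<epsilon> \<and> \<epsilon> < e0 \<longrightarrow>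
      integral (cball 0 R) (\<lambda>x. pbump \<epsilon> (w0 x - y) * det (D0 x)) =
      integral UNIV (\<lambda>z. pbump \<epsilon> (z - y)) * (\<Sum>x | x \<in> ball 0 1 \<and> w0 x = y. sgn (det (D0 x)))"
    using integral_pbump_count(2)[OF c0 R in0] by blast
  obtain e1 where e1: "e1 > 0" "\<forall>\<epsilon>. 0 < \<epsilon> \<and> \<epsilon> < e1 \<longrightarrow>
      integral (cball 0 R) (\<lambda>x. pbump \<epsilon> (w1 x - y) * det (D1 x)) =
      integral UNIV (\<lambda>z. pbump \<epsilon> (z - y)) * (\<Sum>x | x \<in> ball 0 1 \<and> w1 x = y. sgn (det (D1 x)))"
    using integral_pbump_count(2)[OF c1 R in1] by blast
  define m where "m = min (min e0 e1) (\<eta> / real CARD('n))"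
  have m: "m > 0" "m \<le> e0" "m \<le> e1" "m \<le> \<eta> / real CARD('n)"
    using e0(1) e1(1) \<eta>(1) by (auto simp: m_def)
  define \<epsilon> where "\<epsilon> = m / 2"
  have \<epsilon>: "\<epsilon> > 0" "\<epsilon> < e0" "\<epsilon> < e1" "\<epsilon> < \<eta> / real CARD('n)" unfolding \<epsilon>_def using m by linarith+
  then have "\<epsilon> * real CARD('n) \<le> \<eta>" by (simp add: pos_less_divide_eq)
  then have "integral (cball 0 R) (\<lambda>x. pbump \<epsilon> (w0 x - y) * det (D0 x)) =
         integral (cball 0 R) (\<lambda>x. pbump \<epsilon> (w1 x - y) * det (D1 x))"
    using \<eta>(2) by (intro integral_pbump_homotopy[OF c0 c1 R \<epsilon>(1)]) (meson less_imp_le order_trans)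
  then show ?thesis
    using e0(2) e1(2) \<epsilon> integral_pbump_pos[OF \<epsilon>(1), of y] by auto
qed

section \<open>From smooth approximants to the value of the degree\<close>

lemma smooth_on_imp_c1_map:
  fixes w :: "real^'n \<Rightarrow> real^'n"
  assumes "smooth_on S w" "open S"
  shows "c1_map S w (\<lambda>x. matrix (frechet_derivative w (at x)))"
  unfolding c1_map_def
proof (intro conjI ballI)
  have "partial_derivs [] w differentiable (at x)" if "x \<in> S" for x
    using assms(1) that unfolding smooth_on_def by blast
  then have diff: "w differentiable (at x)" if "x \<in> S" for x
    using that by (simp add: partial_derivs_def)
  have "partial_derivs [i] w differentiable (at x)" if "x \<in> S" for x i
    using assms(1) that unfolding smooth_on_def by blast
  then have cont: "continuous_on S (partial_deriv i w)" for i
    by (intro continuous_at_imp_continuous_on ballI differentiable_imp_continuous_within)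
       (simp add: partial_derivs_def)
  have "matrix (frechet_derivative w (at x)) = (\<chi> i j. partial_deriv j w x $ i)" for x
    by (simp add: matrix_def partial_deriv_def)
  then show "continuous_on S (\<lambda>x. matrix (frechet_derivative w (at x)))"
    using cont by (auto intro!: continuous_intros)
  fix x assume "x \<in> S"
  then have d: "(w has_derivative frechet_derivative w (at x)) (at x)"
    using diff frechet_derivative_works by blast
  then show "(w has_derivative (\<lambda>h. matrix (frechet_derivative w (at x)) *v h)) (at x)"
    by (simp add: matrix_vector_mul(2)[OF has_derivative_linear[OF d]])
qed

text \<open>This discharges the definite description. At a boundary point \<open>x\<close>, two
  admissible maps have values in the ball about \<open>u x\<close> whose radius is the distance from
  \<open>y\<close> to the boundary image. The ball is convex and does not contain \<open>y\<close>,
  so the straight homotopy avoids \<open>y\<close>.\<close>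

theorem degree_closure_eq:
  fixes u w :: "real^'n \<Rightarrow> real^'n"
  assumes y: "y \<notin> u ` sphere 0 1"
    and sm: "smooth_on (ball 0 1) w" and cont: "continuous_on (cball 0 1) w"
    and near: "\<And>x. x \<in> cball 0 1 \<Longrightarrow> norm (w x - u x) < infdist y (u ` sphere 0 1)"
    and reg: "regular_value w (ball 0 1) y"
  shows "real_of_int (degree_closure u (ball 0 1) y) = (\<Sum>x | x \<in> ball 0 1 \<and> w x = y. sgn (jacobian w x))"
proof -
  let ?S = "\<lambda>w. \<Sum>x | x \<in> ball 0 1 \<and> w x = y. sgn (jacobian w x)"
  let ?adm = "\<lambda>w. smooth_on (ball 0 1) w \<and> continuous_on (closure (ball 0 1)) w \<and>
            (\<forall>x\<in>closure (ball 0 1). norm (w x - u x) < infdist y (u ` frontier (ball 0 1))) \<and>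
            regular_value w (ball 0 1) y"
  have w: "?adm w" using sm cont near reg by simp
  have same: "?S w' = ?S w" if w': "?adm w'" for w'
    unfolding jacobian_def
  proof (rule signed_count_homotopy)
    show "c1_map (ball 0 1) w' (\<lambda>x. matrix (frechet_derivative w' (at x)))"
      "c1_map (ball 0 1) w (\<lambda>x. matrix (frechet_derivative w (at x)))"
      using w w' by (auto intro: smooth_on_imp_c1_map)
    show "w x + t *\<^sub>R (w' x - w x) \<noteq> y" if x: "norm x = 1" and t: "0 \<le> t" "t \<le> 1" for x t
    proof
      assume eq: "w x + t *\<^sub>R (w' x - w x) = y"
      let ?B = "ball (u x) (infdist y (u ` sphere 0 1))"
      have "w x \<in> ?B" "w' x \<in> ?B"
        using w w' x by (auto simp: dist_norm norm_minus_commute)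
      then have "(1 - t) *\<^sub>R w x + t *\<^sub>R w' x \<in> ?B"
        using t by (intro convexD[OF convex_ball]) auto
      then have "y \<in> ?B" using eq by (simp add: algebra_simps)
      moreover have "infdist y (u ` sphere 0 1) \<le> dist y (u x)"
        using x by (intro infdist_le) auto
      ultimately show False by (simp add: dist_commute)
    qed
  qed (use w w' in \<open>auto simp: regular_value_def jacobian_def\<close>)
  have "\<exists>d::int. ?S w = real_of_int d"
  proof
    show "?S w = real_of_int (\<Sum>x | x \<in> ball 0 1 \<and> w x = y. sgn (if jacobian w x > 0 then 1 else if jacobian w x < 0 then -1 else 0))"
      by (simp add: sgn_if of_int_sum) (intro sum.cong, auto)
  qed
  then obtain d :: int where d: "?S w = real_of_int d" by blast
  have "degree_closure u (ball 0 1) y = d"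
    unfolding degree_closure_def frontier_ball[OF zero_less_one]
  proof (subst if_not_P[OF y], rule the_equality)
    show "\<forall>w. smooth_on (ball 0 1) w \<and> continuous_on (closure (ball 0 1)) w \<and>
        (\<forall>x\<in>closure (ball 0 1). norm (w x - u x) < infdist y (u ` sphere 0 1)) \<and> regular_value w (ball 0 1) y \<longrightarrow>
        real_of_int d = (\<Sum>x\<in>{x \<in> ball 0 1. w x = y}. sgn (jacobian w x))"
      using same d by simp
    show "d' = d" if "\<forall>w. smooth_on (ball 0 1) w \<and> continuous_on (closure (ball 0 1)) w \<and>
        (\<forall>x\<in>closure (ball 0 1). norm (w x - u x) < infdist y (u ` sphere 0 1)) \<and> regular_value w (ball 0 1) y \<longrightarrow>
        real_of_int d' = (\<Sum>x\<in>{x \<in> ball 0 1. w x = y}. sgn (jacobian w x))" for d'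
      using that[rule_format, of w] w d by simp
  qed
  then show ?thesis using d by simp
qed

subsection \<open>A class of smooth functions\<close>

text \<open>The factor \<open>poly P (1 / t)\<close> makes the family closed under differentiation.\<close>

definition bumpP :: "real poly \<Rightarrow> real \<Rightarrow> real" where
  "bumpP P t = (if t \<le> 0 then 0 else poly P (1 / t) * exp (- (1 / t)))"

lemma tendsto_poly_times_exp_minus: "((\<lambda>x. poly Q x * exp (- x)) \<longlongrightarrow> (0::real)) at_top"
proof -
  have "((\<lambda>x. \<Sum>i\<le>degree Q. coeff Q i * (x ^ i / exp x)) \<longlongrightarrow> (\<Sum>i\<le>degree Q. coeff Q i * 0)) at_top"
    by (intro tendsto_sum tendsto_mult tendsto_const tendsto_power_div_exp_0)
  then show ?thesis
    by (simp add: poly_altdef sum_distrib_right exp_minus divide_inverse mult.assoc)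
qed

text \<open>The chain rule at 1/t replaces P by X^2 (P - P'). At 0 the right difference quotient,
  after substituting x = 1/h, is a polynomial times exp(-x) and tends to 0.\<close>

lemma DERIV_bumpP: "(bumpP P has_real_derivative bumpP (monom 1 2 * (P - pderiv P)) t) (at t)"
proof -
  consider "t < 0" | "t > 0" | "t = 0" by linarith
  then show ?thesis
  proof cases
    case 1
    have "((\<lambda>t. 0::real) has_real_derivative 0) (at t)" by simp
    then have "(bumpP P has_real_derivative 0) (at t)"
      by (rule has_field_derivative_transform_within_open[of _ _ _ "{..<0}"]) (use 1 in \<open>auto simp: bumpP_def\<close>)
    then show ?thesis using 1 by (simp add: bumpP_def)
  next
    case 2
    have inv: "((\<lambda>t. 1 / t) has_real_derivative - (1 / t\<^sup>2)) (at t)"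
      using 2 by (auto intro!: derivative_eq_intros simp: power2_eq_square)
    have "((\<lambda>t. poly P (1 / t) * exp (- (1 / t))) has_real_derivative
       (poly (pderiv P) (1 / t) * (- (1 / t\<^sup>2))) * exp (- (1 / t)) 
       + (exp (- (1 / t)) * (- (- (1 / t\<^sup>2)))) * poly P (1 / t)) (at t)"
      by (intro DERIV_mult DERIV_chain2[OF poly_DERIV inv] DERIV_chain2[OF DERIV_exp] DERIV_minus inv)
    then have "((\<lambda>t. poly P (1 / t) * exp (- (1 / t))) has_real_derivative 
        bumpP (monom 1 2 * (P - pderiv P)) t) (at t)"
      using 2 by (simp add: bumpP_def poly_monom field_simps power2_eq_square)
    then show ?thesis
      by (rule has_field_derivative_transform_within_open[of _ _ _ "{0<..}"]) (use 2 in \<open>auto simp: bumpP_def\<close>)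
  next
    case 3
    have "((\<lambda>h. bumpP P h / h) \<longlongrightarrow> 0) (at_left 0)"
      by (rule tendsto_eventually) (auto simp: eventually_at_filter bumpP_def)
    moreover have "((\<lambda>h. bumpP P h / h) \<longlongrightarrow> 0) (at_right 0)"
    proof (rule filterlim_at_right_to_top[THEN iffD2])
      have "((\<lambda>x. poly (monom 1 1 * P) x * exp (- x)) \<longlongrightarrow> 0) at_top"
        by (rule tendsto_poly_times_exp_minus)
      then show "((\<lambda>x. bumpP P (inverse x) / inverse x) \<longlongrightarrow> 0) at_top"
      proof (rule Lim_transform_eventually)
        show "\<forall>\<^sub>F x in at_top. poly (monom 1 1 * P) x * exp (- x) = bumpP P (inverse x) / inverse x"
          using eventually_gt_at_top[of "0::real"]
          by eventually_elim (simp add: bumpP_def poly_monom divide_inverse not_le)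
      qed
    qed
    ultimately have "((\<lambda>h. bumpP P h / h) \<longlongrightarrow> 0) (at 0)"
      by (simp add: filterlim_split_at)
    then show ?thesis using 3 by (simp add: DERIV_def bumpP_def)
  qed
qed

definition bump :: "real \<Rightarrow> real" where
  "bump t = (if t \<le> 0 then 0 else exp (- (1 / t)))"

definition bump' :: "real \<Rightarrow> real" where
  "bump' t = (if t \<le> 0 then 0 else exp (- (1 / t)) / t\<^sup>2)"

lemma bump_eq_bumpP: "bump = bumpP 1"
  by (simp add: fun_eq_iff bump_def bumpP_def)

lemma DERIV_bump: "(bump has_real_derivative bump' t) (at t)"
proof -
  have "bumpP (monom 1 2 * (1 - pderiv 1)) t = bump' t"
    by (simp add: bumpP_def bump'_def poly_monom power_divide)
  then show ?thesis using DERIV_bumpP[of 1 t] by (simp add: bump_eq_bumpP)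
qed

lemma continuous_on_bump [continuous_intros]:
  assumes "continuous_on S f" shows "continuous_on S (\<lambda>x. bump (f x))"
proof -
  have "continuous_on UNIV bump" by (meson DERIV_bump DERIV_isCont continuous_at_imp_continuous_on)
  then show ?thesis using assms continuous_on_compose2[of UNIV bump S f] by blast
qed

lemma bump_bounds: "0 \<le> bump t" "bump t \<le> 1" and bump_pos: "t > 0 \<Longrightarrow> bump t > 0"
  and bump_eq_0: "t \<le> 0 \<Longrightarrow> bump t = 0" and bump'_nonneg: "0 \<le> bump' t"
  by (simp_all add: bump_def bump'_def)

text \<open>With u = 1/t the function is u^2 exp(-u), and exp u dominates u^2/2.\<close>

lemma bump'_le: "bump' t \<le> 2"
proof (cases "t \<le> 0")
  case False
  define u where "u = 1 / t"
  have u: "u > 0" using False by (simp add: u_def)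
  have "u\<^sup>2 / 2 \<le> exp u" using exp_lower_Taylor_quadratic[of u] u by simp
  then have "exp (- u) * u\<^sup>2 \<le> 2" by (simp add: exp_minus divide_simps)
  then show ?thesis using False by (simp add: bump'_def u_def power_divide)
qed (simp add: bump'_def)

text \<open>Smoothness asks for differentiability of all iterated partial derivatives. A class of
  expressions stable under partial derivatives reduces this to an induction over the list of
  directions.\<close>

inductive elem_smooth :: "(real^'n \<Rightarrow> real) \<Rightarrow> bool" where
  const: "elem_smooth (\<lambda>x. c)"
| coord: "elem_smooth (\<lambda>x. x $ i)"
| add: "elem_smooth f \<Longrightarrow> elem_smooth g \<Longrightarrow> elem_smooth (\<lambda>x. f x + g x)"
| mult: "elem_smooth f \<Longrightarrow> elem_smooth g \<Longrightarrow> elem_smooth (\<lambda>x. f x * g x)"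
| bumpP: "elem_smooth f \<Longrightarrow> elem_smooth (\<lambda>x. bumpP P (f x))"

lemma elem_smooth_bump: "elem_smooth f \<Longrightarrow> elem_smooth (\<lambda>x. bump (f x))"
  unfolding bump_eq_bumpP by (rule elem_smooth.bumpP)

lemma elem_smooth_diff: "elem_smooth f \<Longrightarrow> elem_smooth g \<Longrightarrow> elem_smooth (\<lambda>x. f x - g x)"
  using elem_smooth.add[OF _ elem_smooth.mult[OF elem_smooth.const[of "-1"], of g], of f] by simp

lemma elem_smooth_sum: "(\<And>i. i \<in> I \<Longrightarrow> elem_smooth (f i)) \<Longrightarrow> elem_smooth (\<lambda>x. \<Sum>i\<in>I. f i x)"
  by (induction I rule: infinite_finite_induct) (auto intro: elem_smooth.intros)

lemma elem_smooth_power2: "elem_smooth f \<Longrightarrow> elem_smooth (\<lambda>x. (f x)\<^sup>2)"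
  unfolding power2_eq_square by (rule elem_smooth.mult)

lemma elem_smooth_norm_sq: "elem_smooth (\<lambda>x::real^'n. (norm (x - b))\<^sup>2)"
proof -
  have "elem_smooth (\<lambda>x::real^'n. \<Sum>i\<in>UNIV. (x $ i - b $ i)\<^sup>2)"
    by (intro elem_smooth_sum elem_smooth_power2 elem_smooth_diff elem_smooth.intros)
  moreover have "(norm (x - b))\<^sup>2 = (\<Sum>i\<in>UNIV. (x $ i - b $ i)\<^sup>2)" for x
    unfolding power2_norm_eq_inner by (simp add: inner_vec_def power2_eq_square)
  ultimately show ?thesis by (simp only:)
qed

lemma elem_smooth_has_derivative:
  fixes f :: "real^'n \<Rightarrow> real"
  assumes "elem_smooth f"
  shows "\<exists>g. (\<forall>i. elem_smooth (g i)) \<and> (\<forall>x. (f has_derivative (\<lambda>h. \<Sum>i\<in>UNIV. g i x * h $ i)) (at x))"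
  using assms
proof induction
  case (const c)
  show ?case by (rule exI[of _ "\<lambda>i x. 0"]) (simp add: elem_smooth.const)
next
  case (coord i)
  have "((\<lambda>x. x $ i) has_derivative (\<lambda>h. \<Sum>j\<in>UNIV. (if j = i then 1 else 0) * h $ j)) (at x)" for x :: "real^'n"
    using bounded_linear_imp_has_derivative[OF bounded_linear_vec_nth]
    by (simp add: if_distrib[of "\<lambda>c. c * _"] cong: if_cong)
  then show ?case
    by (intro exI[of _ "\<lambda>j x. if j = i then 1 else 0"]) (simp add: elem_smooth.const)
next
  case (add f g)
  then obtain f' g' where "\<forall>i. elem_smooth (f' i)" "\<forall>i. elem_smooth (g' i)"
    "\<And>x. (f has_derivative (\<lambda>h. \<Sum>i\<in>UNIV. f' i x * h $ i)) (at x)"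
    "\<And>x. (g has_derivative (\<lambda>h. \<Sum>i\<in>UNIV. g' i x * h $ i)) (at x)" by blast
  then show ?case
    by (intro exI[of _ "\<lambda>i x. f' i x + g' i x"])
       (auto intro!: elem_smooth.add has_derivative_add simp: distrib_right sum.distrib)
next
  case (mult f g)
  then obtain f' g' where *: "\<forall>i. elem_smooth (f' i)" "\<forall>i. elem_smooth (g' i)"
    "\<And>x. (f has_derivative (\<lambda>h. \<Sum>i\<in>UNIV. f' i x * h $ i)) (at x)"
    "\<And>x. (g has_derivative (\<lambda>h. \<Sum>i\<in>UNIV. g' i x * h $ i)) (at x)" by blast
  have "((\<lambda>x. f x * g x) has_derivative (\<lambda>h. \<Sum>i\<in>UNIV. (f x * g' i x + f' i x * g x) * h $ i)) (at x)" for x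
    by (rule has_derivative_eq_rhs[OF has_derivative_mult[OF *(3)[of x] *(4)[of x]]])
       (simp add: fun_eq_iff sum_distrib_left sum_distrib_right algebra_simps flip: sum.distrib)
  then show ?case using * mult.hyps
    by (intro exI[of _ "\<lambda>i x. f x * g' i x + f' i x * g x"]) (auto intro!: elem_smooth.add elem_smooth.mult)
next
  case (bumpP f P)
  then obtain f' where *: "\<forall>i. elem_smooth (f' i)" 
    "\<And>x. (f has_derivative (\<lambda>h. \<Sum>i\<in>UNIV. f' i x * h $ i)) (at x)" by blast
  let ?Q = "monom 1 2 * (P - pderiv P)"
  have "((\<lambda>x. bumpP P (f x)) has_derivative (\<lambda>h. \<Sum>i\<in>UNIV. (bumpP ?Q (f x) * f' i x) * h $ i)) (at x)" for x
    using has_derivative_compose[OF *(2)[of x] DERIV_bumpP[unfolded has_field_derivative_def]]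
    by (simp add: sum_distrib_left mult.assoc)
  then show ?case using * bumpP.hyps
    by (intro exI[of _ "\<lambda>i x. bumpP ?Q (f x) * f' i x"]) (auto intro!: elem_smooth.mult elem_smooth.bumpP)
qed

lemma partial_deriv_eqI:
  assumes "(f has_derivative f') (at x)" shows "partial_deriv i f x = f' (axis i 1)"
  using frechet_derivative_at[OF assms] by (simp add: partial_deriv_def)

lemma elem_smooth_components_differentiable:
  fixes F :: "real^'n \<Rightarrow> real^'m"
  assumes "\<And>k. elem_smooth (\<lambda>x. F x $ k)"
  shows "F differentiable (at x)" and "elem_smooth (\<lambda>x. partial_deriv i F x $ k)"
proof -
  have "\<forall>k. \<exists>g. (\<forall>i. elem_smooth (g i)) \<and> (\<forall>x. ((\<lambda>x. F x $ k) has_derivative (\<lambda>h. \<Sum>i\<in>UNIV. g i x * h $ i)) (at x))"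
    using elem_smooth_has_derivative[OF assms] by blast
  from choice[OF this] obtain g where g: "\<And>k i. elem_smooth (g k i)"
    "\<And>k x. ((\<lambda>x. F x $ k) has_derivative (\<lambda>h. \<Sum>i\<in>UNIV. g k i x * h $ i)) (at x)" by blast
  have d: "(F has_derivative (\<lambda>h. \<chi> k. \<Sum>i\<in>UNIV. g k i x * h $ i)) (at x)" for x
    by (rule has_derivative_cart) (simp add: g)
  then show "F differentiable (at x)" by (auto simp: differentiable_def)
  have "partial_deriv i F x $ k = g k i x" for x
    by (simp add: partial_deriv_eqI[OF d] axis_def if_distrib cong: if_cong)
  then show "elem_smooth (\<lambda>x. partial_deriv i F x $ k)" by (simp add: g)
qed

lemma elem_smooth_differentiable:
  fixes f :: "real^'n \<Rightarrow> real"
  assumes "elem_smooth f"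
  shows "f differentiable (at x)" and "elem_smooth (partial_deriv i f)"
proof -
  obtain g where g: "\<And>i. elem_smooth (g i)" "\<And>x. (f has_derivative (\<lambda>h. \<Sum>i\<in>UNIV. g i x * h $ i)) (at x)"
    using elem_smooth_has_derivative[OF assms] by blast
  then show "f differentiable (at x)" by (auto simp: differentiable_def)
  have "partial_deriv i f = g i"
    by (rule ext) (simp add: partial_deriv_eqI[OF g(2)] axis_def if_distrib cong: if_cong)
  then show "elem_smooth (partial_deriv i f)" by (simp add: g)
qed

lemma continuous_elem_smooth:
  fixes f :: "real^'n \<Rightarrow> real"
  assumes "elem_smooth f" shows "continuous_on S f"
  by (meson assms elem_smooth_differentiable(1) continuous_at_imp_continuous_on differentiable_imp_continuous_within)

lemma elem_smooth_imp_smooth_on: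
  fixes f :: "real^'n \<Rightarrow> real"
  assumes "elem_smooth f" shows "smooth_on S f"
proof -
  have "elem_smooth (partial_derivs ds f)" for ds
    unfolding partial_derivs_def using assms by (induction ds) (auto intro: elem_smooth_differentiable)
  then show ?thesis unfolding smooth_on_def using elem_smooth_differentiable(1) by blast
qed

lemma elem_smooth_components_imp_smooth_on:
  fixes F :: "real^'n \<Rightarrow> real^'m"
  assumes "\<And>k. elem_smooth (\<lambda>x. F x $ k)" shows "smooth_on S F"
proof -
  have "elem_smooth (\<lambda>x. partial_derivs ds F x $ k)" for ds k
    unfolding partial_derivs_def using assms
    by (induction ds arbitrary: k) (auto intro: elem_smooth_components_differentiable(2))
  then show ?thesis unfolding smooth_on_def using elem_smooth_components_differentiable(1) by blast
qed

subsection \<open>The degree of a map continuous up to the boundary\<close>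

text \<open>A boundary point is a limit point of the open ball, so the filter in \<open>Lim\<close>
  is nontrivial and the limit is unique.\<close>

lemma extend_closure_eq:
  fixes V :: "real^'n \<Rightarrow> real^'m"
  assumes "continuous_on (cball 0 1) V" "x \<in> cball 0 1"
  shows "extend_closure (ball 0 1) V x = V x"
proof (cases "x \<in> ball 0 1")
  case False
  have "(V \<longlongrightarrow> V x) (at x within cball 0 1)"
    using assms by (simp add: continuous_on_def)
  then have "(V \<longlongrightarrow> V x) (at x within ball 0 1)"
    by (rule tendsto_within_subset) auto
  moreover have "x islimpt ball 0 1"
    using assms(2) False by (simp add: islimpt_ball)
  then have "at x within ball 0 1 \<noteq> bot" by (simp add: trivial_limit_within)
  ultimately have "Lim (at x within ball 0 1) V = V x" by (intro tendsto_Lim)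
  then show ?thesis using False by (simp add: extend_closure_def)
qed (simp add: extend_closure_def)

theorem brouwer_deg_eq:
  fixes V w :: "real^'n \<Rightarrow> real^'n"
  assumes V: "continuous_on (cball 0 1) V" and y: "y \<notin> V ` sphere 0 1"
    and sm: "smooth_on (ball 0 1) w" and cont: "continuous_on (cball 0 1) w"
    and near: "\<And>x. x \<in> cball 0 1 \<Longrightarrow> norm (w x - V x) < infdist y (V ` sphere 0 1)"
    and reg: "regular_value w (ball 0 1) y"
  shows "real_of_int (brouwer_deg V (ball 0 1) y) = (\<Sum>x | x \<in> ball 0 1 \<and> w x = y. sgn (jacobian w x))"
proof -
  have "extend_closure (ball 0 1) V ` sphere 0 1 = V ` sphere 0 1"
    by (intro image_cong refl extend_closure_eq[OF V]) auto
  then show ?thesis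
    unfolding brouwer_deg_def using y near extend_closure_eq[OF V]
    by (intro degree_closure_eq sm cont reg) auto
qed

lemma brouwer_deg_boundary:
  fixes V :: "real^'n \<Rightarrow> real^'n"
  assumes "continuous_on (cball 0 1) V" "y \<in> V ` sphere 0 1"
  shows "brouwer_deg V (ball 0 1) y = 0"
proof -
  have "extend_closure (ball 0 1) V ` sphere 0 1 = V ` sphere 0 1"
    by (intro image_cong refl extend_closure_eq[OF assms(1)]) auto
  then show ?thesis using assms(2) by (simp add: brouwer_deg_def degree_closure_def)
qed

subsection \<open>The identity map and integer smoothness\<close>

lemma jacobian_eqI:
  fixes w :: "real^'n \<Rightarrow> real^'n"
  assumes "(w has_derivative (\<lambda>h. D *v h)) (at x)" shows "jacobian w x = det D"
  using frechet_derivative_at[OF assms] by (simp add: jacobian_def flip: frechet_derivative_at[OF assms])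

lemma sphere_nonempty: "sphere (0::real^'n) 1 \<noteq> {}"
proof -
  have "axis undefined 1 \<in> sphere (0::real^'n) 1" by (simp add: norm_axis_1)
  then show ?thesis by blast
qed

lemma infdist_image_sphere_pos:
  fixes V :: "real^'n \<Rightarrow> real^'n"
  assumes "continuous_on (cball 0 1) V" "y \<notin> V ` sphere 0 1"
  shows "infdist y (V ` sphere 0 1) > 0"
proof (rule infdist_pos_not_in_closed)
  have "compact (V ` sphere 0 1)"
    by (intro compact_continuous_image continuous_on_subset[OF assms(1)]) auto
  then show "closed (V ` sphere 0 1)" by (rule compact_imp_closed)
qed (use assms sphere_nonempty in auto)

text \<open>The identity is its own admissible approximant with Jacobian 1. On the sphere the
  conventional value 0 agrees with the indicator of the open ball.\<close>

lemma brouwer_deg_ident: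
  "(\<lambda>y. real_of_int (brouwer_deg (\<lambda>x. x) (ball 0 1) y)) = indicator (ball (0::real^'n) 1)"
proof
  fix y :: "real^'n"
  have cont: "continuous_on (cball 0 1) (\<lambda>x::real^'n. x)" by (rule continuous_on_id)
  have jac: "jacobian (\<lambda>x. x) x = 1" for x :: "real^'n"
    using jacobian_eqI[of "\<lambda>x. x" "mat 1" x] by simp
  show "real_of_int (brouwer_deg (\<lambda>x. x) (ball 0 1) y) = indicator (ball 0 1) y"
  proof (cases "y \<in> sphere 0 1")
    case True
    then have "brouwer_deg (\<lambda>x. x) (ball 0 1) y = 0" by (intro brouwer_deg_boundary[OF cont]) auto
    moreover have "y \<notin> ball 0 1" using True by auto
    ultimately show ?thesis by (simp add: indicator_def)
  next
    case False
    have y: "y \<notin> (\<lambda>x. x) ` sphere 0 1" using False by simp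
    have "real_of_int (brouwer_deg (\<lambda>x. x) (ball 0 1) y) =
        (\<Sum>x | x \<in> ball 0 1 \<and> x = y. sgn (jacobian (\<lambda>x. x) x))"
    proof (rule brouwer_deg_eq[OF cont y _ cont])
      show "smooth_on (ball 0 1) (\<lambda>x::real^'n. x)"
        by (intro elem_smooth_components_imp_smooth_on elem_smooth.coord)
      show "regular_value (\<lambda>x. x) (ball 0 1) y" by (simp add: regular_value_def jac)
      show "norm (x - x) < infdist y ((\<lambda>x. x) ` sphere 0 1)" for x :: "real^'n"
        using infdist_image_sphere_pos[OF cont y] by simp
    qed
    also have "{x. x \<in> ball 0 1 \<and> x = y} = (if y \<in> ball 0 1 then {y} else {})" by auto
    finally show ?thesis by (simp add: jac indicator_def)
  qed
qed

section \<open>The indicator of the ball and weak derivatives\<close>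

lemma continuous_imp_borel_measurable_lebesgue:
  fixes f :: "'a::euclidean_space \<Rightarrow> real"
  assumes "continuous_on UNIV f" shows "f \<in> borel_measurable lebesgue"
proof -
  have "f \<in> borel_measurable lborel" using borel_measurable_continuous_onI[OF assms] by simp
  then show ?thesis by (rule measurable_completion)
qed

text \<open>The pointwise inequality |t| \<le> 1 + |t|^p, valid for p \<ge> 1, provides an
  integrable majorant on a set of finite measure.\<close>

lemma Lp_space_integrable_on_bounded:
  fixes g :: "real^'n \<Rightarrow> real"
  assumes g: "g \<in> Lp_space p" and p: "p \<ge> 1" and K: "K \<in> sets borel" "bounded K"
  shows "integrable lebesgue (\<lambda>x. indicator K x * g x)"
proof (rule Bochner_Integration.integrable_bound)
  have meas: "g \<in> borel_measurable lebesgue" and int: "integrable lebesgue (\<lambda>x. \<bar>g x\<bar> powr p)"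
    using g by (auto simp: Lp_space_def)
  have "emeasure lborel K < \<infinity>" by (rule emeasure_bounded_finite[OF K(2)])
  then have "integrable lborel (indicator K :: _ \<Rightarrow> real)"
    using K(1) by (simp add: integrable_indicator_iff)
  then have "integrable lebesgue (indicator K :: _ \<Rightarrow> real)"
    by (subst integrable_completion) (use K(1) in auto)
  then show "integrable lebesgue (\<lambda>x. indicator K x + \<bar>g x\<bar> powr p)" using int by (rule Bochner_Integration.integrable_add)
  have "K \<in> sets lebesgue" using K(1) by simp
  then show "(\<lambda>x. indicator K x * g x) \<in> borel_measurable lebesgue" using meas by measurable
  have "norm (indicator K x * g x) \<le> norm (indicator K x + \<bar>g x\<bar> powr p)" for x
  proof (cases "\<bar>g x\<bar> \<le> 1")
    case False
    then have "\<bar>g x\<bar> powr 1 \<le> \<bar>g x\<bar> powr p" using p by (intro powr_mono) auto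
    then show ?thesis using False by (simp add: indicator_def)
  next
    case True
    then have "\<bar>g x\<bar> \<le> 1 + \<bar>g x\<bar> powr p" using powr_ge_zero[of "\<bar>g x\<bar>" p] by linarith
    then show ?thesis by (auto simp: indicator_def)
  qed
  then show "AE x in lebesgue. norm (indicator K x * g x) \<le> norm (indicator K x + \<bar>g x\<bar> powr p)" by simp
qed

text \<open>A divergence theorem read off from the null Lagrangian: the map x + \<psi>(x) e, with e
  the \<open>i\<close>-th unit vector, agrees with the identity near the unit sphere, and its
  determinant is 1 plus the \<open>i\<close>-th partial derivative of \<psi>.\<close>

lemma integral_partial_deriv_compact_support:
  fixes \<psi> :: "real^'n \<Rightarrow> real"
  assumes sm: "elem_smooth \<psi>" and R: "0 < R" "R < 1"
    and z: "\<And>x. R \<le> norm x \<Longrightarrow> norm x < 1 \<Longrightarrow> \<psi> x = 0"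
  shows "integral (cball 0 R) (partial_deriv i \<psi>) = 0"
proof -
  obtain g where g: "\<And>j. elem_smooth (g j)" "\<And>x. (\<psi> has_derivative (\<lambda>h. \<Sum>j\<in>UNIV. g j x * h $ j)) (at x)"
    using elem_smooth_has_derivative[OF sm] by blast
  have cont: "continuous_on S (g j)" for S j
    by (rule continuous_elem_smooth[OF g(1)])
  have pd: "partial_deriv i \<psi> = g i"
    by (rule ext) (simp add: partial_deriv_eqI[OF g(2)] axis_def if_distrib cong: if_cong)
  define F where "F = (\<lambda>x. x + \<psi> x *\<^sub>R axis i 1)"
  define D where "D = (\<lambda>x. (\<chi> k j. (if k = j then 1 else 0) + (if k = i then g j x else 0)) :: real^'n^'n)"
  have "continuous_on (ball 0 1) (\<lambda>x. (if k = j then 1 else 0) + (if k = i then g j x else 0))" for k j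
    by (cases "k = i") (auto intro!: continuous_intros cont)
  then have cD: "continuous_on (ball 0 1) D" unfolding D_def
    by (intro continuous_on_vec_lambda)
  have "c1_map (ball 0 1) F D" unfolding c1_map_def
  proof (intro conjI ballI cD has_derivative_cart)
    fix x k
    have "((\<lambda>x. x $ k + \<psi> x * axis i 1 $ k) has_derivative
        (\<lambda>h. h $ k + (\<Sum>j\<in>UNIV. g j x * h $ j) * axis i 1 $ k)) (at x)"
      by (intro has_derivative_add has_derivative_mult_left g(2) bounded_linear_imp_has_derivative bounded_linear_vec_nth)
    moreover have "(D x *v h) $ k = h $ k + (\<Sum>j\<in>UNIV. g j x * h $ j) * axis i 1 $ k" for h
      by (simp add: D_def matrix_vector_mult_def distrib_right sum.distrib axis_def
          if_distrib[of "\<lambda>c. c * _"] cong: if_cong)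
    ultimately show "((\<lambda>x. F x $ k) has_derivative (\<lambda>h. (D x *v h) $ k)) (at x)"
      by (simp add: F_def)
  qed
  moreover have "c1_map (ball 0 1) (\<lambda>x. x) (\<lambda>x. mat 1 :: real^'n^'n)"
    by (simp add: c1_map_def)
  ultimately have "integral (cball 0 R) (\<lambda>x. det (D x)) = integral (cball 0 R) (\<lambda>x::real^'n. det (mat 1 :: real^'n^'n))"
    by (rule null_lagrangian[where R = R]) (use R z in \<open>auto simp: F_def\<close>)
  moreover have "det (D x) = 1 + g i x" for x
  proof -
    \<comment> \<open>Only row \<open>i\<close> differs from the identity matrix; its entries are
      the coefficients of that row in the rows of \<open>mat 1\<close>, and the determinant picks
      out the \<open>i\<close>-th one.\<close>
    let ?c = "\<chi> j. (if j = i then 1 else 0) + g j x"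
    have "D x = (\<chi> k. if k = i then \<Sum>j\<in>UNIV. ?c $ j *s row j (mat 1) else row k (mat 1))"
      by (simp add: D_def vec_eq_iff row_def mat_def if_distrib[of "\<lambda>c. _ * c"] sum.distrib
          cong: if_cong)
    then have "det (D x) = ?c $ i * det (mat 1 :: real^'n^'n)"
      using cramer_lemma_transpose[of i ?c "mat 1"] by simp
    then show ?thesis by simp
  qed
  moreover have "g i integrable_on cball 0 R" "(\<lambda>x. 1::real) integrable_on (cball 0 R :: (real^'n) set)"
    by (intro integrable_continuous_compact cont continuous_on_const compact_cball)+
  ultimately show ?thesis by (simp add: pd integral_add)
qed

text \<open>Since \<open>\<omega> k\<close> vanishes near the sphere, \<open>\<phi> * \<omega> k\<close> restricts to a test function inside the ball, on which
  the weak derivative acts as zero. As \<open>\<omega> k \<longlonglongrightarrow> 1\<close> off the sphere, it acts as zero on \<open>\<phi>\<close>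
  itself, whereas \<open>\<partial>\<^sub>i \<phi>\<close> is nonnegative and nonzero in the ball.\<close>

lemma indicator_ball_no_weak_deriv:
  fixes g :: "real^'n \<Rightarrow> real"
  assumes g: "g \<in> Lp_space p" and p: "p \<ge> 1" and wd: "weak_deriv [i] (indicator (ball 0 1)) g"
  shows False
proof -
  \<comment> \<open>The argument of the bump is at least 1 in the unit ball and negative outside
    radius 2. It increases radially inside the unit ball, so \<open>x $ i\<close> times the
    \<open>i\<close>-th derivative of \<eta> is nonnegative there; this makes the derivative of
    \<phi> nonnegative.\<close>
  define \<eta> where "\<eta> = (\<lambda>x::real^'n. bump (2 - ((norm (x - 0))\<^sup>2 - 1)\<^sup>2))"
  define \<phi> where "\<phi> = (\<lambda>x. x $ i * \<eta> x)"
  \<comment> \<open>Zero on a shell around the unit sphere whose width is of order k^(-1/2). Off the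
    sphere the argument tends to infinity and the value to 1.\<close>
  define \<omega> where "\<omega> = (\<lambda>k x::real^'n. bump (real k * ((norm (x - 0))\<^sup>2 - 1)\<^sup>2 - 1))"
  have sm\<eta>: "elem_smooth \<eta>" and sm\<omega>: "elem_smooth (\<omega> k)" for k
    unfolding \<eta>_def \<omega>_def
    by (intro elem_smooth_bump elem_smooth_diff elem_smooth.const elem_smooth_power2 elem_smooth_norm_sq elem_smooth.mult)+
  have sm\<phi>: "elem_smooth \<phi>" unfolding \<phi>_def by (intro elem_smooth.mult elem_smooth.coord sm\<eta>)
  have sm\<phi>\<omega>: "elem_smooth (\<lambda>x. \<phi> x * \<omega> k x)" for k by (intro elem_smooth.mult sm\<phi> sm\<omega>)
  have supp: "\<phi> x = 0" if "x \<notin> cball 0 2" for x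
  proof -
    have "2\<^sup>2 \<le> (norm x)\<^sup>2" using that by (intro power_mono) auto
    then have "3\<^sup>2 \<le> ((norm x)\<^sup>2 - 1)\<^sup>2" by (intro power_mono) auto
    then show ?thesis by (simp add: \<phi>_def \<eta>_def bump_eq_0)
  qed
  have test: "test_function f" if "elem_smooth f" "\<And>x. x \<notin> cball 0 2 \<Longrightarrow> f x = 0" for f :: "real^'n \<Rightarrow> real"
    unfolding test_function_def
  proof
    show "smooth_on UNIV f" by (rule elem_smooth_imp_smooth_on[OF that(1)])
    have "bounded {x. f x \<noteq> 0}" by (rule bounded_subset[OF bounded_cball[of 0 2]]) (use that(2) in blast)
    then show "compact (closure {x. f x \<noteq> 0})" by (simp add: compact_eq_bounded_closed bounded_closure)
  qed
  have wd': "integral (ball 0 1) (partial_deriv i f) = - (LINT x|lebesgue. g x * f x)"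
    if f: "elem_smooth f" "\<And>x. x \<notin> cball 0 2 \<Longrightarrow> f x = 0" for f :: "real^'n \<Rightarrow> real"
  proof -
    have "(LINT x|lebesgue. indicator (ball 0 1) x * partial_derivs [i] f x) = - (LINT x|lebesgue. g x * f x)"
      using wd test[OF f] unfolding weak_deriv_def by fastforce
    moreover have "set_integrable lebesgue (ball 0 1) (partial_deriv i f)"
      by (rule set_integrable_subset[OF absolutely_integrable_continuous_compact[OF compact_cball[of 0 1]]])
         (auto intro!: continuous_elem_smooth elem_smooth_differentiable f)
    ultimately show ?thesis
      using set_lebesgue_integral_eq_integral(2)[of "ball 0 1" "partial_deriv i f"]
      by (simp add: set_lebesgue_integral_def partial_derivs_def)
  qed
  have zero: "(LINT x|lebesgue. g x * (\<phi> x * \<omega> k x)) = 0" if k: "k \<ge> 2" for k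
  proof -
    \<comment> \<open>The inner radius of that shell, from 1 - R^2 = 1/sqrt k; it is positive
      because k \<ge> 2.\<close>
    define R where "R = sqrt (1 - 1 / sqrt (real k))"
    have sk: "sqrt (real k) > 1" using k by simp
    then have "0 < 1 - 1 / sqrt (real k)" "1 - 1 / sqrt (real k) < 1" by auto
    then have R: "0 < R" "R < 1" and R2: "R\<^sup>2 = 1 - 1 / sqrt (real k)"
      by (auto simp: R_def)
    have \<omega>0: "\<omega> k x = 0" if "R \<le> norm x" "norm x \<le> 1" for x
    proof -
      have "R\<^sup>2 \<le> (norm x)\<^sup>2" "(norm x)\<^sup>2 \<le> 1\<^sup>2" using that R by (intro power_mono; simp)+
      then have "(1 - (norm x)\<^sup>2)\<^sup>2 \<le> (1 / sqrt (real k))\<^sup>2" using R2 by (intro power_mono) auto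
      then have "real k * ((norm x)\<^sup>2 - 1)\<^sup>2 \<le> 1"
        using k by (simp add: power_divide field_simps power2_commute)
      then show ?thesis by (simp add: \<omega>_def bump_eq_0)
    qed
    have "integral (ball 0 1) (partial_deriv i (\<lambda>x. \<phi> x * \<omega> k x)) =
        integral (cball 0 R) (partial_deriv i (\<lambda>x. \<phi> x * \<omega> k x))"
    proof (rule integral_eq_on_subset)
      fix x :: "real^'n" assume x: "x \<in> ball 0 1" "x \<notin> cball 0 R"
      have "((\<lambda>x. \<phi> x * \<omega> k x) has_derivative (\<lambda>h. 0)) (at x)"
        by (rule has_derivative_transform_within_open[of "\<lambda>x. 0" _ x UNIV "ball 0 1 - cball 0 R"])
           (use x \<omega>0 in auto)
      then show "partial_deriv i (\<lambda>x. \<phi> x * \<omega> k x) x = 0" by (rule partial_deriv_eqI)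
    qed (use R in auto)
    also have "\<dots> = 0"
      by (rule integral_partial_deriv_compact_support[OF sm\<phi>\<omega> R]) (simp add: \<omega>0)
    finally show ?thesis using wd'[OF sm\<phi>\<omega>, of k] supp by simp
  qed
  have "(\<lambda>k. LINT x|lebesgue. g x * (\<phi> x * \<omega> k x)) \<longlonglongrightarrow> (LINT x|lebesgue. g x * \<phi> x)"
  proof (rule integral_dominated_convergence)
    have gm: "g \<in> borel_measurable lebesgue" using g by (simp add: Lp_space_def)
    have "\<phi> \<in> borel_measurable lebesgue" "(\<lambda>x. \<phi> x * \<omega> k x) \<in> borel_measurable lebesgue" for k
      using sm\<phi> sm\<phi>\<omega> by (auto intro!: continuous_imp_borel_measurable_lebesgue continuous_elem_smooth)
    then show "(\<lambda>x. g x * \<phi> x) \<in> borel_measurable lebesgue" "(\<lambda>x. g x * (\<phi> x * \<omega> k x)) \<in> borel_measurable lebesgue" for k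
      using gm by (auto intro: borel_measurable_times)
    show "integrable lebesgue (\<lambda>x. 2 * \<bar>indicator (cball 0 2) x * g x\<bar>)"
      by (intro integrable_mult_right integrable_abs Lp_space_integrable_on_bounded[OF g p]) auto
    have "\<bar>\<phi> x\<bar> \<le> 2 * indicator (cball 0 2) x" for x
    proof (cases "x \<in> cball 0 2")
      case True
      have "\<bar>x $ i\<bar> \<le> 2" using component_le_norm_cart[of x i] True by simp
      then have "\<bar>x $ i\<bar> * \<bar>\<eta> x\<bar> \<le> 2 * 1"
        using bump_bounds by (intro mult_mono) (auto simp: \<eta>_def)
      then show ?thesis using True by (simp add: \<phi>_def abs_mult)
    qed (use supp in auto)
    moreover have "\<bar>\<omega> k x\<bar> \<le> 1" for k x using bump_bounds by (simp add: \<omega>_def)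
    ultimately have "\<bar>\<phi> x\<bar> * \<bar>\<omega> k x\<bar> \<le> (2 * indicator (cball 0 2) x) * 1" for k x
      by (intro mult_mono) auto
    then have "\<bar>g x\<bar> * (\<bar>\<phi> x\<bar> * \<bar>\<omega> k x\<bar>) \<le> \<bar>g x\<bar> * (2 * indicator (cball 0 2) x)" for k x
      by (intro mult_left_mono) auto
    then show "AE x in lebesgue. norm (g x * (\<phi> x * \<omega> k x)) \<le> 2 * \<bar>indicator (cball 0 2) x * g x\<bar>" for k
      by (simp add: abs_mult algebra_simps)
    have "sphere 0 1 \<in> null_sets (lebesgue :: (real^'n) measure)"
      using negligible_sphere negligible_iff_null_sets by blast
    then have "AE x in lebesgue. x \<notin> sphere (0::real^'n) 1" by (rule AE_not_in)
    moreover have "(\<lambda>k. g x * (\<phi> x * \<omega> k x)) \<longlonglongrightarrow> g x * \<phi> x" if x: "x \<notin> sphere 0 1" for x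
    proof -
      have c: "((norm x)\<^sup>2 - 1)\<^sup>2 > 0"
        using x by (simp add: power2_eq_1_iff) (metis norm_ge_zero not_one_le_zero le_minus_one_simps(3) order_trans zero_le_one)
      have "(\<lambda>k. exp (- (1 / (real k * ((norm x)\<^sup>2 - 1)\<^sup>2 - 1)))) \<longlonglongrightarrow> exp (- 0)"
      proof (intro tendsto_exp tendsto_minus)
        have "filterlim (\<lambda>k. real k * ((norm x)\<^sup>2 - 1)\<^sup>2 + (- 1)) at_top sequentially"
          by (intro filterlim_tendsto_add_at_top[OF tendsto_const, where c = "-1", unfolded add.commute[of "-1"]]
              filterlim_at_top_mult_tendsto_pos[OF tendsto_const c filterlim_real_sequentially])
        then have "filterlim (\<lambda>k. real k * ((norm x)\<^sup>2 - 1)\<^sup>2 - 1) at_infinity sequentially"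
          by (simp add: filterlim_at_top_imp_at_infinity)
        then show "(\<lambda>k. 1 / (real k * ((norm x)\<^sup>2 - 1)\<^sup>2 - 1)) \<longlonglongrightarrow> 0"
          by (rule tendsto_divide_0[OF tendsto_const])
      qed
      moreover have "\<forall>\<^sub>F k in sequentially. exp (- (1 / (real k * ((norm x)\<^sup>2 - 1)\<^sup>2 - 1))) = \<omega> k x"
      proof -
        obtain K :: nat where "1 / ((norm x)\<^sup>2 - 1)\<^sup>2 < real K" using reals_Archimedean2 by blast
        then have "1 < real K * ((norm x)\<^sup>2 - 1)\<^sup>2" using c by (simp add: pos_divide_less_eq)
        moreover have "real K * ((norm x)\<^sup>2 - 1)\<^sup>2 \<le> real k * ((norm x)\<^sup>2 - 1)\<^sup>2" if "k \<ge> K" for k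
          using that c by (intro mult_right_mono) auto
        ultimately show ?thesis unfolding eventually_sequentially \<omega>_def bump_def by force
      qed
      ultimately have "(\<lambda>k. \<omega> k x) \<longlonglongrightarrow> 1" using Lim_transform_eventually by fastforce
      then have "(\<lambda>k. g x * (\<phi> x * \<omega> k x)) \<longlonglongrightarrow> g x * (\<phi> x * 1)" by (intro tendsto_mult tendsto_const)
      then show ?thesis by simp
    qed
    ultimately show "AE x in lebesgue. (\<lambda>k. g x * (\<phi> x * \<omega> k x)) \<longlonglongrightarrow> g x * \<phi> x"
      by (rule eventually_mono)
  qed
  moreover have "(\<lambda>k. LINT x|lebesgue. g x * (\<phi> x * \<omega> k x)) \<longlonglongrightarrow> 0"
  proof (rule tendsto_eventually)
    show "\<forall>\<^sub>F k in sequentially. (LINT x|lebesgue. g x * (\<phi> x * \<omega> k x)) = 0"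
      using eventually_ge_at_top[of 2] by eventually_elim (rule zero)
  qed
  ultimately have "(LINT x|lebesgue. g x * \<phi> x) = 0" by (rule LIMSEQ_unique)
  then have int0: "integral (ball 0 1) (partial_deriv i \<phi>) = 0" using wd'[OF sm\<phi> supp] by simp
  have pd: "partial_deriv i \<phi> x = \<eta> x + 4 * (x $ i)\<^sup>2 * (1 - (norm x)\<^sup>2) * bump' (2 - ((norm x)\<^sup>2 - 1)\<^sup>2)" for x
  proof -
    have "((\<lambda>x. 2 - (x \<bullet> x - 1)\<^sup>2) has_derivative (\<lambda>h. 0 - 2 * (x \<bullet> x - 1) * ((x \<bullet> h + h \<bullet> x) - 0))) (at x)"
    proof (intro has_derivative_diff has_derivative_const)
      show "((\<lambda>x. (x \<bullet> x - 1)\<^sup>2) has_derivative (\<lambda>h. 2 * (x \<bullet> x - 1) * ((x \<bullet> h + h \<bullet> x) - 0))) (at x)"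
        by (rule has_derivative_eq_rhs[OF has_derivative_power[OF has_derivative_diff[OF has_derivative_inner[OF has_derivative_ident has_derivative_ident] has_derivative_const]]])
           (simp add: fun_eq_iff algebra_simps)
    qed
    from has_derivative_compose[OF this DERIV_bump[unfolded has_field_derivative_def]]
    have "(\<eta> has_derivative (\<lambda>h. bump' (2 - (x \<bullet> x - 1)\<^sup>2) * (0 - 2 * (x \<bullet> x - 1) * ((x \<bullet> h + h \<bullet> x) - 0)))) (at x)"
      by (simp add: \<eta>_def power2_norm_eq_inner)
    moreover define B where "B = bump' (2 - (x \<bullet> x - 1)\<^sup>2)"
    ultimately have "(\<eta> has_derivative (\<lambda>h. B * (0 - 2 * (x \<bullet> x - 1) * ((x \<bullet> h + h \<bullet> x) - 0)))) (at x)"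
      by simp
    from partial_deriv_eqI[OF has_derivative_mult[OF bounded_linear_imp_has_derivative[OF bounded_linear_vec_nth[of i]] this], of i]
    have "partial_deriv i \<phi> x = \<eta> x + 4 * (x $ i)\<^sup>2 * (1 - x \<bullet> x) * B"
      by (simp add: \<phi>_def inner_axis inner_axis' power2_eq_square algebra_simps)
    then show ?thesis by (simp add: B_def power2_norm_eq_inner)
  qed
  obtain a b where ab: "0 \<in> box a b" "cbox a b \<subseteq> ball (0::real^'n) 1"
    using open_contains_cbox[OF open_ball, of "0::real^'n" 0 1] by (metis centre_in_ball zero_less_one)
  have "integral (ball 0 1) (partial_deriv i \<phi>) > 0"
  proof (rule integral_pos_of_nonneg_continuous)
    have cont: "continuous_on S (partial_deriv i \<phi>)" for S
      by (intro continuous_elem_smooth elem_smooth_differentiable sm\<phi>)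
    show "cbox a b \<subseteq> ball 0 1" "0 \<in> box a b" using ab by auto
    show "continuous_on (cbox a b) (partial_deriv i \<phi>)" by (rule cont)
    have "set_integrable lebesgue (ball 0 1) (partial_deriv i \<phi>)"
      by (rule set_integrable_subset[OF absolutely_integrable_continuous_compact[OF compact_cball[of 0 1] cont]]) auto
    then show "partial_deriv i \<phi> integrable_on ball 0 1" by (rule set_lebesgue_integral_eq_integral(1))
    show "partial_deriv i \<phi> x \<ge> 0" if "x \<in> ball 0 1" for x
    proof -
      have "(norm x)\<^sup>2 \<le> 1\<^sup>2" using that by (intro power_mono) auto
      then show ?thesis unfolding pd using bump'_nonneg bump_bounds by (simp add: \<eta>_def)
    qed
    show "partial_deriv i \<phi> 0 > 0" unfolding pd by (simp add: \<eta>_def bump_pos)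
  qed
  with int0 show False by simp
qed

lemma indicator_ball_not_in_sobolev_int:
  assumes "p \<ge> 1" "m \<ge> 1"
  shows "indicator (ball (0::real^'n) 1) \<notin> sobolev_int m p"
proof
  assume "indicator (ball (0::real^'n) 1) \<in> sobolev_int m p"
  moreover have "length [undefined :: 'n] \<le> m" using assms(2) by simp
  ultimately obtain g where "g \<in> Lp_space p" "weak_deriv [undefined] (indicator (ball (0::real^'n) 1)) g"
    unfolding sobolev_int_def by blast
  then show False using indicator_ball_no_weak_deriv assms(1) by blast
qed

text \<open>For \<beta> \<ge> 1 every branch of the definition includes membership in
  \<open>sobolev_int\<close> of order at least 1, which already asks for first weak
  derivatives.\<close>

lemma indicator_ball_not_in_sobolev:
  assumes "p \<ge> 1" "\<beta> \<ge> 1"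
  shows "indicator (ball (0::real^'n) 1) \<notin> sobolev \<beta> p"
proof -
  have "nat \<lfloor>\<beta>\<rfloor> \<ge> 1" using assms(2) by (simp add: le_nat_iff)
  from indicator_ball_not_in_sobolev_int[OF assms(1) this, where 'n='n] show ?thesis
    using assms(2) by (auto simp: sobolev_def)
qed

subsection \<open>The profile of a single bump\<close>

text \<open>An orthogonal transformation taking a multiple of a coordinate axis to \<open>z\<close>
  conjugates the matrix to a diagonal one. The eigenvalue on the axis is
  \<open>a + c * (norm z)\<^sup>2\<close>, and all others are \<open>a\<close>.\<close>

lemma det_scalar_plus_rank_one:
  fixes z :: "real^'n"
  shows "det (\<chi> i j. a * (if i = j then 1 else 0) + c * z $ i * z $ j) = a ^ (CARD('n) - 1) * (a + c * (norm z)\<^sup>2)"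
proof -
  define k :: 'n where "k = undefined"
  obtain f :: "real^'n \<Rightarrow> real^'n" where f: "orthogonal_transformation f" "f (norm z *\<^sub>R axis k 1) = z"
    by (rule orthogonal_transformation_exists[of "norm z *\<^sub>R axis k 1" z]) (auto simp: norm_axis_1)
  have lin: "linear f" using f(1) by (simp add: orthogonal_transformation_def)
  define M :: "real^'n^'n" where "M = (\<chi> i j. a * (if i = j then 1 else 0) + c * z $ i * z $ j)"
  define E :: "real^'n^'n" where "E = (\<chi> i j. if i = j then a + (if i = k then c * (norm z)\<^sup>2 else 0) else 0)"
  have z: "z = norm z *\<^sub>R f (axis k 1)" using f(2) lin by (simp add: linear_scale)
  have M: "M *v h = a *\<^sub>R h + (c * (z \<bullet> h)) *\<^sub>R z" for h
    by (simp add: M_def vec_eq_iff matrix_vector_mult_def distrib_right sum.distrib inner_vec_def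
        sum_distrib_left sum_distrib_right if_distrib[of "\<lambda>u. u * _"] if_distrib[of "\<lambda>u. _ * u"] algebra_simps cong: if_cong)
  have E: "E *v h = a *\<^sub>R h + (c * (norm z)\<^sup>2 * (axis k 1 \<bullet> h)) *\<^sub>R axis k 1" for h
  proof -
    have "(E *v h) $ i = (a + (if i = k then c * (norm z)\<^sup>2 else 0)) * h $ i" for i
      by (simp add: E_def matrix_vector_mult_def if_distrib[of "\<lambda>u. u * _"] cong: if_cong)
    moreover have "axis k 1 \<bullet> h = h $ k" by (simp add: inner_axis')
    ultimately show ?thesis by (simp add: vec_eq_iff axis_def algebra_simps)
  qed
  have "M *v f h = f (E *v h)" for h
  proof -
    have "z \<bullet> f h = norm z * (axis k 1 \<bullet> h)"
      by (subst z) (use f(1) in \<open>simp add: orthogonal_transformation_def\<close>)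
    moreover have "f (E *v h) = a *\<^sub>R f h + (c * (norm z)\<^sup>2 * (axis k 1 \<bullet> h)) *\<^sub>R f (axis k 1)"
      using lin by (simp add: E linear_add linear_scale)
    moreover have "(c * (norm z * (axis k 1 \<bullet> h))) *\<^sub>R z = (c * (norm z)\<^sup>2 * (axis k 1 \<bullet> h)) *\<^sub>R f (axis k 1)"
      by (subst (2) z) (simp add: power2_eq_square mult_ac)
    ultimately show ?thesis by (simp add: M)
  qed
  then have "M ** matrix f = matrix f ** E"
    using matrix_vector_mul(2)[OF lin] unfolding matrix_eq by (metis matrix_vector_mul_assoc)
  then have "det M * det (matrix f) = det (matrix f) * det E" by (metis det_mul)
  moreover have "det (matrix f) \<noteq> 0"
    using det_orthogonal_matrix[of "matrix f"] f(1) by (auto simp: orthogonal_transformation_matrix)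
  ultimately have "det M = det E" by simp
  also have "det E = (\<Prod>i\<in>UNIV. a + (if i = k then c * (norm z)\<^sup>2 else 0))"
    by (subst det_diagonal) (auto simp: E_def)
  also have "\<dots> = (a + c * (norm z)\<^sup>2) * (\<Prod>i\<in>UNIV - {k}. a)"
    by (subst prod.remove[of UNIV k]) (auto intro!: prod.cong)
  also have "\<dots> = a ^ (CARD('n) - 1) * (a + c * (norm z)\<^sup>2)" by (simp add: card_Diff_singleton)
  finally show ?thesis by (simp add: M_def)
qed

text \<open>The direction of \<open>z\<close> is kept and its length becomes
  \<open>radial (norm z)\<close>. The support has radius sqrt 2, strictly below the radius 3/2 at
  which patches are kept apart.\<close>

definition profile :: "real^'n \<Rightarrow> real^'n" where
  "profile z = bump (2 - (norm z)\<^sup>2) *\<^sub>R z"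

definition profile_jac :: "real^'n \<Rightarrow> real^'n^'n" where
  "profile_jac z = (\<chi> i j. bump (2 - (norm z)\<^sup>2) * (if i = j then 1 else 0) + (- 2 * bump' (2 - (norm z)\<^sup>2)) * z $ i * z $ j)"

lemma profile_jac_mult:
  "profile_jac z *v h = bump (2 - (norm z)\<^sup>2) *\<^sub>R h - (2 * bump' (2 - (norm z)\<^sup>2) * (z \<bullet> h)) *\<^sub>R (z :: real^'n)"
  by (simp add: profile_jac_def vec_eq_iff matrix_vector_mult_def distrib_right sum.distrib inner_vec_def
      sum_distrib_left sum_distrib_right if_distrib[of "\<lambda>u. u * _"] if_distrib[of "\<lambda>u. _ * u"] algebra_simps
      sum_subtractf cong: if_cong)

lemma profile_has_derivative:
  "(profile has_derivative (\<lambda>h. profile_jac z *v h)) (at (z :: real^'n))"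
proof -
  have "((\<lambda>z. 2 - z \<bullet> z) has_derivative (\<lambda>h. 0 - (z \<bullet> h + h \<bullet> z))) (at z)"
    by (intro has_derivative_diff has_derivative_const has_derivative_inner has_derivative_ident)
  from has_derivative_scaleR[OF has_derivative_compose[OF this DERIV_bump[unfolded has_field_derivative_def]] has_derivative_ident]
  have "((\<lambda>z. bump (2 - z \<bullet> z) *\<^sub>R z) has_derivative
     (\<lambda>h. bump (2 - z \<bullet> z) *\<^sub>R h + (bump' (2 - z \<bullet> z) * (0 - (z \<bullet> h + h \<bullet> z))) *\<^sub>R z)) (at z)" .
  moreover have "(\<lambda>h. bump (2 - z \<bullet> z) *\<^sub>R h + (bump' (2 - z \<bullet> z) * (0 - (z \<bullet> h + h \<bullet> z))) *\<^sub>R z) = (\<lambda>h. profile_jac z *v h)"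
  proof
    fix h
    have "0 - (z \<bullet> h + h \<bullet> z) = - 2 * (z \<bullet> h)" by (simp add: inner_commute)
    then show "bump (2 - z \<bullet> z) *\<^sub>R h + (bump' (2 - z \<bullet> z) * (0 - (z \<bullet> h + h \<bullet> z))) *\<^sub>R z = profile_jac z *v h"
      by (simp add: profile_jac_mult power2_norm_eq_inner)
  qed
  ultimately show ?thesis by (simp add: profile_def[abs_def] power2_norm_eq_inner)
qed

lemma profile_eq_0: "(norm z)\<^sup>2 \<ge> 2 \<Longrightarrow> profile z = 0"
  by (simp add: profile_def bump_eq_0)

lemma profile_jac_eq_0: "(norm z)\<^sup>2 \<ge> 2 \<Longrightarrow> profile_jac z = 0"
  by (simp add: profile_jac_def bump_eq_0 bump'_def vec_eq_iff)

lemma norm_profile_le: "norm (profile z) \<le> 2"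
proof (cases "(norm z)\<^sup>2 \<ge> 2")
  case False
  then have "(norm z)\<^sup>2 \<le> 2\<^sup>2" by simp
  then have "norm z \<le> 2" by (rule power2_le_imp_le) simp
  then have "bump (2 - (norm z)\<^sup>2) * norm z \<le> 1 * 2"
    by (intro mult_mono bump_bounds) (auto simp: bump_bounds)
  then show ?thesis by (simp add: profile_def bump_bounds)
qed (simp add: profile_eq_0)

text \<open>On the support, bump \<le> 1, bump' \<le> 2 and |z|^2 \<le> 2, so the derivative has
  norm at most 1 + 2 * 2 * 2 = 9.\<close>

lemma profile_lipschitz: "norm (profile x - profile y) \<le> 9 * norm (x - y :: real^'n)"
proof (rule differentiable_bound[of UNIV])
  show "(profile has_derivative (\<lambda>h. profile_jac z *v h)) (at z within UNIV)" for z :: "real^'n"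
    using profile_has_derivative[of z] by simp
  show "onorm (\<lambda>h. profile_jac z *v h) \<le> 9" for z :: "real^'n"
  proof (rule onorm_le)
    fix h
    show "norm (profile_jac z *v h) \<le> 9 * norm h"
    proof (cases "(norm z)\<^sup>2 \<ge> 2")
      case True
      then show ?thesis by (simp add: profile_jac_eq_0)
    next
      case False
      let ?B = "bump (2 - (norm z)\<^sup>2)" and ?B' = "bump' (2 - (norm z)\<^sup>2)"
      have "norm (profile_jac z *v h) \<le> norm (?B *\<^sub>R h) + norm ((2 * ?B' * (z \<bullet> h)) *\<^sub>R z)"
        unfolding profile_jac_mult by (rule norm_triangle_ineq4)
      also have "\<dots> = ?B * norm h + 2 * ?B' * (\<bar>z \<bullet> h\<bar> * norm z)"
        by (simp add: bump_bounds bump'_nonneg abs_mult)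
      also have "\<dots> \<le> 1 * norm h + 2 * 2 * ((norm z * norm h) * norm z)"
        by (intro add_mono mult_mono bump_bounds bump'_le Cauchy_Schwarz_ineq2) (auto simp: bump_bounds bump'_nonneg)
      also have "\<dots> = norm h + 4 * (norm z)\<^sup>2 * norm h" by (simp add: power2_eq_square)
      also have "\<dots> \<le> norm h + 4 * 2 * norm h"
        using False by (intro add_mono mult_right_mono) auto
      finally show ?thesis by simp
    qed
  qed
qed auto

lemma le_powr_of_le_one:
  fixes x :: real
  assumes "0 \<le> x" "x \<le> 1" "\<alpha> \<le> 1"
  shows "x \<le> x powr \<alpha>"
proof (cases "x = 0")
  case False
  then have "x powr 1 \<le> x powr \<alpha>" using assms by (intro powr_mono') auto
  then show ?thesis using False assms by simp
qed simp

text \<open>Up to distance 1 the Lipschitz bound is stronger than the Hoelder bound; beyond it, the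
  difference of two values is at most 4.\<close>

lemma profile_holder:
  fixes x y :: "real^'n"
  assumes "0 < \<alpha>" "\<alpha> \<le> 1"
  shows "norm (profile x - profile y) \<le> 9 * norm (x - y) powr \<alpha>"
proof (cases "norm (x - y) \<le> 1")
  case True
  then have "norm (x - y) \<le> norm (x - y) powr \<alpha>" using assms by (intro le_powr_of_le_one) auto
  then show ?thesis using profile_lipschitz[of x y] by linarith
next
  case False
  then have "1 \<le> norm (x - y) powr \<alpha>" using assms by (intro ge_one_powr_ge_zero) auto
  moreover have "norm (profile x - profile y) \<le> 2 + 2"
    by (rule order_trans[OF norm_triangle_ineq4 add_mono[OF norm_profile_le norm_profile_le]])
  ultimately show ?thesis by linarith
qed

text \<open>Here \<open>bump (2 - q)\<close> is \<open>bump' (2 - q)\<close> times (2 - q)^2, and (2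
  - q)^2 \<le> 1 < 2q. With q the squared norm, this says that the radial eigenvalue of the
  profile's Jacobian is negative.\<close>

lemma bump'_gt:
  assumes "1 \<le> q" "q < 2"
  shows "bump (2 - q) < 2 * bump' (2 - q) * q"
proof -
  have "(2 - q)\<^sup>2 \<le> 1\<^sup>2" using assms by (intro power_mono) auto
  then have "(2 - q)\<^sup>2 < 2 * q" using assms by simp
  then have "bump (2 - q) * (2 - q)\<^sup>2 < bump (2 - q) * (2 * q)"
    using assms by (intro mult_strict_left_mono) (auto simp: bump_pos)
  moreover have "bump (2 - q) = bump' (2 - q) * (2 - q)\<^sup>2"
    using assms by (simp add: bump_def bump'_def)
  ultimately have "bump (2 - q) * (2 - q)\<^sup>2 < (2 * bump' (2 - q) * q) * (2 - q)\<^sup>2"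
    by (simp add: mult_ac)
  then show ?thesis by (rule mult_right_less_imp_less) simp
qed

text \<open>The tangential eigenvalues all equal the positive value of \<open>bump\<close> and the
  radial one is negative, so the sign does not depend on the dimension.\<close>

lemma det_profile_jac_neg:
  fixes z :: "real^'n"
  assumes "1 \<le> norm z" "(norm z)\<^sup>2 < 2"
  shows "det (profile_jac z) < 0"
proof -
  have "1 \<le> (norm z)\<^sup>2" using assms(1) by simp
  then have "bump (2 - (norm z)\<^sup>2) - 2 * bump' (2 - (norm z)\<^sup>2) * (norm z)\<^sup>2 < 0"
    using bump'_gt assms(2) by simp
  moreover have "bump (2 - (norm z)\<^sup>2) ^ (CARD('n) - 1) > 0" using assms(2) by (simp add: bump_pos)
  ultimately show ?thesis
    unfolding profile_jac_def det_scalar_plus_rank_one by (simp add: mult_pos_neg)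
qed

definition radial :: "real \<Rightarrow> real" where
  "radial t = bump (2 - t\<^sup>2) * t"

lemma norm_profile: "norm (profile z) = radial (norm z)"
  by (simp add: profile_def radial_def bump_bounds)

text \<open>The derivative of \<open>radial\<close> is the radial eigenvalue just shown to be
  negative. From sqrt 2 on, \<open>radial\<close> is 0, whereas its value at \<open>t\<close> is
  positive.\<close>

lemma radial_strict_decreasing:
  assumes "1 \<le> t" "t < u" "t\<^sup>2 < 2"
  shows "radial u < radial t"
proof (cases "u\<^sup>2 < 2")
  case False
  then show ?thesis using assms by (simp add: radial_def bump_eq_0 bump_pos)
next
  case True
  have "(radial has_real_derivative bump' (2 - x\<^sup>2) * (- (2 * x)) * x + bump (2 - x\<^sup>2)) (at x)" for x
  proof -
    have "((\<lambda>x::real. 2 - x\<^sup>2) has_real_derivative - (2 * x)) (at x)"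
      by (auto intro!: derivative_eq_intros)
    from DERIV_mult[OF DERIV_chain2[OF DERIV_bump this] DERIV_ident]
    show ?thesis by (simp add: radial_def[abs_def] algebra_simps)
  qed
  moreover have "bump' (2 - x\<^sup>2) * (- (2 * x)) * x + bump (2 - x\<^sup>2) < 0" if "t \<le> x" "x \<le> u" for x
  proof -
    have "x\<^sup>2 \<le> u\<^sup>2" "1 \<le> x\<^sup>2" using that assms by (auto intro!: power_mono)
    then show ?thesis using bump'_gt[of "x\<^sup>2"] True by (simp add: power2_eq_square algebra_simps)
  qed
  ultimately show ?thesis using assms(2) DERIV_neg_imp_decreasing[of t u radial] by blast
qed

lemma continuous_on_radial: "continuous_on S radial"
  unfolding radial_def by (intro continuous_intros)

subsection \<open>Wrapping infinitely many shrinking boundary patches\<close>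

lemma det_scaleR_matrix:
  fixes A :: "real^'n^'n"
  shows "det (c *\<^sub>R A) = c ^ CARD('n) * det A"
proof -
  have "c *\<^sub>R A = (\<chi> i. c *s A $ i)" by (simp add: vec_eq_iff)
  then show ?thesis using det_rows_mul[of "\<lambda>_. c" "\<lambda>i. A $ i"] by (simp add: vec_lambda_eta)
qed

lemma finite_if_all_eq:
  assumes "\<And>x y. x \<in> A \<Longrightarrow> y \<in> A \<Longrightarrow> x = y" shows "finite A"
proof (cases "A = {}")
  case False
  then obtain x where "x \<in> A" by blast
  then have "A \<subseteq> {x}" using assms by blast
  then show ?thesis using finite_subset by blast
qed simp

text \<open>The patches of level \<open>k\<close> have size \<open>s k\<close> and are indexed by \<open>I k\<close>. Their centres \<open>b j\<close> lie at
  distance \<open>s k\<close> outside the closed ball, so inside the ball the profile is only used for \<open>norm z \<ge> 1\<close>.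
  There, like an inversion, it decreases along rays and reverses orientation, so all preimages
  count with the same sign.\<close>

locale bump_family =
  fixes i0 :: "'n::finite" and s :: "nat \<Rightarrow> real" and \<alpha> :: real
    and I :: "nat \<Rightarrow> 'm set" and b :: "nat \<times> 'm \<Rightarrow> real^'n"
  assumes \<alpha>: "0 < \<alpha>" "\<alpha> \<le> 1"
    and s: "0 < s k" "s k \<le> 1 / 40"
    and s_decay: "s (Suc k) powr \<alpha> \<le> radial (5/4) / 8 * s k powr \<alpha>"
    and finite_I: "finite (I k)"
    and norm_b: "j \<in> Sigma UNIV I \<Longrightarrow> norm (b j) = 1 + s (fst j)"
    and sep: "j \<in> Sigma UNIV I \<Longrightarrow> j' \<in> Sigma UNIV I \<Longrightarrow> j \<noteq> j' \<Longrightarrow>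
      norm (b j - b j') \<ge> 3/2 * (s (fst j) + s (fst j'))"
    and b_near: "j \<in> Sigma UNIV I \<Longrightarrow> norm (b j - axis i0 1) \<le> 1 / 20"
begin

definition r :: "nat \<Rightarrow> real" where "r k = s k powr \<alpha>"

text \<open>A target of norm at most \<open>m0 * r k\<close> corresponds to a radius t \<ge> 5/4 in
  the profile variable. This is far enough from a centre lying outside the ball for the preimage to
  fall inside it, see \<open>ray_inside\<close>.\<close>

definition m0 :: real where "m0 = radial (5/4)"

definition patch :: "nat \<times> 'm \<Rightarrow> real^'n \<Rightarrow> real^'n" where
  "patch j x = r (fst j) *\<^sub>R profile ((1 / s (fst j)) *\<^sub>R (x - b j))"

text \<open>The radius 3/2 exceeds the support radius sqrt 2 of the profile and matches the constant
  in \<open>sep\<close>, so active regions are disjoint while values and derivatives vanish outside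
  them.\<close>

definition active :: "nat \<times> 'm \<Rightarrow> real^'n \<Rightarrow> bool" where
  "active j x \<longleftrightarrow> j \<in> Sigma UNIV I \<and> norm (x - b j) < 3/2 * s (fst j)"

text \<open>At most one index is active at any point, so this sum over infinitely many patches is
  finite pointwise. The truncation \<open>W\<close> below sums finitely many whole patches and is
  therefore smooth.\<close>

definition V :: "real^'n \<Rightarrow> real^'n" where
  "V x = (\<Sum>j | active j x. patch j x)"

definition W :: "nat \<Rightarrow> real^'n \<Rightarrow> real^'n" where
  "W m x = (\<Sum>j\<in>Sigma {..m} I. patch j x)"

lemma r_pos: "r k > 0" using s(1)[of k] by (simp add: r_def)

lemma m0_pos: "m0 > 0" and m0_le: "m0 \<le> 2"
  using bump_bounds[of "7/16"] by (simp_all add: m0_def radial_def power2_eq_square bump_pos)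

text \<open>Values of levels beyond \<open>k\<close> have norm at most \<open>2 * r (Suc k)\<close>,
  hence at most half of \<open>m0 / 2 * r k\<close>, the distance from 0 at which the degree is
  tested at level \<open>k\<close>.\<close>

lemma r_Suc: "r (Suc k) \<le> m0 / 8 * r k" using s_decay by (simp add: r_def m0_def)

lemma r_half: "r (Suc k) \<le> 1 / 2 * r k"
  using r_Suc[of k] m0_le r_pos[of k] mult_right_mono[of "m0 / 8" "1 / 2" "r k"] by linarith

lemma r_antimono: "k \<le> l \<Longrightarrow> r l \<le> r k"
proof (rule lift_Suc_antimono_le)
  show "r (Suc n) \<le> r n" for n using r_half[of n] r_pos[of n] by linarith
qed

lemma r_tendsto_0: "r \<longlonglongrightarrow> 0"
proof (rule tendsto_sandwich[where f = "\<lambda>_. 0" and h = "\<lambda>k. (1/2) ^ k * r 0"])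
  have "r k \<le> (1/2) ^ k * r 0" for k
  proof (induction k)
    case (Suc k)
    then show ?case using r_half[of k] by simp
  qed simp
  then show "\<forall>\<^sub>F k in sequentially. r k \<le> (1/2) ^ k * r 0" by simp
  have "(\<lambda>k. (1/2::real) ^ k * r 0) \<longlonglongrightarrow> 0 * r 0"
    by (intro tendsto_mult LIMSEQ_realpow_zero tendsto_const) auto
  then show "(\<lambda>k. (1/2::real) ^ k * r 0) \<longlonglongrightarrow> 0" by simp
qed (use r_pos in \<open>auto intro: always_eventually less_imp_le\<close>)

section \<open>Disjointness of the patches and regularity of the infinite sum\<close>

lemma norm_scaled: "norm ((1 / s k) *\<^sub>R (x - c)) = norm (x - c) / s k"
  using s(1)[of k] by simp

lemma not_active_big:
  assumes "norm (x - b j) \<ge> 3/2 * s (fst j)"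
  shows "(norm ((1 / s (fst j)) *\<^sub>R (x - b j)))\<^sup>2 \<ge> 2"
proof -
  have "3/2 \<le> norm ((1 / s (fst j)) *\<^sub>R (x - b j))"
    unfolding norm_scaled using assms s(1)[of "fst j"] by (simp add: pos_le_divide_eq)
  then have "(3/2)\<^sup>2 \<le> (norm ((1 / s (fst j)) *\<^sub>R (x - b j)))\<^sup>2" by (intro power_mono) auto
  moreover have "(2::real) \<le> (3/2)\<^sup>2" by (simp add: power2_eq_square)
  ultimately show ?thesis by (rule order_trans[rotated])
qed

lemma patch_eq_0: "norm (x - b j) \<ge> 3/2 * s (fst j) \<Longrightarrow> patch j x = 0"
  using profile_eq_0[OF not_active_big] by (simp add: patch_def)

lemma active_unique:
  assumes "active j x" "active j' x" shows "j = j'"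
proof (rule ccontr)
  assume "j \<noteq> j'"
  then have "norm (b j - b j') \<ge> 3/2 * (s (fst j) + s (fst j'))" using assms sep by (simp add: active_def)
  moreover have "norm (b j - b j') \<le> norm (x - b j') + norm (x - b j)"
    using norm_triangle_ineq4[of "x - b j'" "x - b j"] by simp
  moreover have "norm (x - b j) < 3/2 * s (fst j)" "norm (x - b j') < 3/2 * s (fst j')"
    using assms by (auto simp: active_def)
  ultimately show False by (simp add: distrib_left)
qed

lemma V_active: "active j x \<Longrightarrow> V x = patch j x"
proof -
  assume a: "active j x"
  then have "{j. active j x} = {j}" using active_unique by blast
  then show ?thesis by (simp add: V_def)
qed

lemma V_inactive: "(\<And>j. \<not> active j x) \<Longrightarrow> V x = 0"
  by (simp add: V_def)

lemma W_active:
  assumes "active j x" shows "W m x = (if fst j \<le> m then patch j x else 0)"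
proof -
  have "patch j' x = 0" if "j' \<in> Sigma {..m} I" "j' \<noteq> j" for j'
  proof (rule patch_eq_0)
    have "\<not> active j' x" using active_unique assms that by blast
    then show "norm (x - b j') \<ge> 3/2 * s (fst j')" using that by (auto simp: active_def)
  qed
  then have "W m x = (\<Sum>j'\<in>Sigma {..m} I. if j' = j then patch j x else 0)"
    unfolding W_def by (intro sum.cong) auto
  also have "\<dots> = (if j \<in> Sigma {..m} I then patch j x else 0)"
    using finite_I by (simp add: finite_SigmaI)
  also have "j \<in> Sigma {..m} I \<longleftrightarrow> fst j \<le> m" using assms by (auto simp: active_def)
  finally show ?thesis .
qed

lemma W_inactive:
  assumes "\<And>j. \<not> active j x" shows "W m x = 0"
  unfolding W_def
proof (rule sum.neutral, intro ballI patch_eq_0)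
  fix j assume "j \<in> Sigma {..m} I"
  then show "norm (x - b j) \<ge> 3/2 * s (fst j)" using assms[of j] by (auto simp: active_def)
qed

lemma norm_patch_le: "norm (patch j x) \<le> 2 * r (fst j)"
  using norm_profile_le mult_left_mono[OF norm_profile_le, of "r (fst j)"] r_pos[of "fst j"]
  by (simp add: patch_def mult.commute)

lemma W_near_V: "norm (W m x - V x) \<le> 2 * r (Suc m)"
proof (cases "\<exists>j. active j x")
  case True
  then obtain j where j: "active j x" by blast
  show ?thesis
  proof (cases "fst j \<le> m")
    case True
    then show ?thesis using W_active[OF j, of m] V_active[OF j] r_pos[of "Suc m"] by simp
  next
    case False
    then have "r (fst j) \<le> r (Suc m)" by (intro r_antimono) simp
    then show ?thesis using W_active[OF j, of m] V_active[OF j] False norm_patch_le[of j x] by simp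
  qed
next
  case False
  then have no: "\<not> active j x" for j by blast
  show ?thesis using W_inactive[OF no, of m] V_inactive[OF no] r_pos[of "Suc m"] by simp
qed

text \<open>The amplitude s^\<alpha> cancels exactly the factor s^(-\<alpha>) from rescaling, so the
  constant is the same for all levels.\<close>

lemma patch_holder: "norm (patch j x - patch j y) \<le> 9 * norm (x - y) powr \<alpha>"
proof -
  let ?s = "s (fst j)"
  have "norm (patch j x - patch j y) =
      r (fst j) * norm (profile ((1 / ?s) *\<^sub>R (x - b j)) - profile ((1 / ?s) *\<^sub>R (y - b j)))"
    using r_pos[of "fst j"] by (simp add: patch_def flip: scaleR_diff_right)
  also have "\<dots> \<le> r (fst j) * (9 * norm ((1 / ?s) *\<^sub>R (x - b j) - (1 / ?s) *\<^sub>R (y - b j)) powr \<alpha>)"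
    using r_pos[of "fst j"] by (intro mult_left_mono profile_holder \<alpha>) auto
  also have "(1 / ?s) *\<^sub>R (x - b j) - (1 / ?s) *\<^sub>R (y - b j) = (1 / ?s) *\<^sub>R (x - y)"
    by (simp flip: scaleR_diff_right)
  also have "norm ((1 / ?s) *\<^sub>R (x - y)) powr \<alpha> = norm (x - y) powr \<alpha> / ?s powr \<alpha>"
    unfolding norm_scaled using s(1)[of "fst j"] by (simp add: powr_divide)
  finally show ?thesis using s(1)[of "fst j"] by (simp add: r_def)
qed

text \<open>If the points lie in different active regions, each patch vanishes at the other point,
  so both values are differences of a single patch. This gives 9 + 9 whatever the number of
  patches.\<close>

lemma V_holder: "norm (V x - V y) \<le> 18 * norm (x - y) powr \<alpha>"
proof -
  define K where "K = norm (x - y) powr \<alpha>"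
  have K: "K \<ge> 0" by (simp add: K_def)
  have ph: "norm (patch j x - patch j y) \<le> 9 * K" for j unfolding K_def by (rule patch_holder)
  have one: "norm (patch j x) \<le> 9 * K" if "\<not> active j y" "active j x" for j
    using ph[of j] patch_eq_0[of j y] that by (auto simp: active_def)
  have one': "norm (patch j y) \<le> 9 * K" if "\<not> active j x" "active j y" for j
    using ph[of j] patch_eq_0[of j x] that by (auto simp: active_def)
  consider j j' where "active j x" "active j' y" "j \<noteq> j'" | j where "active j x" "active j y"
    | j where "active j x" "\<And>j. \<not> active j y" | j where "\<And>j. \<not> active j x" "active j y"
    | "\<And>j. \<not> active j x" "\<And>j. \<not> active j y" by blast
  then have "norm (V x - V y) \<le> 18 * K"
  proof cases
    case (1 j j')
    then have "\<not> active j y" "\<not> active j' x" using active_unique by blast+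
    then have "norm (patch j x) + norm (patch j' y) \<le> 9 * K + 9 * K"
      using 1 one one' by (intro add_mono) auto
    then show ?thesis
      using norm_triangle_ineq4[of "patch j x" "patch j' y"]
      by (simp add: V_active[OF 1(1)] V_active[OF 1(2)])
  next
    case (2 j)
    then show ?thesis using ph[of j] K by (simp add: V_active[OF 2(1)] V_active[OF 2(2)])
  next
    case (3 j)
    then show ?thesis using one[of j] K V_inactive[of y] by (simp add: V_active[OF 3(1)])
  next
    case (4 j)
    then show ?thesis using one'[of j] K V_inactive[of x] by (simp add: V_active[OF 4(2)])
  next
    case 5
    then show ?thesis using V_inactive[of x] V_inactive[of y] K by simp
  qed
  then show ?thesis by (simp add: K_def)
qed

lemma V_in_holder_space: "V \<in> holder_space \<alpha> S"
  unfolding holder_space_def using \<alpha> V_holder by auto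

lemma continuous_on_V: "continuous_on S V"
  unfolding continuous_on_iff
proof (intro ballI allI impI)
  fix x and e :: real assume "e > 0"
  define d where "d = (e / 18) powr (1 / \<alpha>)"
  have "dist (V x') (V x) < e" if "dist x' x < d" for x'
  proof -
    have "norm (x' - x) powr \<alpha> < d powr \<alpha>"
      using that \<alpha> by (intro powr_less_mono2) (auto simp: dist_norm)
    also have "d powr \<alpha> = e / 18" using \<alpha> \<open>e > 0\<close> by (simp add: d_def powr_powr)
    finally show ?thesis using V_holder[of x' x] by (simp add: dist_norm)
  qed
  moreover have "d > 0" using \<open>e > 0\<close> by (simp add: d_def)
  ultimately show "\<exists>d>0. \<forall>x'\<in>S. dist x' x < d \<longrightarrow> dist (V x') (V x) < e" by blast
qed

section \<open>Smooth truncations and their Jacobians\<close>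

lemma elem_smooth_W: "elem_smooth (\<lambda>x. W m x $ i)"
proof -
  have "(norm ((1 / s k) *\<^sub>R (x - c)))\<^sup>2 = (1 / s k)\<^sup>2 * (norm (x - c))\<^sup>2" for k and x c :: "real^'n"
    by (simp add: norm_scaled power_divide)
  then have "W m x $ i = (\<Sum>j\<in>Sigma {..m} I. r (fst j) *
      (bump (2 - (1 / s (fst j))\<^sup>2 * (norm (x - b j))\<^sup>2) * ((1 / s (fst j)) * (x $ i - b j $ i))))" for x
    by (simp add: W_def patch_def profile_def mult.assoc)
  then show ?thesis
    by (simp only:) (intro elem_smooth_sum elem_smooth.mult elem_smooth.const elem_smooth_bump
        elem_smooth_diff elem_smooth_norm_sq elem_smooth.coord)
qed

lemma smooth_on_W: "smooth_on S (W m)"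
  by (rule elem_smooth_components_imp_smooth_on) (rule elem_smooth_W)

lemma continuous_on_W: "continuous_on S (W m)"
  by (meson elem_smooth_components_differentiable(1) elem_smooth_W continuous_at_imp_continuous_on
      differentiable_imp_continuous_within)

text \<open>At an active point the derivatives of all other patches vanish too, so a single profile
  is differentiated: outer scaling \<open>r\<close> and inner scaling 1/s, to the power of the
  dimension.\<close>

lemma jacobian_W:
  assumes a: "active j x" and m: "fst j \<le> m"
  shows "jacobian (W m) x = (r (fst j) / s (fst j)) ^ CARD('n) * det (profile_jac ((1 / s (fst j)) *\<^sub>R (x - b j)))"
proof -
  let ?z = "\<lambda>j x. (1 / s (fst j)) *\<^sub>R (x - b j)"
  have "(patch j has_derivative (\<lambda>h. ((r (fst j) / s (fst j)) *\<^sub>R profile_jac (?z j x)) *v h)) (at x)" for j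
  proof -
    have "(?z j has_derivative (\<lambda>h. (1 / s (fst j)) *\<^sub>R (h - 0))) (at x)"
      by (intro has_derivative_scaleR_right has_derivative_diff has_derivative_ident has_derivative_const)
    from has_derivative_scaleR_right[OF has_derivative_compose[OF this profile_has_derivative], of "r (fst j)"]
    show ?thesis
      by (simp add: patch_def[abs_def] matrix_vector_mult_scaleR scaleR_matrix_vector_assoc[symmetric])
  qed
  then have "(W m has_derivative (\<lambda>h. \<Sum>j\<in>Sigma {..m} I. ((r (fst j) / s (fst j)) *\<^sub>R profile_jac (?z j x)) *v h)) (at x)"
    unfolding W_def[abs_def] by (intro has_derivative_sum)
  moreover have "(\<Sum>j'\<in>Sigma {..m} I. ((r (fst j') / s (fst j')) *\<^sub>R profile_jac (?z j' x)) *v h) =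
      ((r (fst j) / s (fst j)) *\<^sub>R profile_jac (?z j x)) *v h" for h
  proof -
    have "profile_jac (?z j' x) = 0" if "j' \<in> Sigma {..m} I" "j' \<noteq> j" for j'
    proof (intro profile_jac_eq_0 not_active_big)
      have "\<not> active j' x" using active_unique a that by blast
      then show "norm (x - b j') \<ge> 3/2 * s (fst j')" using that by (auto simp: active_def)
    qed
    then have "(\<Sum>j'\<in>Sigma {..m} I. ((r (fst j') / s (fst j')) *\<^sub>R profile_jac (?z j' x)) *v h) =
      (\<Sum>j'\<in>Sigma {..m} I. if j' = j then ((r (fst j) / s (fst j)) *\<^sub>R profile_jac (?z j x)) *v h else 0)"
      by (intro sum.cong) auto
    moreover have "j \<in> Sigma {..m} I" using a m by (auto simp: active_def)
    ultimately show ?thesis using finite_I by (simp add: finite_SigmaI)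
  qed
  ultimately have "jacobian (W m) x = det ((r (fst j) / s (fst j)) *\<^sub>R profile_jac (?z j x))"
    by (intro jacobian_eqI) simp
  then show ?thesis by (simp add: det_scaleR_matrix)
qed

section \<open>Rays from the patch centres\<close>

lemma b_inner:
  assumes "j \<in> Sigma UNIV I" shows "\<bar>b j \<bullet> y - y $ i0\<bar> \<le> norm y / 20"
proof -
  have "b j \<bullet> y - y $ i0 = (b j - axis i0 1) \<bullet> y" by (simp add: inner_diff_left inner_axis')
  then have "\<bar>b j \<bullet> y - y $ i0\<bar> \<le> norm (b j - axis i0 1) * norm y"
    using Cauchy_Schwarz_ineq2[of "b j - axis i0 1" y] by simp
  also have "\<dots> \<le> 1 / 20 * norm y" using b_near[OF assms] by (intro mult_right_mono) auto
  finally show ?thesis by simp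
qed

lemma norm_ray_sq:
  assumes j: "j \<in> Sigma UNIV I" and y: "y \<noteq> 0"
  shows "(norm (b j + (s (fst j) * t / norm y) *\<^sub>R y))\<^sup>2 =
    (1 + s (fst j))\<^sup>2 + 2 * (s (fst j) * t) * (b j \<bullet> y / norm y) + (s (fst j) * t)\<^sup>2"
proof -
  let ?l = "s (fst j) * t / norm y"
  have "(norm (b j + ?l *\<^sub>R y))\<^sup>2 = (norm (b j))\<^sup>2 + 2 * ?l * (b j \<bullet> y) + ?l\<^sup>2 * (norm y)\<^sup>2"
    unfolding power2_norm_eq_inner
    by (simp add: inner_add_left inner_add_right inner_commute power2_eq_square algebra_simps)
  moreover have "?l\<^sup>2 * (norm y)\<^sup>2 = (s (fst j) * t)\<^sup>2" using y by (simp add: power_divide)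
  ultimately show ?thesis by (simp add: norm_b[OF j])
qed

text \<open>The centre is at height s above the sphere and the ray descends almost radially, with
  cosine at most -9/10. For t \<ge> 5/4 the linear gain 9/4 s in the squared norm beats the excess,
  at most 2s + s/40 + s/20.\<close>

lemma ray_inside:
  assumes j: "j \<in> Sigma UNIV I" and y: "y \<noteq> 0" "y $ i0 \<le> - (19/20) * norm y" and t: "5/4 \<le> t" "t\<^sup>2 < 2"
  shows "norm (b j + (s (fst j) * t / norm y) *\<^sub>R y) < 1"
proof -
  let ?s = "s (fst j)"
  have sj: "0 < ?s" "?s \<le> 1/40" by (rule s(1), rule s(2))
  have "b j \<bullet> y \<le> - (9/10) * norm y" using b_inner[OF j, of y] y(2) by linarith
  then have d: "b j \<bullet> y / norm y \<le> - (9/10)" using y(1) by (simp add: divide_le_eq)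
  have "2 * (?s * t) * (b j \<bullet> y / norm y) \<le> 2 * (?s * t) * (- (9/10))"
    using sj t by (intro mult_left_mono d) auto
  also have "\<dots> \<le> 2 * (?s * (5/4)) * (- (9/10))"
    using sj t by (intro mult_right_mono_neg) auto
  finally have 1: "2 * (?s * t) * (b j \<bullet> y / norm y) \<le> - (9/4) * ?s" by simp
  have "(?s * t)\<^sup>2 = ?s * ?s * t\<^sup>2" by (simp add: power2_eq_square)
  also have "\<dots> \<le> (1/40 * ?s) * 2" using sj t by (intro mult_mono) auto
  finally have 2: "(?s * t)\<^sup>2 \<le> ?s / 20" by simp
  have "?s * ?s \<le> 1/40 * ?s" using sj by (intro mult_right_mono) auto
  then have 3: "(1 + ?s)\<^sup>2 \<le> 1 + 2 * ?s + ?s / 40" by (simp add: power2_eq_square algebra_simps)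
  have "(norm (b j + (?s * t / norm y) *\<^sub>R y))\<^sup>2 < 1\<^sup>2"
    unfolding norm_ray_sq[OF j y(1)] using 1 2 3 sj by simp
  then show ?thesis by (rule power2_less_imp_less) simp
qed

text \<open>The centre is already outside the ball, and a direction near the pole makes a
  nonnegative inner product with it, so the norm cannot decrease along the ray.\<close>

lemma ray_outside:
  assumes j: "j \<in> Sigma UNIV I" and y: "y \<noteq> 0" "y $ i0 \<ge> (19/20) * norm y" and t: "0 \<le> t"
  shows "norm (b j + (s (fst j) * t / norm y) *\<^sub>R y) > 1"
proof -
  let ?s = "s (fst j)"
  have sj: "0 < ?s" by (rule s(1))
  have "b j \<bullet> y \<ge> 0" using b_inner[OF j, of y] y(2) norm_ge_zero[of y] by linarith
  then have "2 * (?s * t) * (b j \<bullet> y / norm y) \<ge> 0" using sj t by simp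
  moreover have "(1 + ?s)\<^sup>2 > 1\<^sup>2" using sj by (intro power_strict_mono) auto
  ultimately have "(norm (b j + (?s * t / norm y) *\<^sub>R y))\<^sup>2 > 1\<^sup>2"
    unfolding norm_ray_sq[OF j y(1)] using zero_le_power2[of "?s * t"] by linarith
  then show ?thesis by (rule power2_less_imp_less) simp
qed

text \<open>The profile keeps directions, so a preimage of \<open>y\<close> lies on the ray from
  \<open>b j\<close> along \<open>y\<close>. A point of the closed ball has distance at least
  \<open>s\<close> from the centre, whence t \<ge> 1; a nonzero value forces t^2 < 2.\<close>

lemma preimage_ray:
  assumes a: "active j x" and x: "norm x \<le> 1" and y: "patch j x = y" "y \<noteq> 0"
  obtains t where "1 \<le> t" "t\<^sup>2 < 2" "radial t = norm y / r (fst j)" "x = b j + (s (fst j) * t / norm y) *\<^sub>R y"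
    "norm ((1 / s (fst j)) *\<^sub>R (x - b j)) = t"
proof
  let ?s = "s (fst j)" and ?z = "(1 / s (fst j)) *\<^sub>R (x - b j)"
  have j: "j \<in> Sigma UNIV I" using a by (simp add: active_def)
  have sj: "0 < ?s" by (rule s(1))
  have "norm (b j) \<le> norm x + norm (x - b j)" by (metis norm_triangle_sub norm_minus_commute)
  then have "?s \<le> norm (x - b j)" using norm_b[OF j] x by simp
  then show "1 \<le> norm ?z" unfolding norm_scaled using sj by simp
  show lt: "(norm ?z)\<^sup>2 < 2"
    using profile_eq_0[of ?z] y by (force simp: patch_def)
  have "norm y = r (fst j) * radial (norm ?z)"
    using y(1) r_pos[of "fst j"] by (auto simp: patch_def norm_profile)
  then show "radial (norm ?z) = norm y / r (fst j)" using r_pos[of "fst j"] by simp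
  define B where "B = bump (2 - (norm ?z)\<^sup>2)"
  have B: "B > 0" using lt by (simp add: B_def bump_pos)
  have yz: "y = (r (fst j) * B) *\<^sub>R ?z" using y(1) by (simp add: patch_def profile_def B_def)
  define z where "z = ?z"
  have yz': "norm z *\<^sub>R y = norm y *\<^sub>R z"
    unfolding yz z_def[symmetric] using B r_pos[of "fst j"] by (simp add: abs_mult)
  have "(norm z / norm y) *\<^sub>R y = (1 / norm y) *\<^sub>R (norm z *\<^sub>R y)" by simp
  also have "\<dots> = (1 / norm y) *\<^sub>R (norm y *\<^sub>R z)" by (simp only: yz')
  also have "\<dots> = z" using y(2) by simp
  finally have "?z = (norm ?z / norm y) *\<^sub>R y" by (simp only: z_def)
  then have "?s *\<^sub>R ?z = (?s * norm ?z / norm y) *\<^sub>R y" by (metis scaleR_scaleR times_divide_eq_right)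
  moreover have "?s *\<^sub>R ?z = x - b j" using sj by simp
  ultimately show "x = b j + (?s * norm ?z / norm y) *\<^sub>R y" by (simp add: algebra_simps)
qed simp

section \<open>The degree in two opposite cones\<close>

lemma active_of_value:
  assumes "V x = y \<or> W m x = y" "y \<noteq> 0"
  obtains j where "active j x" "patch j x = y" "W m x = y \<Longrightarrow> fst j \<le> m"
proof (cases "\<exists>j. active j x")
  case True
  then obtain j where j: "active j x" by blast
  show ?thesis
    by (rule that[OF j]) (use assms V_active[OF j] W_active[OF j, of m] in \<open>auto split: if_splits\<close>)
next
  case False
  then show ?thesis using assms V_inactive[of x] W_inactive[of x m] by auto
qed

lemma W_approx:
  assumes "y \<notin> V ` sphere 0 1"
  obtains m where "m \<ge> k" "\<And>x. norm (W m x - V x) < infdist y (V ` sphere 0 1)"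
proof -
  have "infdist y (V ` sphere 0 1) / 2 > 0"
    using infdist_image_sphere_pos[OF continuous_on_V assms] by simp
  then obtain M where M: "\<And>m. m \<ge> M \<Longrightarrow> r m < infdist y (V ` sphere 0 1) / 2"
    using r_tendsto_0 r_pos unfolding LIMSEQ_iff by (metis abs_of_pos diff_zero real_norm_def)
  show thesis
  proof (rule that[of "max k M"])
    have "M \<le> Suc (max k M)" by simp
    then show "norm (W (max k M) x - V x) < infdist y (V ` sphere 0 1)" for x
      using W_near_V[of "max k M" x] M[of "Suc (max k M)"] by linarith
  qed simp
qed

text \<open>Rays in the cone around the pole leave the ball for good, so neither the map nor any
  truncation attains \<open>y\<close> on the closed ball and the signed count is empty.\<close>

lemma degree_opposite:
  assumes y: "y \<noteq> 0" "y $ i0 \<ge> (19/20) * norm y"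
  shows "brouwer_deg V (ball 0 1) y = 0"
proof -
  have none: "norm x > 1" if v: "V x = y \<or> W m x = y" for x m
  proof (rule ccontr)
    assume "\<not> norm x > 1"
    then have x: "norm x \<le> 1" by simp
    obtain j where j: "active j x" "patch j x = y" using active_of_value[OF v y(1)] by blast
    obtain t where "1 \<le> t" "x = b j + (s (fst j) * t / norm y) *\<^sub>R y"
      using preimage_ray[OF j(1) x j(2) y(1)] by blast
    then show False using ray_outside[OF _ y, of j t] j(1) x by (simp add: active_def)
  qed
  have V: "y \<notin> V ` sphere 0 1" using none by force
  obtain m where m: "\<And>x. norm (W m x - V x) < infdist y (V ` sphere 0 1)"
    using W_approx[OF V, of 0] by blast
  have empty: "{x. x \<in> ball 0 1 \<and> W m x = y} = {}" using none[of _ m] by force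
  have "regular_value (W m) (ball 0 1) y" using none[of _ m] by (force simp: regular_value_def)
  from brouwer_deg_eq[OF continuous_on_V V smooth_on_W continuous_on_W m this]
  have "real_of_int (brouwer_deg V (ball 0 1) y) = 0" unfolding empty by simp
  then show ?thesis by simp
qed

text \<open>The lower bound on \<open>norm y\<close> excludes levels finer than \<open>k\<close>;
  the upper bound places every preimage in the open ball with negative Jacobian. The degree is thus
  minus the number of preimages. Each patch of level \<open>k\<close> supplies one, and coarser
  levels can only add more.\<close>

lemma degree_cone:
  assumes y: "y $ i0 \<le> - (19/20) * norm y" and lo: "2 * r (Suc k) < norm y" and hi: "norm y \<le> m0 * r k"
  shows "real_of_int (brouwer_deg V (ball 0 1) y) \<le> - real (card (I k))"
proof -
  have y0: "y \<noteq> 0" using lo r_pos[of "Suc k"] by auto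
  have level: "fst j \<le> k" if "patch j x = y" for j x
  proof (rule ccontr)
    assume "\<not> fst j \<le> k"
    then have "r (fst j) \<le> r (Suc k)" by (intro r_antimono) simp
    then show False using norm_patch_le[of j x] that lo by simp
  qed
  \<comment> \<open>Coarser levels have larger amplitude, so the required radial value is at most
    \<open>m0\<close> there as well, and monotonicity of \<open>radial\<close> gives the
    bound.\<close>
  have t_ge: "5/4 \<le> t" if "1 \<le> t" "t\<^sup>2 < 2" "radial t = norm y / r l" "l \<le> k" for t l
  proof (rule ccontr)
    assume "\<not> 5/4 \<le> t"
    then have "m0 < radial t" unfolding m0_def using that by (intro radial_strict_decreasing) auto
    moreover have "norm y \<le> m0 * r l"
      using hi mult_left_mono[OF r_antimono[OF \<open>l \<le> k\<close>], of m0] m0_pos by linarith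
    then have "norm y / r l \<le> m0" using r_pos[of l] by (simp add: pos_divide_le_eq)
    ultimately show False using that by simp
  qed
  have inside: "norm x < 1 \<and> jacobian (W m) x < 0"
    if x: "norm x \<le> 1" and j: "active j x" "patch j x = y" and m: "fst j \<le> m" for x m j
  proof -
    obtain t where t: "1 \<le> t" "t\<^sup>2 < 2" "radial t = norm y / r (fst j)" "x = b j + (s (fst j) * t / norm y) *\<^sub>R y"
      "norm ((1 / s (fst j)) *\<^sub>R (x - b j)) = t"
      using preimage_ray[OF j(1) x j(2) y0] by blast
    have "norm x < 1"
      using ray_inside[OF _ y0 y t_ge[OF t(1-3) level[OF j(2)]] t(2), of j] t(4) j(1) by (simp add: active_def)
    moreover have "det (profile_jac ((1 / s (fst j)) *\<^sub>R (x - b j))) < 0"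
      using t by (intro det_profile_jac_neg) auto
    then have "jacobian (W m) x < 0"
      unfolding jacobian_W[OF j(1) m] using s(1)[of "fst j"] r_pos[of "fst j"] by (intro mult_pos_neg) auto
    ultimately show ?thesis by simp
  qed
  have V: "y \<notin> V ` sphere 0 1"
  proof
    assume "y \<in> V ` sphere 0 1"
    then obtain x where x: "norm x = 1" "V x = y" by auto
    then obtain j where "active j x" "patch j x = y" using active_of_value[of x y 0] y0 by blast
    then show False using inside[of x j "fst j"] x by simp
  qed
  obtain m where m: "m \<ge> k" "\<And>x. norm (W m x - V x) < infdist y (V ` sphere 0 1)"
    using W_approx[OF V, of k] by blast
  let ?P = "{x. x \<in> ball 0 1 \<and> W m x = y}"
  have neg: "jacobian (W m) x < 0" if x: "x \<in> ?P" for x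
  proof -
    obtain j where "active j x" "patch j x = y" "fst j \<le> m" using active_of_value[of x y m] x y0 by blast
    then show ?thesis using inside[of x j m] x by simp
  qed
  have fin: "finite ?P"
  proof -
    have sub: "?P \<subseteq> (\<Union>j\<in>Sigma {..k} I. {x. norm x \<le> 1 \<and> active j x \<and> patch j x = y})"
    proof
      fix x assume x: "x \<in> ?P"
      then obtain j where j: "active j x" "patch j x = y" using active_of_value[of x y m] y0 by blast
      then have "j \<in> Sigma {..k} I" using level[OF j(2)] by (auto simp: active_def)
      then show "x \<in> (\<Union>j\<in>Sigma {..k} I. {x. norm x \<le> 1 \<and> active j x \<and> patch j x = y})" using j x by auto
    qed
    \<comment> \<open>Injectivity of \<open>radial\<close> beyond 1 fixes t, and t fixes the point
      on the ray: each patch has at most one preimage.\<close>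
    have "finite {x. norm x \<le> 1 \<and> active j x \<and> patch j x = y}" for j
    proof (rule finite_if_all_eq)
      fix x x' assume "x \<in> {x. norm x \<le> 1 \<and> active j x \<and> patch j x = y}" "x' \<in> {x. norm x \<le> 1 \<and> active j x \<and> patch j x = y}"
      then have x: "norm x \<le> 1" "active j x" "patch j x = y" and x': "norm x' \<le> 1" "active j x'" "patch j x' = y" by auto
      obtain t where t: "1 \<le> t" "t\<^sup>2 < 2" "radial t = norm y / r (fst j)" "x = b j + (s (fst j) * t / norm y) *\<^sub>R y"
        using preimage_ray[OF x(2,1,3) y0] by blast
      obtain t' where t': "1 \<le> t'" "t'\<^sup>2 < 2" "radial t' = norm y / r (fst j)" "x' = b j + (s (fst j) * t' / norm y) *\<^sub>R y"
        using preimage_ray[OF x'(2,1,3) y0] by blast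
      have "t = t'"
        using radial_strict_decreasing[of t t'] radial_strict_decreasing[of t' t] t(1-3) t'(1-3)
        by (cases t t' rule: linorder_cases) auto
      then show "x = x'" using t(4) t'(4) by simp
    qed
    then have "finite (\<Union>j\<in>Sigma {..k} I. {x. norm x \<le> 1 \<and> active j x \<and> patch j x = y})"
      by (intro finite_UN_I finite_SigmaI finite_atMost finite_I)
    with sub show ?thesis by (rule finite_subset)
  qed
  have count: "real_of_int (brouwer_deg V (ball 0 1) y) = (\<Sum>x\<in>?P. sgn (jacobian (W m) x))"
    by (rule brouwer_deg_eq[OF continuous_on_V V smooth_on_W continuous_on_W m(2)])
       (use neg in \<open>force simp: regular_value_def\<close>)
  also have "\<dots> = (\<Sum>x\<in>?P. -1)" using neg by (intro sum.cong) auto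
  also have "\<dots> = - real (card ?P)" by simp
  finally have deg: "real_of_int (brouwer_deg V (ball 0 1) y) = - real (card ?P)" .
  \<comment> \<open>\<open>radial\<close> takes the value \<open>m0\<close> at 5/4 and 0 at 3/2,
    which brackets the required value; positivity of that value then forces t below sqrt 2.\<close>
  have "\<exists>t. 5/4 \<le> t \<and> t \<le> 3/2 \<and> radial t = norm y / r k"
  proof (rule IVT2')
    have "norm y / r k \<le> m0" using hi r_pos[of k] by (simp add: pos_divide_le_eq)
    then show "norm y / r k \<le> radial (5/4)" by (simp add: m0_def)
    show "radial (3/2) \<le> norm y / r k" using r_pos[of k] by (simp add: radial_def bump_eq_0 power2_eq_square)
  qed (auto intro: continuous_on_radial)
  then obtain t where t: "5/4 \<le> t" "t \<le> 3/2" "radial t = norm y / r k" by blast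
  have "radial t > 0" using t(3) y0 r_pos[of k] by simp
  then have t2: "t\<^sup>2 < 2" using t(1) by (cases "t\<^sup>2 < 2") (auto simp: radial_def bump_eq_0)
  define X where "X = (\<lambda>i. b (k, i) + (s k * t / norm y) *\<^sub>R y)"
  have t32: "t < 3/2"
  proof (rule power2_less_imp_less)
    show "t\<^sup>2 < (3/2)\<^sup>2" using t2 by (simp add: power2_eq_square)
  qed simp
  have X: "active (k, i) (X i)" "norm (X i) < 1" "patch (k, i) (X i) = y" if i: "i \<in> I k" for i
  proof -
    have J: "(k, i) \<in> Sigma UNIV I" using i by simp
    have d: "X i - b (k, i) = (s k * t / norm y) *\<^sub>R y" by (simp add: X_def)
    have "norm (X i - b (k, i)) = s k * t" unfolding d using s(1)[of k] t(1) y0 by (simp add: abs_mult)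
    then show "active (k, i) (X i)" using J t32 s(1)[of k] by (simp add: active_def mult.commute)
    show "norm (X i) < 1" using ray_inside[OF J y0 y t(1) t2] by (simp add: X_def)
    have z: "(1 / s k) *\<^sub>R (X i - b (k, i)) = (t / norm y) *\<^sub>R y" unfolding d using s(1)[of k] by simp
    have nz: "norm ((t / norm y) *\<^sub>R y) = t" using t(1) y0 by simp
    have "patch (k, i) (X i) = (r k * (bump (2 - t\<^sup>2) * (t / norm y))) *\<^sub>R y"
      by (simp only: patch_def fst_conv z profile_def nz scaleR_scaleR mult.assoc)
    also have "r k * (bump (2 - t\<^sup>2) * (t / norm y)) = 1"
      using t(3) r_pos[of k] y0 by (simp add: radial_def field_simps)
    finally show "patch (k, i) (X i) = y" by simp
  qed
  have "card (I k) \<le> card ?P"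
  proof (rule card_inj_on_le[OF _ _ fin])
    show "inj_on X (I k)"
    proof (rule inj_onI)
      fix i i' assume i: "i \<in> I k" "i' \<in> I k" "X i = X i'"
      have "active (k, i) (X i)" "active (k, i') (X i)" using X(1)[OF i(1)] X(1)[OF i(2)] unfolding i(3) by blast+
      then show "i = i'" using active_unique by blast
    qed
    show "X ` I k \<subseteq> ?P"
    proof (rule image_subsetI)
      fix i assume i: "i \<in> I k"
      show "X i \<in> ?P" using X[OF i] W_active[OF X(1)[OF i], of m] m(1) by simp
    qed
  qed
  then show ?thesis using deg by simp
qed

end

subsection \<open>Jumps at many scales exclude fractional smoothness\<close>

lemma emeasure_ball_cart:
  "\<rho> \<ge> 0 \<Longrightarrow> emeasure lborel (ball (a::real^'n) \<rho>) = ennreal (unit_ball_vol (real CARD('n)) * \<rho> ^ CARD('n))"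
  using emeasure_ball[of \<rho> a] by simp

lemma nn_integral_ge_on_ball:
  fixes F :: "real^'n \<Rightarrow> ennreal"
  assumes F: "\<And>x. x \<in> ball a \<rho> \<Longrightarrow> F x \<ge> ennreal C" and "C \<ge> 0" "\<rho> \<ge> 0"
  shows "(\<integral>\<^sup>+ x. F x \<partial>lebesgue) \<ge> ennreal (C * (unit_ball_vol (real CARD('n)) * \<rho> ^ CARD('n)))"
proof -
  have "ennreal (C * (unit_ball_vol (real CARD('n)) * \<rho> ^ CARD('n))) = ennreal C * emeasure lborel (ball a \<rho>)"
    unfolding emeasure_ball_cart[OF \<open>\<rho> \<ge> 0\<close>] using assms by (intro ennreal_mult) auto
  also have "\<dots> = (\<integral>\<^sup>+ x. ennreal C * indicator (ball a \<rho>) x \<partial>lborel)"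
    by (rule nn_integral_cmult_indicator[symmetric]) simp
  also have "\<dots> \<le> (\<integral>\<^sup>+ x. F x \<partial>lborel)"
    using F by (intro nn_integral_mono) (auto simp: indicator_def)
  finally show ?thesis by (simp add: nn_integral_completion)
qed

lemma not_bounded_by_finite:
  fixes T :: ennreal and g :: "nat \<Rightarrow> real"
  assumes T: "\<And>k. T \<ge> ennreal (C * g k)" and C: "C > 0" and g: "\<And>M. \<exists>k. M \<le> g k"
  shows "T = \<infinity>"
proof (rule ccontr)
  assume "T \<noteq> \<infinity>"
  then obtain t where t: "t \<ge> 0" "T = ennreal t" by (cases T) auto
  obtain k where "(t + 1) / C \<le> g k" using g by blast
  then have "t + 1 \<le> C * g k" using C by (simp add: pos_divide_le_eq mult.commute)
  moreover have "C * g k \<le> t" using T[of k] t by (simp add: ennreal_le_iff)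
  ultimately show False by simp
qed

text \<open>For \<beta> = 0 the large values on one ball suffice. Otherwise pairs from the two balls
  are at distance at most \<open>3 * c * \<rho> k\<close>, so with q = n + \<beta>p they contribute
  at least a constant times d^p \<rho>^(2n) / \<rho>^q = d^p \<rho>^(n - \<beta>p).\<close>

lemma not_in_sobolev_of_jumps:
  fixes f :: "real^'n \<Rightarrow> real" and e :: "real^'n" and \<rho> d :: "nat \<Rightarrow> real"
  assumes p: "p \<ge> 1" and \<beta>: "0 \<le> \<beta>" "\<beta> < 1" and e: "norm e = 1" and c: "c > 0"
    and \<rho>: "\<And>k. \<rho> k > 0" and d: "\<And>k. d k \<ge> 0"
    and big: "\<And>k y. y \<in> ball (- (c * \<rho> k) *\<^sub>R e) (c * \<rho> k / 100) \<Longrightarrow> \<bar>f y\<bar> \<ge> d k"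
    and zero: "\<And>k y. y \<in> ball ((c * \<rho> k) *\<^sub>R e) (c * \<rho> k / 100) \<Longrightarrow> f y = 0"
    and growth: "\<And>M. \<exists>k. M \<le> d k powr p * \<rho> k powr (real CARD('n) - \<beta> * p)"
  shows "f \<notin> sobolev \<beta> p"
proof
  assume f: "f \<in> sobolev \<beta> p"
  let ?n = "CARD('n)" and ?v = "unit_ball_vol (real CARD('n))"
  have v: "?v > 0" by simp
  have rad: "c * \<rho> k / 100 \<ge> 0" for k using c \<rho>[of k] by simp
  have d_le: "d k powr p \<le> \<bar>f y\<bar> powr p" if "y \<in> ball (- (c * \<rho> k) *\<^sub>R e) (c * \<rho> k / 100)" for k y
    using big[OF that] d[of k] p by (intro powr_mono2) auto
  show False
  proof (cases "\<beta> = 0")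
    case True
    then have "f \<in> Lp_space p" using f by (simp add: sobolev_def sobolev_int_def)
    then have "integrable lebesgue (\<lambda>x. \<bar>f x\<bar> powr p)" by (simp add: Lp_space_def)
    then have fin: "(\<integral>\<^sup>+ x. ennreal (\<bar>f x\<bar> powr p) \<partial>lebesgue) < \<infinity>"
      by (simp add: integrable_iff_bounded)
    have "(\<integral>\<^sup>+ x. ennreal (\<bar>f x\<bar> powr p) \<partial>lebesgue) = \<infinity>"
    proof (rule not_bounded_by_finite[where g = "\<lambda>k. d k powr p * \<rho> k powr (real CARD('n) - \<beta> * p)" and C = "?v * (c / 100) ^ ?n"])
      fix k
      have "ennreal (d k powr p * (?v * (c * \<rho> k / 100) ^ ?n)) \<le> (\<integral>\<^sup>+ x. ennreal (\<bar>f x\<bar> powr p) \<partial>lebesgue)"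
        by (rule nn_integral_ge_on_ball[OF _ _ rad]) (auto intro!: ennreal_leI d_le)
      moreover have "d k powr p * (?v * (c * \<rho> k / 100) ^ ?n) =
          (?v * (c / 100) ^ ?n) * (d k powr p * \<rho> k powr (real ?n - \<beta> * p))"
        using True \<rho>[of k] by (simp add: powr_realpow power_mult_distrib power_divide)
      ultimately show "ennreal ((?v * (c / 100) ^ ?n) * (d k powr p * \<rho> k powr (real ?n - \<beta> * p)))
          \<le> (\<integral>\<^sup>+ x. ennreal (\<bar>f x\<bar> powr p) \<partial>lebesgue)" by simp
    qed (use v c growth in simp_all)
    then show False using fin by simp
  next
    case False
    then have "\<beta> \<notin> \<int>" using \<beta> by (auto elim!: Ints_cases)
    then have "f \<in> sobolev_frac \<beta> p" using f \<beta> by (simp add: sobolev_def)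
    let ?q = "real ?n + \<beta> * p"
    define F where "F = (\<lambda>x y. ennreal (\<bar>f x - f y\<bar> powr p / norm (x - y) powr ?q))"
    have fin: "(\<integral>\<^sup>+ x. (\<integral>\<^sup>+ y. F x y \<partial>lebesgue) \<partial>lebesgue) < \<infinity>"
      using \<open>f \<in> sobolev_frac \<beta> p\<close> by (simp add: sobolev_frac_def F_def)
    have "(\<integral>\<^sup>+ x. (\<integral>\<^sup>+ y. F x y \<partial>lebesgue) \<partial>lebesgue) = \<infinity>"
    \<comment> \<open>The constant collects the two ball volumes and the bound on distances between
      the balls.\<close>
    proof (rule not_bounded_by_finite[where g = "\<lambda>k. d k powr p * \<rho> k powr (real CARD('n) - \<beta> * p)" and
          C = "(?v * (c / 100) ^ ?n)\<^sup>2 / (3 * c) powr ?q"])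
      fix k
      let ?R = "c * \<rho> k"
      have R: "?R > 0" using c \<rho> by simp
      define K where "K = d k powr p / (3 * ?R) powr ?q"
      have K: "K \<ge> 0" by (simp add: K_def)
      have F_ge: "F x y \<ge> ennreal K"
        if x: "x \<in> ball (- ?R *\<^sub>R e) (?R / 100)" and y: "y \<in> ball (?R *\<^sub>R e) (?R / 100)" for x y
      proof -
        \<comment> \<open>The centres are \<open>2 * ?R\<close> apart and the radii are
          \<open>?R / 100\<close>; 3 is a convenient upper factor, and the distance stays
          positive.\<close>
        have "norm (x - y) \<le> 3 * ?R \<and> norm (x - y) > 0"
        proof -
          define u where "u = x + ?R *\<^sub>R e"
          define w where "w = y - ?R *\<^sub>R e"
          have uw: "norm u < ?R / 100" "norm w < ?R / 100"
            using x y by (simp_all add: u_def w_def dist_norm norm_minus_commute add.commute)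
          have xy: "x - y = (u - w) - (2 * ?R) *\<^sub>R e"
            by (simp add: u_def w_def algebra_simps flip: scaleR_2)
          have nR: "norm ((2 * ?R) *\<^sub>R e) = 2 * ?R" using R e by simp
          have "norm (u - w) < ?R / 50" using norm_triangle_ineq4[of u w] uw by simp
          moreover have "norm (x - y) \<le> norm (u - w) + 2 * ?R"
            unfolding xy using norm_triangle_ineq4[of "u - w" "(2 * ?R) *\<^sub>R e"] nR by simp
          moreover have "2 * ?R \<le> norm (u - w) + norm (x - y)"
            unfolding xy using norm_triangle_sub[of "(2 * ?R) *\<^sub>R e" "u - w"] nR by (simp add: norm_minus_commute)
          ultimately show ?thesis using R by linarith
        qed
        then have "norm (x - y) powr ?q \<le> (3 * ?R) powr ?q" "norm (x - y) powr ?q > 0"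
          using \<beta> p by (auto intro!: powr_mono2)
        moreover have "d k powr p \<le> \<bar>f x - f y\<bar> powr p" using d_le[OF x] zero[OF y] by simp
        ultimately have "K \<le> \<bar>f x - f y\<bar> powr p / norm (x - y) powr ?q"
          unfolding K_def by (intro frac_le) auto
        then show ?thesis unfolding F_def by (rule ennreal_leI)
      qed
      define K' where "K' = K * (?v * (?R / 100) ^ ?n)"
      have K': "K' \<ge> 0" using K R v by (simp add: K'_def)
      have "(\<integral>\<^sup>+ y. F x y \<partial>lebesgue) \<ge> ennreal K'" if "x \<in> ball (- ?R *\<^sub>R e) (?R / 100)" for x
        unfolding K'_def by (rule nn_integral_ge_on_ball[OF F_ge[OF that] K]) (use R in auto)
      then have "(\<integral>\<^sup>+ x. (\<integral>\<^sup>+ y. F x y \<partial>lebesgue) \<partial>lebesgue) \<ge> ennreal (K' * (?v * (?R / 100) ^ ?n))"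
        by (rule nn_integral_ge_on_ball[OF _ K']) (use R in auto)
      moreover have "K' * (?v * (?R / 100) ^ ?n) =
        ((?v * (c / 100) ^ ?n)\<^sup>2 / (3 * c) powr ?q) * (d k powr p * \<rho> k powr (real ?n - \<beta> * p))"
      proof -
        have "(3 * ?R) powr ?q = (3 * c) powr ?q * \<rho> k powr ?q"
          using c \<rho>[of k] by (simp add: powr_mult mult.assoc[symmetric])
        moreover have "(?R / 100) ^ ?n = (c / 100) ^ ?n * \<rho> k ^ ?n"
          by (simp add: power_mult_distrib power_divide)
        moreover have "\<rho> k powr (real ?n - \<beta> * p) = \<rho> k ^ ?n * \<rho> k ^ ?n / \<rho> k powr ?q"
        proof -
          have "real ?n - \<beta> * p = real ?n + real ?n - ?q" by simp
          then have "\<rho> k powr (real ?n - \<beta> * p) = \<rho> k powr (real ?n) * \<rho> k powr (real ?n) / \<rho> k powr ?q"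
            by (simp only: powr_diff powr_add)
          then show ?thesis using \<rho>[of k] by (simp add: powr_realpow)
        qed
        ultimately show ?thesis by (simp add: K'_def K_def power2_eq_square)
      qed
      ultimately show "ennreal (((?v * (c / 100) ^ ?n)\<^sup>2 / (3 * c) powr ?q) * (d k powr p * \<rho> k powr (real ?n - \<beta> * p)))
        \<le> (\<integral>\<^sup>+ x. (\<integral>\<^sup>+ y. F x y \<partial>lebesgue) \<partial>lebesgue)" by simp
    next
      have "?v * (c / 100) ^ ?n > 0" using v c by simp
      moreover have "(3 * c) powr ?q > 0" using c by simp
      ultimately show "0 < (?v * (c / 100) ^ ?n)\<^sup>2 / (3 * c) powr ?q"
        by (intro divide_pos_pos zero_less_power)
    qed (use growth in simp)
    then show False using fin by simp
  qed
qed

context bump_family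
begin

text \<open>With R = \<open>m0 / 2 * r k\<close>, points of the two balls have norm between 0.99 R
  and 1.01 R and satisfy the cone condition, since 0.99 exceeds 19/20 * 1.01. The norm is below 2R =
  \<open>m0 * r k\<close> and above R/2, hence above \<open>2 * r (Suc k)\<close>.\<close>

lemma degree_not_in_sobolev:
  assumes p: "p \<ge> 1" and \<beta>: "0 \<le> \<beta>" "\<beta> < 1"
    and growth: "\<And>M. \<exists>k. M \<le> real (card (I k)) powr p * (s k powr \<alpha>) powr (real CARD('n) - \<beta> * p)"
  shows "(\<lambda>y. real_of_int (brouwer_deg V (ball 0 1) y)) \<notin> sobolev \<beta> p"
proof (rule not_in_sobolev_of_jumps[OF p \<beta>, where e = "axis i0 1" and c = "m0 / 2" and \<rho> = r and d = "\<lambda>k. real (card (I k))"])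
  let ?e = "axis i0 1 :: real^'n"
  have center: "\<bar>y $ i0 - a\<bar> \<le> R / 100 \<and> \<bar>norm y - \<bar>a\<bar>\<bar> \<le> R / 100" if "y \<in> ball (a *\<^sub>R ?e) (R / 100)" for y a R
  proof -
    have "norm (y - a *\<^sub>R ?e) < R / 100" using that by (simp add: dist_norm norm_minus_commute)
    moreover have "\<bar>(y - a *\<^sub>R ?e) $ i0\<bar> \<le> norm (y - a *\<^sub>R ?e)" by (rule component_le_norm_cart)
    moreover have "\<bar>norm y - norm (a *\<^sub>R ?e)\<bar> \<le> norm (y - a *\<^sub>R ?e)" by (rule norm_triangle_ineq3)
    moreover have "(y - a *\<^sub>R ?e) $ i0 = y $ i0 - a" "norm (a *\<^sub>R ?e) = \<bar>a\<bar>"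
      by (simp_all add: norm_axis_1)
    ultimately show ?thesis by linarith
  qed
  fix k y
  define R where "R = m0 / 2 * r k"
  have R: "R > 0" "m0 * r k = 2 * R" "r (Suc k) \<le> R / 4" using r_pos[of k] m0_pos r_Suc[of k] by (simp_all add: R_def)
  show "real (card (I k)) \<le> \<bar>real_of_int (brouwer_deg V (ball 0 1) y)\<bar>"
    if "y \<in> ball (- (m0 / 2 * r k) *\<^sub>R ?e) (m0 / 2 * r k / 100)"
  proof -
    have y: "\<bar>y $ i0 + R\<bar> \<le> R / 100" "\<bar>norm y - R\<bar> \<le> R / 100"
      using center[of y "- R" R] that R(1) by (simp_all add: R_def)
    have "norm y \<le> R + R / 100" "R - R / 100 \<le> norm y" "y $ i0 \<le> R / 100 - R"
      using y by linarith+
    then have "y $ i0 \<le> - (19/20) * norm y" "2 * r (Suc k) < norm y" "norm y \<le> m0 * r k"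
      using R by simp_all
    then have "real_of_int (brouwer_deg V (ball 0 1) y) \<le> - real (card (I k))" by (rule degree_cone)
    then show ?thesis by linarith
  qed
  show "real_of_int (brouwer_deg V (ball 0 1) y) = 0"
    if "y \<in> ball ((m0 / 2 * r k) *\<^sub>R ?e) (m0 / 2 * r k / 100)"
  proof -
    have y: "\<bar>y $ i0 - R\<bar> \<le> R / 100" "\<bar>norm y - R\<bar> \<le> R / 100"
      using center[of y R R] that R(1) by (simp_all add: R_def)
    have "norm y \<le> R + R / 100" "R - R / 100 \<le> norm y" "R - R / 100 \<le> y $ i0"
      using y by linarith+
    moreover from this have "norm y > 0" using R(1) by linarith
    ultimately have "y \<noteq> 0" "y $ i0 \<ge> (19/20) * norm y"
      using R(1) by auto
    then show ?thesis using degree_opposite by simp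
  qed
qed (use m0_pos r_pos growth in \<open>simp_all add: norm_axis_1 r_def\<close>)

end

subsection \<open>Choice of the parameters\<close>

text \<open>Pinning the coordinate \<open>i0\<close> at 0 leaves n - 1 free directions, tangential
  at the pole. Distinct indices then differ in a coordinate other than \<open>i0\<close>, where
  separation is measured.\<close>

definition grid :: "'n \<Rightarrow> nat \<Rightarrow> ('n \<Rightarrow> nat) set" where
  "grid i0 N = {m. m i0 = 0 \<and> (\<forall>i. i \<noteq> i0 \<longrightarrow> m i < N)}"

lemma card_grid: "card (grid (i0 :: 'n::finite) N) = N ^ (CARD('n) - 1)"
  and finite_grid: "finite (grid (i0 :: 'n) N)"
proof -
  have eq: "grid i0 N = (\<Pi>\<^sub>E i\<in>UNIV. if i = i0 then {0} else {..<N})"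
    by (auto simp: grid_def PiE_UNIV_domain Pi_iff split: if_splits)
  have "card (grid i0 N) = (\<Prod>i\<in>(UNIV::'n set). if i = i0 then 1 else N)"
    unfolding eq by (subst card_PiE) (auto intro!: prod.cong)
  also have "\<dots> = (\<Prod>i\<in>UNIV - {i0}. N)"
    by (subst prod.remove[of UNIV i0]) (auto intro!: prod.cong)
  finally show "card (grid i0 N) = N ^ (CARD('n) - 1)" by (simp add: card_Diff_singleton)
  show "finite (grid i0 N)" unfolding eq by (intro finite_PiE) auto
qed

text \<open>Within a level the spacing is \<open>4 * s\<close>. The dyadic shift confines level
  \<open>k\<close> to tangential coordinates between \<delta>/2^k and 9/8 of it, so that levels do
  not meet.\<close>

definition offset :: "'n \<Rightarrow> real \<Rightarrow> (nat \<Rightarrow> real) \<Rightarrow> nat \<times> ('n \<Rightarrow> nat) \<Rightarrow> real^'n" where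
  "offset i0 \<delta> s j = (\<chi> i. if i = i0 then 0 else \<delta> / 2 ^ fst j + 4 * s (fst j) * real (snd j i))"

text \<open>The square root lifts the tangential offset to the sphere of radius 1 + s, on the side
  of the pole.\<close>

definition centre :: "'n \<Rightarrow> real \<Rightarrow> (nat \<Rightarrow> real) \<Rightarrow> nat \<times> ('n \<Rightarrow> nat) \<Rightarrow> real^'n" where
  "centre i0 \<delta> s j = offset i0 \<delta> s j + sqrt ((1 + s (fst j))\<^sup>2 - (norm (offset i0 \<delta> s j))\<^sup>2) *\<^sub>R axis i0 1"

text \<open>The value of \<delta> makes the l1 norm of an offset at most n * 2\<delta> = 1/40; the
  height deviates from 1 by at most another 1/40, whence 1/20. In one level the spacing 4s exceeds
  the required 3s; between levels a coordinate gap of 7/16 of \<delta>/2^k is far larger than the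
  patches.\<close>

lemma bump_family_grid:
  fixes i0 :: "'n::finite" and s :: "nat \<Rightarrow> real" and N :: "nat \<Rightarrow> nat"
  assumes n: "CARD('n) \<ge> 2" and \<alpha>: "0 < \<alpha>" "\<alpha> \<le> 1"
    and \<delta>: "\<delta> = 1 / (80 * real CARD('n))"
    and s: "\<And>k. 0 < s k" "\<And>k. s k \<le> \<delta> / 2 ^ k / 64"
    and decay: "\<And>k. s (Suc k) powr \<alpha> \<le> radial (5/4) / 8 * s k powr \<alpha>"
    and N: "\<And>k. 4 * s k * real (N k) \<le> \<delta> / 2 ^ k / 8"
  shows "bump_family i0 s \<alpha> (\<lambda>k. grid i0 (N k)) (centre i0 \<delta> s)"
proof
  let ?I = "\<lambda>k. grid i0 (N k)"
  let ?b = "centre i0 \<delta> s"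
  have \<delta>01: "0 < \<delta>" "\<delta> \<le> 1/80" using n unfolding \<delta> by (simp_all add: field_simps)
  define dl where "dl = (\<lambda>k::nat. \<delta> / 2 ^ k)"
  have dk: "0 < dl k" "dl k \<le> \<delta>" for k using \<delta>01 by (simp_all add: dl_def pos_divide_le_eq)
  have s64: "64 * s k \<le> dl k" for k using s(2)[of k] by (simp add: dl_def)
  have N8: "8 * (4 * s k * real (N k)) \<le> dl k" for k using N[of k] by (simp add: dl_def)
  show s40: "s k \<le> 1/40" for k using s64[of k] dk(2)[of k] \<delta>01 by simp
  show "finite (?I k)" for k by (rule finite_grid)
  have off: "dl (fst j) \<le> offset i0 \<delta> s j $ i" "offset i0 \<delta> s j $ i \<le> (9/8) * (dl (fst j))"
    if "j \<in> Sigma UNIV ?I" "i \<noteq> i0" for j i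
  proof -
    obtain k m where j: "j = (k, m)" "m i < N k" using \<open>j \<in> Sigma UNIV ?I\<close> \<open>i \<noteq> i0\<close> by (cases j) (auto simp: grid_def)
    have "4 * s k * real (m i) \<le> 4 * s k * real (N k)"
      using j s(1)[of k] by (intro mult_left_mono) auto
    moreover have "0 \<le> 4 * s k * real (m i)" using s(1)[of k] by simp
    ultimately show "dl (fst j) \<le> offset i0 \<delta> s j $ i" "offset i0 \<delta> s j $ i \<le> (9/8) * (dl (fst j))"
      using N8[of k] dk(1)[of k] \<open>i \<noteq> i0\<close> by (simp_all add: offset_def j flip: dl_def) (simp_all add: dl_def)
  qed
  have off0: "offset i0 \<delta> s j $ i0 = 0" for j by (simp add: offset_def)
  have norm_off: "norm (offset i0 \<delta> s j) \<le> 1/40" if j: "j \<in> Sigma UNIV ?I" for j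
  proof -
    have "\<bar>offset i0 \<delta> s j $ i\<bar> \<le> 2 * \<delta>" for i
    proof (cases "i = i0")
      case False
      then show ?thesis using off[OF j False] dk[of "fst j"] \<delta>01 by linarith
    qed (use off0 \<delta>01 in simp)
    then have "(\<Sum>i\<in>UNIV. \<bar>offset i0 \<delta> s j $ i\<bar>) \<le> (\<Sum>i\<in>(UNIV::'n set). 2 * \<delta>)" by (intro sum_mono)
    also have "\<dots> = 1/40" by (simp add: \<delta>)
    finally show ?thesis using norm_le_l1_cart[of "offset i0 \<delta> s j"] by linarith
  qed
  have sq_le: "(norm (offset i0 \<delta> s j))\<^sup>2 \<le> (1 + s (fst j))\<^sup>2" if "j \<in> Sigma UNIV ?I" for j
    using norm_off[OF that] s(1)[of "fst j"] by (intro power_mono) auto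
  show "norm (?b j) = 1 + s (fst j)" if j: "j \<in> Sigma UNIV ?I" for j
  proof -
    have "(norm (?b j))\<^sup>2 = (norm (offset i0 \<delta> s j))\<^sup>2 + (sqrt ((1 + s (fst j))\<^sup>2 - (norm (offset i0 \<delta> s j))\<^sup>2))\<^sup>2"
      unfolding power2_norm_eq_inner centre_def
      by (simp add: inner_add_left inner_add_right inner_axis inner_axis' off0 power2_eq_square)
    also have "\<dots> = (1 + s (fst j))\<^sup>2" using sq_le[OF j] by simp
    finally show ?thesis using s(1)[of "fst j"] by (simp add: power2_eq_iff_nonneg)
  qed
  show "norm (?b j - axis i0 1) \<le> 1/20" if j: "j \<in> Sigma UNIV ?I" for j
  proof -
    let ?P = "norm (offset i0 \<delta> s j)"
    define h where "h = sqrt ((1 + s (fst j))\<^sup>2 - ?P\<^sup>2)"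
    have "h \<le> sqrt ((1 + s (fst j))\<^sup>2)" unfolding h_def by (intro real_sqrt_le_mono) simp
    then have 1: "h \<le> 1 + s (fst j)" using s(1)[of "fst j"] by simp
    have "?P * ?P \<le> 1 * ?P" using norm_off[OF j] by (intro mult_right_mono) auto
    moreover have "1 \<le> (1 + s (fst j))\<^sup>2" using s(1)[of "fst j"] by (intro one_le_power) simp
    \<comment> \<open>Since P \<le> 1, the square of P is at most P; this gives a linear lower bound
      for the height.\<close>
    ultimately have "(1 - ?P)\<^sup>2 \<le> (1 + s (fst j))\<^sup>2 - ?P\<^sup>2"
      by (simp add: power2_eq_square algebra_simps)
    then have 2: "1 - ?P \<le> h" unfolding h_def by (rule real_le_rsqrt)
    have "?b j - axis i0 1 = offset i0 \<delta> s j + (h - 1) *\<^sub>R axis i0 1"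
      by (simp add: centre_def h_def algebra_simps)
    then have "norm (?b j - axis i0 1) \<le> ?P + \<bar>h - 1\<bar>"
      using norm_triangle_ineq[of "offset i0 \<delta> s j" "(h - 1) *\<^sub>R axis i0 1"] by (simp add: norm_axis_1)
    then show ?thesis using 1 2 norm_off[OF j] s40[of "fst j"] by linarith
  qed
  have comp: "\<bar>offset i0 \<delta> s j $ i - offset i0 \<delta> s j' $ i\<bar> \<le> norm (?b j - ?b j')" if "i \<noteq> i0" for i j j'
    using component_le_norm_cart[of "?b j - ?b j'" i] that by (simp add: centre_def axis_def)
  \<comment> \<open>Dimension at least 2 provides a tangential coordinate in which different levels
    can be told apart.\<close>
  obtain i1 where i1: "i1 \<noteq> i0"
  proof -
    have "UNIV \<noteq> {i0}"
    proof
      assume "UNIV = {i0}"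
      then have "CARD('n) = card {i0}" by (rule arg_cong)
      then show False using n by simp
    qed
    then show thesis using that by blast
  qed
  have far: "norm (?b j - ?b j') \<ge> 3/2 * (s (fst j) + s (fst j'))"
    if j: "j \<in> Sigma UNIV ?I" "j' \<in> Sigma UNIV ?I" and lt: "fst j < fst j'" for j j'
  proof -
    have "(2::real) ^ Suc (fst j) \<le> 2 ^ fst j'" using lt by (intro power_increasing) auto
    then have "dl (fst j') \<le> \<delta> / 2 ^ Suc (fst j)" unfolding dl_def using \<delta>01 by (intro divide_left_mono) auto
    then have half: "2 * dl (fst j') \<le> dl (fst j)" by (simp add: dl_def)
    \<comment> \<open>The finer level reaches at most 9/8 of half the coarser offset: 1 - 9/16 =
      7/16.\<close>
    have "(7/16) * (dl (fst j)) \<le> offset i0 \<delta> s j $ i1 - offset i0 \<delta> s j' $ i1"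
      using off(1)[OF j(1) i1] off(2)[OF j(2) i1] half by linarith
    then have "(7/16) * (dl (fst j)) \<le> norm (?b j - ?b j')" using comp[OF i1, of j j'] by linarith
    moreover have "64 * s (fst j) \<le> dl (fst j)" "64 * s (fst j') \<le> dl (fst j)"
      using s64[of "fst j"] s64[of "fst j'"] half dk(1)[of "fst j'"] by linarith+
    ultimately show ?thesis using dk(1)[of "fst j"] by (simp add: distrib_left)
  qed
  show "norm (?b j - ?b j') \<ge> 3/2 * (s (fst j) + s (fst j'))"
    if j: "j \<in> Sigma UNIV ?I" "j' \<in> Sigma UNIV ?I" "j \<noteq> j'" for j j'
  proof (cases "fst j" "fst j'" rule: linorder_cases)
    case less
    then show ?thesis using far j by blast
  next
    case greater
    then show ?thesis using far[OF j(2,1)] by (simp add: norm_minus_commute add.commute)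
  next
    case equal
    then have "snd j \<noteq> snd j'" using j(3) by (simp add: prod_eq_iff)
    then obtain i where i: "snd j i \<noteq> snd j' i" by blast
    have "i \<noteq> i0" using i j by (auto simp: grid_def)
    have "1 \<le> \<bar>real (snd j i) - real (snd j' i)\<bar>" using i by linarith
    then have "4 * s (fst j) * 1 \<le> 4 * s (fst j) * \<bar>real (snd j i) - real (snd j' i)\<bar>"
      using s(1)[of "fst j"] by (intro mult_left_mono) auto
    also have "\<dots> = \<bar>offset i0 \<delta> s j $ i - offset i0 \<delta> s j' $ i\<bar>"
      using \<open>i \<noteq> i0\<close> equal s(1)[of "fst j'"] by (simp add: offset_def abs_mult flip: right_diff_distrib)
    also have "\<dots> \<le> norm (?b j - ?b j')" by (rule comp[OF \<open>i \<noteq> i0\<close>])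
    finally show ?thesis using equal s(1)[of "fst j'"] by simp
  qed
qed (use \<alpha> s decay in auto)

lemma powr_base_exists:
  fixes e K L :: real
  assumes "e < 0" "K > 0" "L > 0" "0 < a"
  obtains \<theta> where "0 < \<theta>" "\<theta> \<le> 1/2" "\<theta> powr a \<le> L" "\<theta> powr e \<ge> K"
proof
  define \<theta> where "\<theta> = min (1/2) (min (L powr (1 / a)) (K powr (1 / e)))"
  show pos: "0 < \<theta>" and "\<theta> \<le> 1/2" using assms by (simp_all add: \<theta>_def)
  have "\<theta> powr a \<le> (L powr (1 / a)) powr a"
    using assms pos by (intro powr_mono2) (auto simp: \<theta>_def)
  then show "\<theta> powr a \<le> L" using assms by (simp add: powr_powr)
  have "(K powr (1 / e)) powr e \<le> \<theta> powr e"
    using assms pos by (intro powr_mono2') (auto simp: \<theta>_def)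
  then show "\<theta> powr e \<ge> K" using assms by (simp add: powr_powr)
qed

text \<open>Sizes decay like \<theta>^k, but level \<open>k\<close> has only tangential width of
  order 2^(-k), so it holds about (2\<theta>)^(-k) patches per direction. The resulting loss 2^(-c)
  per level is absorbed by taking \<theta> small, because the exponent of \<theta> is
  negative.\<close>

lemma rough_degree_fractional:
  fixes p \<alpha> \<beta> :: real
  assumes n: "CARD('n::finite) \<ge> 2" and p: "p \<ge> 1" and \<alpha>: "0 < \<alpha>" "\<alpha> \<le> 1" and \<beta>: "0 \<le> \<beta>" "\<beta> < 1"
    and big: "\<beta> > real CARD('n) / p - (real CARD('n) - 1) / \<alpha>"
  obtains v :: "real^'n \<Rightarrow> real^'n" where "continuous_on UNIV v" "v \<in> holder_space \<alpha> (ball 0 1)"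
    "(\<lambda>y. real_of_int (brouwer_deg v (ball 0 1) y)) \<notin> sobolev \<beta> p"
proof -
  let ?n = "CARD('n)"
  define q where "q = real ?n - \<beta> * p"
  define c where "c = (real ?n - 1) * p"
  \<comment> \<open>This is the hypothesis on \<beta> multiplied by \<alpha>p.\<close>
  have "\<alpha> * q < c"
  proof -
    have "(real ?n / p - \<beta>) * (\<alpha> * p) < (real ?n - 1) / \<alpha> * (\<alpha> * p)"
      using big \<alpha> p by (intro mult_strict_right_mono) auto
    moreover have "(real ?n / p - \<beta>) * (\<alpha> * p) = \<alpha> * q" using p by (simp add: q_def field_simps)
    moreover have "(real ?n - 1) / \<alpha> * (\<alpha> * p) = c" using \<alpha> by (simp add: c_def)
    ultimately show ?thesis by (simp only:)
  qed
  then have "\<alpha> * q - c < 0" by simp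
  moreover have "(2::real) powr (c + 1) > 0" "radial (5/4) / 8 > 0"
    by (simp_all add: radial_def bump_pos power2_eq_square)
  \<comment> \<open>The third property gives the amplitude decay; the fourth leaves a factor of at
    least 2 per level after the loss 2^(-c).\<close>
  ultimately obtain \<theta> where \<theta>: "0 < \<theta>" "\<theta> \<le> 1/2" "\<theta> powr \<alpha> \<le> radial (5/4) / 8" "\<theta> powr (\<alpha> * q - c) \<ge> 2 powr (c + 1)"
    using powr_base_exists \<alpha>(1) by metis
  define \<delta> where "\<delta> = 1 / (80 * real ?n)"
  define s where "s = (\<lambda>k. \<delta> / 64 * \<theta> ^ k)"
  \<comment> \<open>The numerator 2 exhausts the slot, as \<open>4 * s k * N k\<close> is at most
    \<delta>/2^k/8. Since \<theta> \<le> 1/2 the argument is at least 2, so rounding down loses at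
    most a factor 2.\<close>
  define N where "N = (\<lambda>k. nat \<lfloor>2 / (2 * \<theta>) ^ k\<rfloor>)"
  have \<delta>: "\<delta> > 0" using n by (simp add: \<delta>_def)
  have s: "0 < s k" for k using \<theta> \<delta> by (simp add: s_def)
  have x: "2 / (2 * \<theta>) ^ k \<ge> 2" for k
  proof -
    have "(2 * \<theta>) ^ k \<le> 1" "0 < (2 * \<theta>) ^ k" using \<theta>(1,2) power_le_one[of "2 * \<theta>" k] by simp_all
    then show ?thesis by (simp only: pos_le_divide_eq)
  qed
  have N: "real (N k) \<le> 2 / (2 * \<theta>) ^ k" "real (N k) \<ge> 1 / (2 * \<theta>) ^ k" for k
  proof -
    define X where "X = 2 / (2 * \<theta>) ^ k"
    have X: "X \<ge> 2" using x[of k] by (simp only: X_def)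
    have "N k = nat \<lfloor>X\<rfloor>" by (simp only: N_def X_def)
    then have "real (N k) = of_int \<lfloor>X\<rfloor>" using X by simp
    then have "real (N k) \<le> X" "real (N k) \<ge> X / 2" using X by linarith+
    then show "real (N k) \<le> 2 / (2 * \<theta>) ^ k" "real (N k) \<ge> 1 / (2 * \<theta>) ^ k"
      by (simp_all add: X_def)
  qed
  define i0 :: 'n where "i0 = undefined"
  let ?I = "\<lambda>k. grid i0 (N k)"
  interpret bump_family i0 s \<alpha> ?I "centre i0 \<delta> s"
  proof (rule bump_family_grid[OF n \<alpha> \<delta>_def s])
    fix k
    have "\<theta> ^ k \<le> (1/2) ^ k" using \<theta> by (intro power_mono) auto
    then have "\<delta> / 64 * \<theta> ^ k \<le> \<delta> / 64 * (1/2) ^ k" using \<delta> by (intro mult_left_mono) auto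
    then show "s k \<le> \<delta> / 2 ^ k / 64" by (simp add: s_def power_divide)
    have "s (Suc k) = \<theta> * s k" by (simp add: s_def)
    then have "s (Suc k) powr \<alpha> = \<theta> powr \<alpha> * s k powr \<alpha>"
      using \<theta>(1) s[of k] by (simp add: powr_mult)
    also have "\<dots> \<le> radial (5/4) / 8 * s k powr \<alpha>" using \<theta>(3) by (intro mult_right_mono) auto
    finally show "s (Suc k) powr \<alpha> \<le> radial (5/4) / 8 * s k powr \<alpha>" .
    have "4 * s k * real (N k) \<le> 4 * s k * (2 / (2 * \<theta>) ^ k)"
      using N(1)[of k] s[of k] by (intro mult_left_mono) auto
    also have "\<dots> = \<delta> / 2 ^ k / 8" using \<theta>(1) by (simp add: s_def power_mult_distrib)
    finally show "4 * s k * real (N k) \<le> \<delta> / 2 ^ k / 8" .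
  qed
  show thesis
  proof (rule that[of V])
    show "continuous_on UNIV V" by (rule continuous_on_V)
    show "V \<in> holder_space \<alpha> (ball 0 1)" by (rule V_in_holder_space)
    show "(\<lambda>y. real_of_int (brouwer_deg V (ball 0 1) y)) \<notin> sobolev \<beta> p"
    proof (rule degree_not_in_sobolev[OF p \<beta>])
      define C where "C = (\<delta> / 64) powr (\<alpha> * q)"
      have C: "C > 0" using \<delta> by (simp add: C_def)
      have lower: "real (card (?I k)) powr p * (s k powr \<alpha>) powr (real ?n - \<beta> * p) \<ge> C * 2 ^ k" for k
      proof -
        have tk: "\<theta> ^ k = \<theta> powr real k" "(2 * \<theta>) ^ k = (2 * \<theta>) powr real k"
          using \<theta>(1) by (simp_all add: powr_realpow)
        have "real (card (?I k)) = real (N k) ^ (?n - 1)" by (simp add: card_grid)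
        also have "\<dots> \<ge> (1 / (2 * \<theta>) ^ k) ^ (?n - 1)"
          using N(2)[of k] \<theta>(1) by (intro power_mono) auto
        finally have "((1 / (2 * \<theta>) ^ k) ^ (?n - 1)) powr p \<le> real (card (?I k)) powr p"
          using p \<theta>(1) by (intro powr_mono2) auto
        moreover have "((1 / (2 * \<theta>) ^ k) ^ (?n - 1)) powr p = (2 * \<theta>) powr (- (real k * c))"
        proof -
          have "(1 / (2 * \<theta>) ^ k) ^ (?n - 1) = ((2 * \<theta>) powr (- real k)) powr real (?n - 1)"
          proof -
            have "1 / (2 * \<theta>) ^ k = (2 * \<theta>) powr (- real k)" by (simp only: tk(2) powr_minus_divide)
            moreover have "(2 * \<theta>) powr (- real k) > 0" using \<theta>(1) by simp
            ultimately show ?thesis by (simp only: powr_realpow)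
          qed
          then have "((1 / (2 * \<theta>) ^ k) ^ (?n - 1)) powr p = (2 * \<theta>) powr (- real k * real (?n - 1) * p)"
            by (simp only: powr_powr)
          moreover have "- real k * real (?n - 1) * p = - (real k * c)" using n by (simp add: c_def of_nat_diff)
          ultimately show ?thesis by (simp only:)
        qed
        moreover have "(s k powr \<alpha>) powr (real ?n - \<beta> * p) = C * \<theta> powr (real k * (\<alpha> * q))"
        proof -
          have "(s k powr \<alpha>) powr (real ?n - \<beta> * p) = s k powr (\<alpha> * q)" by (simp only: powr_powr q_def)
          also have "\<dots> = (\<delta> / 64) powr (\<alpha> * q) * (\<theta> powr real k) powr (\<alpha> * q)"
            unfolding s_def tk by (rule powr_mult)
          finally show ?thesis by (simp only: C_def powr_powr)
        qed
        ultimately have "real (card (?I k)) powr p * (s k powr \<alpha>) powr (real ?n - \<beta> * p) \<ge>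
            (2 * \<theta>) powr (- (real k * c)) * (C * \<theta> powr (real k * (\<alpha> * q)))"
          using C by (simp add: mult_right_mono)
        moreover have "(2 * \<theta>) powr (- (real k * c)) * (C * \<theta> powr (real k * (\<alpha> * q))) =
            C * (2 powr (- c) * \<theta> powr (\<alpha> * q - c)) ^ k"
        proof -
          have "(2 * \<theta>) powr (- (real k * c)) = 2 powr (- c * real k) * \<theta> powr (- (real k * c))"
            using \<theta>(1) by (simp add: powr_mult mult.commute)
          moreover have "\<theta> powr (- (real k * c)) * \<theta> powr (real k * (\<alpha> * q)) = \<theta> powr ((\<alpha> * q - c) * real k)"
            by (simp add: powr_add[symmetric] algebra_simps)
          moreover have "(2 powr (- c) * \<theta> powr (\<alpha> * q - c)) ^ k = 2 powr (- c * real k) * \<theta> powr ((\<alpha> * q - c) * real k)"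
            using \<theta>(1) by (simp add: power_mult_distrib powr_powr powr_realpow[symmetric])
          ultimately show ?thesis by (simp add: mult_ac)
        qed
        moreover have "2 \<le> 2 powr (- c) * \<theta> powr (\<alpha> * q - c)"
        proof -
          have "2 powr (- c) * 2 powr (c + 1) \<le> 2 powr (- c) * \<theta> powr (\<alpha> * q - c)"
            using \<theta>(4) by (intro mult_left_mono) auto
          moreover have "(2::real) powr (- c) * 2 powr (c + 1) = 2" by (simp flip: powr_add)
          ultimately show ?thesis by simp
        qed
        then have "C * 2 ^ k \<le> C * (2 powr (- c) * \<theta> powr (\<alpha> * q - c)) ^ k"
          using C by (intro mult_left_mono power_mono) auto
        ultimately show ?thesis by linarith
      qed
      show "\<exists>k. M \<le> real (card (?I k)) powr p * (s k powr \<alpha>) powr (real ?n - \<beta> * p)" for M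
      proof -
        obtain k where "M / C < 2 ^ k" using real_arch_pow[of 2 "M / C"] by auto
        then have "M \<le> C * 2 ^ k" using C by (simp add: pos_divide_less_eq mult.commute)
        then show ?thesis using lower[of k] order_trans by blast
      qed
    qed
  qed
qed

lemma ident_in_holder_space:
  assumes "0 \<le> \<alpha>" "\<alpha> \<le> 1"
  shows "(\<lambda>x. x) \<in> holder_space \<alpha> (ball (0::real^'n) 1)"
proof (cases "\<alpha> = 0")
  case True
  then show ?thesis by (auto simp: holder_space_def intro!: exI[of _ "\<lambda>x. x"])
next
  case False
  have "norm (x - y) \<le> 2 * norm (x - y) powr \<alpha>" if "x \<in> ball 0 1" "y \<in> ball 0 1" for x y :: "real^'n"
  proof (cases "norm (x - y) \<le> 1")
    case True
    then have "norm (x - y) \<le> norm (x - y) powr \<alpha>" using assms by (intro le_powr_of_le_one) auto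
    moreover have "0 \<le> norm (x - y) powr \<alpha>" by simp
    ultimately show ?thesis by linarith
  next
    case False
    then have "1 \<le> norm (x - y) powr \<alpha>" using assms by (intro ge_one_powr_ge_zero) auto
    moreover have "norm (x - y) \<le> 2" using norm_triangle_ineq4[of x y] that by simp
    ultimately show ?thesis by linarith
  qed
  then have "\<forall>x\<in>ball 0 1. \<forall>y\<in>ball (0::real^'n) 1. norm (x - y) \<le> 2 * norm (x - y) powr \<alpha>" by blast
  then show ?thesis using False unfolding holder_space_def by auto
qed

theorem corollary1p4:
  fixes p \<alpha> \<beta> :: real
  assumes "CARD('n::finite) \<ge> 2"
    and "p \<ge> 1"
    and "0 \<le> \<alpha>" and "\<alpha> \<le> 1"
    and "\<beta> \<ge> 0"
    and "\<alpha> \<noteq> 0 \<Longrightarrow> \<beta> > real CARD('n) / p - (real CARD('n) - 1) / \<alpha>"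
  shows "\<exists>v :: real^'n \<Rightarrow> real^'n.
           v \<in> holder_space \<alpha> (ball 0 1) \<and>
           (\<lambda>y. real_of_int (brouwer_deg v (ball 0 1) y)) \<notin> sobolev \<beta> p"
proof -
  consider "\<beta> \<ge> 1" | "\<beta> < 1" "\<alpha> \<noteq> 0" | "\<beta> < 1" "\<alpha> = 0" by linarith
  then show ?thesis
  proof cases
    case 1
    then have "(\<lambda>y. real_of_int (brouwer_deg (\<lambda>x. x) (ball (0::real^'n) 1) y)) \<notin> sobolev \<beta> p"
      unfolding brouwer_deg_ident by (intro indicator_ball_not_in_sobolev assms)
    then show ?thesis using ident_in_holder_space assms by blast
  next
    case 2
    then obtain v :: "real^'n \<Rightarrow> real^'n" where "v \<in> holder_space \<alpha> (ball 0 1)"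
      "(\<lambda>y. real_of_int (brouwer_deg v (ball 0 1) y)) \<notin> sobolev \<beta> p"
      using rough_degree_fractional[where 'n='n, of p \<alpha> \<beta>] assms by force
    then show ?thesis by blast
  next
    case 3
    define n where "n = real CARD('n)"
    have n: "n \<ge> 2" using assms(1) by (simp add: n_def)
    \<comment> \<open>A positive exponent with (n - 1)/a \<ge> n/p + 1, so that the lower bound on
      \<beta> is at most -1 and holds for every \<beta> \<ge> 0. The map obtained for
      \<open>a\<close> is continuous, which is what exponent 0 asks for.\<close>
    define a where "a = min 1 ((n - 1) / (n / p + 1))"
    have np: "n / p + 1 > 0" using n assms(2) by (simp add: add_pos_pos)
    have a: "0 < a" "a \<le> 1" "a * (n / p + 1) \<le> n - 1"
      using n np by (auto simp: a_def min_def pos_le_divide_eq)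
    then have "n / p + 1 \<le> (n - 1) / a" by (simp add: pos_le_divide_eq mult.commute)
    then have "\<beta> > real CARD('n) / p - (real CARD('n) - 1) / a" using assms(5) by (simp add: n_def)
    then obtain v :: "real^'n \<Rightarrow> real^'n" where v: "continuous_on UNIV v"
      "(\<lambda>y. real_of_int (brouwer_deg v (ball 0 1) y)) \<notin> sobolev \<beta> p"
      using rough_degree_fractional[where 'n='n, of p a \<beta>] assms a 3 by force
    have "v \<in> holder_space 0 (ball 0 1)"
      using continuous_on_subset[OF v(1)] by (auto simp: holder_space_def intro!: exI[of _ v])
    then show ?thesis using v(2) 3 by blast
  qed
qed

end
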